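(* For every partition $\mu$, $$\hat s_{1}(y\|a)\,\hat s_\mu(y\|a)=\sum_\lambda\sum_{D_-}\mathrm{wt}(D_-)\,\hat s_\lambda(y\|a),$$ where for each partition $\lambda$ the inner sum is over all distinct pairs $D_-$ that can be obtained from some nonempty $\Lambda$-decomposition $D=(\lambda/\rho,\rho/\mu)$ of $\lambda/\mu$ (with outer shape $\lambda$).
   Context: Partitions are drawn in English notation; box $(i,j)$ is in row $i$, column $j$. A vertical strip is a skew shape with at most one box per row; a horizontal strip has at most one box per column. A $\Lambda$-decomposition of a skew shape $\lambda/\mu$ is a pair $D=(\lambda/\rho,\rho/\mu)$ with $\mu\subseteq\rho\subseteq\lambda$, $\lambda/\rho$ a vertical strip and $\rho/\mu$ a horizontal strip; it is nonempty if $\lambda/\mu\neq\emptyset$. The weight of a pair $(A,B)$ of sets of boxes (in particular of $D$) is $\mathrm{wt}=\prod_{(i,j)\in A}(a_{j-i+1}-a_0)\prod_{(i,j)\in B}(a_1-a_{j-i+1})\in\mathbb{Q}[a]$. $D_-$ is obtained from $D$ by removing the northeastmost box of $\lambda/\mu$ (the rightmost box in its top nonempty row) from whichever of $\lambda/\rho$, $\rho/\mu$ contains it. $\mathbb{Q}[a]=\mathbb{Q}[a_i\mid i\in\mathbb{Z}]$. $\hat\Lambda(y\|a)$: formal sums $\sum c_\lambda s_\lambda(y)$, $c_\lambda\in\mathbb{Q}[a]$, of Schur functions in $y_0,y_{-1},\dots$ (a ring). $\Lambda(x\|a)$: $\mathbb{Q}[a]$-algebra generated by $p_k(x\|a)=\sum_{i\le0}(x_i^k-a_i^k)$;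 $f(x/a)$ is the image of $f$ under $p_k\mapsto p_k(x\|a)$; pairing $\langle s_\lambda(x/a),s_\mu(y)\rangle=\delta_{\lambda\mu}$. Double Schur: with $\gamma_a$ ($a_i\mapsto a_{i+1}$, $p_k(x\|a)\mapsto p_k(x\|a)-a_1^k$), $h_r(x\|a)=\gamma_a^{r-1}h_r(x/a)$ and $s_\lambda(x\|a)=\det(\gamma_a^{1-j}h_{\lambda_i-i+j}(x\|a))$. Dual Schur functions $\hat s_\mu(y\|a)$ are defined by $\langle s_\lambda(x\|a),\hat s_\mu(y\|a)\rangle=\delta_{\lambda\mu}$; $\hat s_1$ is the case $\mu=(1)$. *)

theory Defs
  imports "HOL-Library.Poly_Mapping" "Jordan_Normal_Form.Determinant"
begin

text \<open>
  Formal power series over \<open>'a\<close> in commuting variables indexed by \<open>'v\<close> (possibly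
  infinitely many): arbitrary coefficient functions on the monomials \<open>'v \<Rightarrow>\<^sub>0 nat\<close>.
\<close>

typedef ('v, 'a) mfps = "UNIV :: (('v \<Rightarrow>\<^sub>0 nat) \<Rightarrow> 'a) set"
  morphisms mcoeff Mfps ..

lemma mfps_eqI:
  assumes "\<And>m. mcoeff F m = mcoeff G m"
  shows "F = G"
proof -
  have "mcoeff F = mcoeff G"
    by (rule ext) (rule assms)
  then show ?thesis
    by (simp add: mcoeff_inject)
qed

definition splits :: "('v \<Rightarrow>\<^sub>0 nat) \<Rightarrow> (('v \<Rightarrow>\<^sub>0 nat) \<times> ('v \<Rightarrow>\<^sub>0 nat)) set" where
  "splits m = {(u, w). u + w = m}"

lemma finite_splits: "finite (splits m)"
proof -
  let ?K = "Poly_Mapping.keys m"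
  let ?P = "PiE ?K (\<lambda>k. {..Poly_Mapping.lookup m k})"
  let ?f = "\<lambda>u. restrict (Poly_Mapping.lookup u) ?K"
  have fin: "finite ?P"
    by (rule finite_PiE) simp_all
  have le: "Poly_Mapping.lookup u k \<le> Poly_Mapping.lookup m k" if "(u, w) \<in> splits m" for u w k
    using that by (auto simp: splits_def lookup_add)
  have "inj_on ?f (fst ` splits m)"
  proof (rule inj_onI)
    fix u u' assume u: "u \<in> fst ` splits m" and u': "u' \<in> fst ` splits m" and eq: "?f u = ?f u'"
    show "u = u'"
    proof (rule poly_mapping_eqI)
      fix k
      show "Poly_Mapping.lookup u k = Poly_Mapping.lookup u' k"
      proof (cases "k \<in> ?K")
        case True
        then show ?thesis using fun_cong[OF eq, of k] by simp
      next
        case False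
        then have "Poly_Mapping.lookup m k = 0" by (simp add: in_keys_iff)
        then show ?thesis using u u' le by (metis imageE le_zero_eq prod.collapse)
      qed
    qed
  qed
  moreover have "?f ` fst ` splits m \<subseteq> ?P"
    using le by fastforce
  ultimately have "finite (fst ` splits m)"
    using fin by (meson finite_imageD finite_subset)
  moreover have "inj_on fst (splits m)"
    by (auto simp: inj_on_def splits_def)
  ultimately show ?thesis by (rule finite_imageD)
qed

lemma splits_0 [simp]: "splits 0 = {(0, 0)}"
proof -
  have "u = 0 \<and> w = 0" if "u + w = 0" for u w :: "'v \<Rightarrow>\<^sub>0 nat"
    using that by (simp add: poly_mapping_eq_iff lookup_add fun_eq_iff)
  then show ?thesis by (auto simp: splits_def)
qed

lemma mcoeff_Mfps [simp]: "mcoeff (Mfps f) = f"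
  by (simp add: Mfps_inverse)

instantiation mfps :: (type, comm_ring_1) comm_ring_1
begin

definition zero_mfps :: "('a, 'b) mfps" where
  "zero_mfps = Mfps (\<lambda>m. 0)"

definition one_mfps :: "('a, 'b) mfps" where
  "one_mfps = Mfps (\<lambda>m. if m = 0 then 1 else 0)"

definition plus_mfps :: "('a, 'b) mfps \<Rightarrow> ('a, 'b) mfps \<Rightarrow> ('a, 'b) mfps" where
  "plus_mfps F G = Mfps (\<lambda>m. mcoeff F m + mcoeff G m)"

definition minus_mfps :: "('a, 'b) mfps \<Rightarrow> ('a, 'b) mfps \<Rightarrow> ('a, 'b) mfps" where
  "minus_mfps F G = Mfps (\<lambda>m. mcoeff F m - mcoeff G m)"

definition uminus_mfps :: "('a, 'b) mfps \<Rightarrow> ('a, 'b) mfps" where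
  "uminus_mfps F = Mfps (\<lambda>m. - mcoeff F m)"

definition times_mfps :: "('a, 'b) mfps \<Rightarrow> ('a, 'b) mfps \<Rightarrow> ('a, 'b) mfps" where
  "times_mfps F G = Mfps (\<lambda>m. \<Sum>(u, w) \<in> splits m. mcoeff F u * mcoeff G w)"

lemmas mfps_defs = zero_mfps_def one_mfps_def plus_mfps_def minus_mfps_def uminus_mfps_def
  times_mfps_def

instance
proof
  fix A B C :: "('a, 'b) mfps"
  show "A * B * C = A * (B * C)"
  proof (rule mfps_eqI)
    fix m
    have "mcoeff (A * B * C) m =
        (\<Sum>(s, w) \<in> splits m. \<Sum>(u, v) \<in> splits s. mcoeff A u * mcoeff B v * mcoeff C w)"
      by (simp add: mfps_defs sum_distrib_right case_prod_beta)
    also have "\<dots> = (\<Sum>(p, q) \<in> Sigma (splits m) (\<lambda>p. splits (fst p)).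
        mcoeff A (fst q) * mcoeff B (snd q) * mcoeff C (snd p))"
      by (subst sum.Sigma[symmetric]) (auto simp: finite_splits case_prod_beta)
    also have "\<dots> = (\<Sum>(p, q) \<in> Sigma (splits m) (\<lambda>p. splits (snd p)).
        mcoeff A (fst p) * mcoeff B (fst q) * mcoeff C (snd q))"
      by (rule sum.reindex_bij_witness[where
            i = "\<lambda>((u, s), (v, w)). ((u + v, w), (u, v))" and
            j = "\<lambda>((s, w), (u, v)). ((u, v + w), (v, w))"])
         (auto simp: splits_def add.assoc)
    also have "\<dots> = (\<Sum>(u, s) \<in> splits m. \<Sum>(v, w) \<in> splits s. mcoeff A u * mcoeff B v * mcoeff C w)"
      by (subst sum.Sigma[symmetric]) (auto simp: finite_splits case_prod_beta)
    also have "\<dots> = mcoeff (A * (B * C)) m"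
      by (simp add: mfps_defs sum_distrib_left case_prod_beta mult.assoc)
    finally show "mcoeff (A * B * C) m = mcoeff (A * (B * C)) m" .
  qed
  show "A * B = B * A"
  proof (rule mfps_eqI)
    fix m
    show "mcoeff (A * B) m = mcoeff (B * A) m"
      unfolding mfps_defs mcoeff_Mfps
      by (rule sum.reindex_bij_witness[where i = prod.swap and j = prod.swap])
         (auto simp: splits_def add.commute mult.commute)
  qed
  show "1 * A = A"
  proof (rule mfps_eqI)
    fix m
    have "mcoeff (1 * A) m = (\<Sum>p \<in> splits m. if p = (0, m) then mcoeff A m else 0)"
      unfolding mfps_defs mcoeff_Mfps
      by (rule sum.cong) (auto simp: splits_def split: if_splits)
    also have "\<dots> = mcoeff A m"
      by (simp add: finite_splits) (simp add: splits_def)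
    finally show "mcoeff (1 * A) m = mcoeff A m" .
  qed
  show "(A + B) * C = A * C + B * C"
    by (rule mfps_eqI)
       (simp add: mfps_defs case_prod_beta distrib_right sum.distrib)
  show "(0 :: ('a, 'b) mfps) \<noteq> 1"
  proof
    assume "(0 :: ('a, 'b) mfps) = 1"
    then have "mcoeff (0 :: ('a, 'b) mfps) 0 = mcoeff (1 :: ('a, 'b) mfps) 0"
      by simp
    then show False
      by (simp add: mfps_defs)
  qed
qed (rule mfps_eqI, simp add: mfps_defs add_ac)+

end

definition mconst :: "'a::zero \<Rightarrow> ('v, 'a) mfps" where
  "mconst c = Mfps (\<lambda>m. if m = 0 then c else 0)"

text \<open>
  \<open>S\<close> is the formal sum of the possibly infinite family \<open>F i\<close>, \<open>i \<in> I\<close>: every monomial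
  occurs in only finitely many members, and coefficients add up.
\<close>

definition has_formal_sum :: "('i \<Rightarrow> ('v, 'c::comm_ring_1) mfps) \<Rightarrow> 'i set \<Rightarrow> ('v, 'c) mfps \<Rightarrow> bool"
  where "has_formal_sum F I S \<longleftrightarrow>
    (\<forall>m. finite {i \<in> I. mcoeff (F i) m \<noteq> 0} \<and>
         mcoeff S m = (\<Sum>i \<in> {i \<in> I. mcoeff (F i) m \<noteq> 0}. mcoeff (F i) m))"

text \<open>
  Evaluation of a polynomial at \<open>v\<close>, its coefficients being mapped by \<open>\<phi>\<close>.
\<close>

definition poly_subst ::
    "('c::zero \<Rightarrow> 'r::comm_ring_1) \<Rightarrow> ('v \<Rightarrow> 'r) \<Rightarrow> (('v \<Rightarrow>\<^sub>0 nat) \<Rightarrow>\<^sub>0 'c) \<Rightarrow> 'r" where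
  "poly_subst \<phi> v P =
    (\<Sum>m \<in> Poly_Mapping.keys P. \<phi> (Poly_Mapping.lookup P m) *
      (\<Prod>k \<in> Poly_Mapping.keys m. v k ^ Poly_Mapping.lookup m k))"


section \<open>Partitions and skew shapes\<close>

definition partitions :: "nat list set" where
  "partitions = {\<nu>. sorted_wrt (\<ge>) \<nu> \<and> 0 \<notin> set \<nu>}"

definition diagram :: "nat list \<Rightarrow> (nat \<times> nat) set" where
  "diagram \<nu> = {(i, j). 1 \<le> i \<and> i \<le> length \<nu> \<and> 1 \<le> j \<and> j \<le> \<nu> ! (i - 1)}"

definition skew :: "nat list \<Rightarrow> nat list \<Rightarrow> (nat \<times> nat) set" where
  "skew \<nu> \<mu> = diagram \<nu> - diagram \<mu>"

definition vertical_strip :: "(nat \<times> nat) set \<Rightarrow> bool" where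
  "vertical_strip A \<longleftrightarrow> (\<forall>i. card {j. (i, j) \<in> A} \<le> 1)"

definition horizontal_strip :: "(nat \<times> nat) set \<Rightarrow> bool" where
  "horizontal_strip A \<longleftrightarrow> (\<forall>j. card {i. (i, j) \<in> A} \<le> 1)"

definition Lambda_decompositions ::
    "nat list \<Rightarrow> nat list \<Rightarrow> ((nat \<times> nat) set \<times> (nat \<times> nat) set) set" where
  "Lambda_decompositions \<nu> \<mu> =
    {(skew \<nu> \<rho>, skew \<rho> \<mu>) | \<rho>. \<rho> \<in> partitions \<and>
       diagram \<mu> \<subseteq> diagram \<rho> \<and> diagram \<rho> \<subseteq> diagram \<nu> \<and>
       vertical_strip (skew \<nu> \<rho>) \<and> horizontal_strip (skew \<rho> \<mu>)}"

definition northeastmost :: "(nat \<times> nat) set \<Rightarrow> nat \<times> nat" where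
  "northeastmost A = (let i = Min (fst ` A) in (i, Max {j. (i, j) \<in> A}))"

text \<open>
  All pairs \<open>D\<^sub>-\<close> arising from nonempty \<open>\<Lambda>\<close>-decompositions \<open>D\<close> of \<open>\<nu>/\<mu>\<close>;
  this is a set, so pairs arising from several \<open>D\<close> occur once.
\<close>

definition D_minus :: "nat list \<Rightarrow> nat list \<Rightarrow> ((nat \<times> nat) set \<times> (nat \<times> nat) set) set" where
  "D_minus \<nu> \<mu> =
    {(A - {northeastmost (skew \<nu> \<mu>)}, B - {northeastmost (skew \<nu> \<mu>)}) | A B.
       (A, B) \<in> Lambda_decompositions \<nu> \<mu> \<and> skew \<nu> \<mu> \<noteq> {}}"


section \<open>The coefficient ring and weights\<close>

text \<open>The polynomial ring \<open>\<rat>[a\<^sub>i | i \<in> \<int>]\<close>.\<close>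

type_synonym Qa = "(int \<Rightarrow>\<^sub>0 nat) \<Rightarrow>\<^sub>0 rat"

definition avar :: "int \<Rightarrow> Qa" where
  "avar i = Poly_Mapping.single (Poly_Mapping.single i 1) 1"

definition wt :: "(nat \<times> nat) set \<times> (nat \<times> nat) set \<Rightarrow> Qa" where
  "wt D = (\<Prod>(i, j) \<in> fst D. avar (int j - int i + 1) - avar 0) *
          (\<Prod>(i, j) \<in> snd D. avar 1 - avar (int j - int i + 1))"


section \<open>Symmetric functions\<close>

text \<open>
  The alphabets \<open>x\<^sub>0, x\<^sub>-\<^sub>1, \<dots>\<close> and \<open>y\<^sub>0, y\<^sub>-\<^sub>1, \<dots>\<close> are indexed by \<open>nat\<close>: index \<open>i\<close> stands
  for \<open>x\<^sub>-\<^sub>i\<close> or \<open>y\<^sub>-\<^sub>i\<close>. The complete symmetric function \<open>hsym r\<close> takes an integer index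
  and is \<open>0\<close> for \<open>r < 0\<close>; \<open>psum k\<close> is meant for \<open>k \<ge> 1\<close>.
\<close>

definition psum :: "nat \<Rightarrow> (nat, 'c::comm_ring_1) mfps" where
  "psum k = Mfps (\<lambda>m. if \<exists>i. m = Poly_Mapping.single i k then 1 else 0)"

definition hsym :: "int \<Rightarrow> (nat, 'c::comm_ring_1) mfps" where
  "hsym r = Mfps (\<lambda>m. if int (\<Sum>i \<in> Poly_Mapping.keys m. Poly_Mapping.lookup m i) = r then 1 else 0)"

text \<open>
  Schur functions by the Jacobi--Trudi determinant, whose rows and columns are numbered
  from \<open>0\<close> here.
\<close>

definition schur :: "nat list \<Rightarrow> (nat, 'c::comm_ring_1) mfps" where
  "schur \<nu> = det (mat (length \<nu>) (length \<nu>) (\<lambda>(i, j). hsym (int (\<nu> ! i) - int i + int j)))"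

definition Lambda_hat :: "(nat, Qa) mfps set" where
  "Lambda_hat = {g. \<exists>c. has_formal_sum (\<lambda>\<nu>. mconst (c \<nu>) * schur \<nu>) partitions g}"


section \<open>Double symmetric functions\<close>

text \<open>
  Elements of \<open>\<Lambda>(x\<parallel>a)\<close> are formal power series in the \<open>x\<^sub>i\<close> (\<open>i \<le> 0\<close>) and the \<open>a\<^sub>i\<close>
  (\<open>i \<in> \<int>\<close>), organised as series in \<open>x\<close> over \<open>\<rat>[[a]]\<close>; the latter is needed since
  \<open>p\<^sub>k(x\<parallel>a)\<close> involves infinitely many \<open>a\<^sub>i\<close>.
\<close>

type_synonym xa_series = "(nat, (int, rat) mfps) mfps"

definition Qa_embed :: "Qa \<Rightarrow> xa_series" where
  "Qa_embed c = mconst (Mfps (Poly_Mapping.lookup c))"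

definition a_psum :: "nat \<Rightarrow> (int, rat) mfps" where
  "a_psum k = Mfps (\<lambda>m. if \<exists>i \<le> 0. m = Poly_Mapping.single i k then 1 else 0)"

definition p_xa :: "nat \<Rightarrow> xa_series" where
  "p_xa k = psum k - mconst (a_psum k)"

definition Lambda_xa :: "xa_series set" where
  "Lambda_xa = range (poly_subst Qa_embed (\<lambda>k. p_xa (Suc k)))"

text \<open>
  \<open>super f\<close> is \<open>f(x/a)\<close> for a symmetric function \<open>f\<close>: write \<open>f\<close> as a polynomial in the
  power sums and replace each \<open>p\<^sub>k\<close> by \<open>p\<^sub>k(x\<parallel>a)\<close>. Variable \<open>k\<close> of the polynomial stands for
  \<open>p\<^sub>k\<^sub>+\<^sub>1\<close>.
\<close>

definition super :: "(nat, rat) mfps \<Rightarrow> xa_series" where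
  "super f = poly_subst (\<lambda>q. mconst (mconst q)) (\<lambda>k. p_xa (Suc k))
     (THE P. poly_subst mconst (\<lambda>k. psum (Suc k)) P = f)"

text \<open>
  \<open>gamma n\<close> is the power \<open>\<gamma>\<^sub>a\<^sup>n\<close>, \<open>n \<in> \<int>\<close>: replace every \<open>a\<^sub>i\<close> by \<open>a\<^sub>i\<^sub>+\<^sub>n\<close>, also inside the
  infinite sums \<open>p\<^sub>k(x\<parallel>a)\<close>, and keep the \<open>x\<^sub>i\<close>. The lemmas below show that \<open>gamma 1\<close> is a ring
  homomorphism with the values defining \<open>\<gamma>\<^sub>a\<close> on the generators and that the \<open>gamma n\<close>
  are its powers.
\<close>

definition shift_mon :: "int \<Rightarrow> (int \<Rightarrow>\<^sub>0 nat) \<Rightarrow> (int \<Rightarrow>\<^sub>0 nat)" where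
  "shift_mon n m = Poly_Mapping.map_key (\<lambda>i. i + n) m"

definition shift_a :: "int \<Rightarrow> (int, rat) mfps \<Rightarrow> (int, rat) mfps" where
  "shift_a n G = Mfps (\<lambda>m. mcoeff G (shift_mon n m))"

definition gamma :: "int \<Rightarrow> xa_series \<Rightarrow> xa_series" where
  "gamma n F = Mfps (\<lambda>m. shift_a n (mcoeff F m))"

lemma lookup_shift: "Poly_Mapping.lookup (shift_mon n m) j = Poly_Mapping.lookup m (j + n)"
  by (simp add: shift_mon_def map_key.rep_eq inj_def)

lemma shift_shift: "shift_mon n (shift_mon n' m) = shift_mon (n + n') m"
  by (rule poly_mapping_eqI) (simp add: lookup_shift add.assoc)

lemma shift_0 [simp]: "shift_mon 0 m = m"
  by (rule poly_mapping_eqI) (simp add: lookup_shift)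

lemma shift_add: "shift_mon n (u + w) = shift_mon n u + shift_mon n w"
  by (rule poly_mapping_eqI) (simp add: lookup_shift lookup_add)

lemma shift_inverse [simp]: "shift_mon n (shift_mon (- n) m) = m" "shift_mon (- n) (shift_mon n m) = m"
  by (simp_all add: shift_shift)

lemma shift_eq_iff: "shift_mon n m = m' \<longleftrightarrow> m = shift_mon (- n) m'"
  by auto

lemma eq_shift_iff: "m' = shift_mon n m \<longleftrightarrow> shift_mon (- n) m' = m"
  by auto

lemma shift_single [simp]: "shift_mon n (Poly_Mapping.single i k) = Poly_Mapping.single (i - n) k"
  by (rule poly_mapping_eqI) (auto simp: lookup_shift lookup_single when_def)

lemma shift_zero [simp]: "shift_mon n m = 0 \<longleftrightarrow> m = 0"
  by (metis shift_inverse(2) shift_single single_zero)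

lemma shift_a_0: "shift_a n 0 = 0"
  by (simp add: shift_a_def zero_mfps_def)

lemma shift_a_1: "shift_a n 1 = 1"
  by (simp add: shift_a_def one_mfps_def)

lemma shift_a_add: "shift_a n (F + G) = shift_a n F + shift_a n G"
  by (simp add: shift_a_def plus_mfps_def)

lemma shift_a_diff: "shift_a n (F - G) = shift_a n F - shift_a n G"
  by (simp add: shift_a_def minus_mfps_def)

lemma shift_a_sum: "shift_a n (sum f I) = (\<Sum>i \<in> I. shift_a n (f i))"
  by (induction I rule: infinite_finite_induct) (simp_all add: shift_a_0 shift_a_add)

lemma shift_a_mult: "shift_a n (F * G) = shift_a n F * shift_a n G"
  unfolding shift_a_def times_mfps_def mcoeff_Mfps
  by (intro mfps_eqI, simp, rule sum.reindex_bij_witness[where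
        i = "\<lambda>(u, w). (shift_mon n u, shift_mon n w)" and
        j = "\<lambda>(u, w). (shift_mon (- n) u, shift_mon (- n) w)"])
     (auto simp: splits_def shift_eq_iff simp flip: shift_add)

lemma gamma_0 [simp]: "gamma 0 F = F"
  using shift_0 by (auto simp: gamma_def shift_a_def intro!: mfps_eqI)

lemma gamma_gamma: "gamma n (gamma n' F) = gamma (n + n') F"
  by (simp add: gamma_def shift_a_def shift_shift add.commute)

lemma gamma_one: "gamma n 1 = 1"
  by (rule mfps_eqI) (simp add: gamma_def one_mfps_def[where ?'a = nat] shift_a_0 shift_a_1)

lemma gamma_add: "gamma n (F + G) = gamma n F + gamma n G"
  by (simp add: gamma_def plus_mfps_def[where ?'a = nat] shift_a_add)

lemma gamma_diff: "gamma n (F - G) = gamma n F - gamma n G"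
  by (simp add: gamma_def minus_mfps_def[where ?'a = nat] shift_a_diff)

lemma gamma_mult: "gamma n (F * G) = gamma n F * gamma n G"
  by (simp add: gamma_def times_mfps_def[where ?'a = nat] shift_a_sum shift_a_mult case_prod_beta)

lemma gamma_mconst: "gamma n (mconst c) = mconst (shift_a n c)"
  by (rule mfps_eqI) (simp add: gamma_def mconst_def shift_a_0)

lemma avar_power: "avar i ^ k = Poly_Mapping.single (Poly_Mapping.single i k) 1"
proof (induction k)
  case (Suc k)
  then show ?case
    by (simp add: avar_def mult_single flip: single_add)
qed simp

lemma gamma_avar: "gamma n (Qa_embed (avar i)) = Qa_embed (avar (i + n))"
proof -
  have "shift_a n (Mfps (Poly_Mapping.lookup (avar i))) = Mfps (Poly_Mapping.lookup (avar (i + n)))"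
    by (rule mfps_eqI)
       (simp add: shift_a_def avar_def lookup_single eq_shift_iff)
  then show ?thesis
    by (simp add: Qa_embed_def gamma_mconst)
qed

lemma gamma_p_xa:
  assumes "k \<ge> 1"
  shows "gamma 1 (p_xa k) = p_xa k - Qa_embed (avar 1 ^ k)"
proof -
  have "gamma 1 (psum k) = psum k"
    by (rule mfps_eqI) (simp add: gamma_def psum_def shift_a_0 shift_a_1)
  moreover have "shift_a 1 (a_psum k) = a_psum k + Mfps (Poly_Mapping.lookup (avar 1 ^ k))"
  proof (rule mfps_eqI)
    fix m :: "int \<Rightarrow>\<^sub>0 nat"
    have inj: "Poly_Mapping.single i k = Poly_Mapping.single j k \<longleftrightarrow> i = j" for i j :: int
      using assms by (metis lookup_single_eq lookup_single_not_eq not_one_le_zero)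
    have "(\<exists>i \<le> 0. shift_mon 1 m = Poly_Mapping.single i k) \<longleftrightarrow>
        (\<exists>i \<le> 0. m = Poly_Mapping.single i k) \<or> Poly_Mapping.single 1 k = m"
      (is "?L \<longleftrightarrow> ?R")
    proof
      assume ?L
      then obtain i where "i \<le> 0" and m: "m = Poly_Mapping.single (i + 1) k"
        by (auto simp: shift_eq_iff)
      then have "i = 0 \<or> i + 1 \<le> 0"
        by linarith
      with m show ?R
        by auto
    next
      assume ?R
      then have "\<exists>j \<le> 1. m = Poly_Mapping.single j k"
        by (metis order.refl order.trans zero_le_one)
      then obtain j where "j \<le> 1" "m = Poly_Mapping.single j k"
        by blast
      then show ?L
        by (intro exI[of _ "j - 1"]) simp
    qed
    moreover have "\<not> ((\<exists>i \<le> 0. m = Poly_Mapping.single i k) \<and> Poly_Mapping.single 1 k = m)"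
      using inj by fastforce
    ultimately show "mcoeff (shift_a 1 (a_psum k)) m =
        mcoeff (a_psum k + Mfps (Poly_Mapping.lookup (avar 1 ^ k))) m"
      by (simp add: shift_a_def a_psum_def plus_mfps_def avar_power lookup_single when_def) blast
  qed
  moreover have "mconst (F + G) = (mconst F + mconst G :: xa_series)" for F G
    by (rule mfps_eqI) (simp add: mconst_def plus_mfps_def[where ?'a = nat])
  ultimately show ?thesis
    by (simp add: p_xa_def gamma_diff gamma_mconst Qa_embed_def)
qed


section \<open>Double Schur functions and their duals\<close>

definition h_double :: "int \<Rightarrow> xa_series" where
  "h_double r = gamma (r - 1) (super (hsym r))"

definition schur_double :: "nat list \<Rightarrow> xa_series" where
  "schur_double \<nu> = det (mat (length \<nu>) (length \<nu>)
     (\<lambda>(i, j). gamma (- int j) (h_double (int (\<nu> ! i) - int i + int j))))"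

text \<open>
  The coordinates of an element of \<open>\<Lambda>(x\<parallel>a)\<close> in its \<open>\<rat>[a]\<close>-basis \<open>s\<^sub>\<nu>(x/a)\<close>, and those of
  an element of \<open>Lambda_hat\<close> with respect to the \<open>s\<^sub>\<nu>(y)\<close>.
\<close>

definition x_coords :: "xa_series \<Rightarrow> nat list \<Rightarrow> Qa" where
  "x_coords f = (THE c. {\<nu>. c \<nu> \<noteq> 0} \<subseteq> partitions \<and> finite {\<nu>. c \<nu> \<noteq> 0} \<and>
     f = (\<Sum>\<nu> \<in> {\<nu>. c \<nu> \<noteq> 0}. Qa_embed (c \<nu>) * super (schur \<nu>)))"

definition y_coords :: "(nat, Qa) mfps \<Rightarrow> nat list \<Rightarrow> Qa" where
  "y_coords g = (THE c. {\<nu>. c \<nu> \<noteq> 0} \<subseteq> partitions \<and>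
     has_formal_sum (\<lambda>\<nu>. mconst (c \<nu>) * schur \<nu>) partitions g)"

text \<open>
  The \<open>\<rat>[a]\<close>-bilinear pairing of \<open>\<Lambda>(x\<parallel>a)\<close> with \<open>Lambda_hat\<close>, extended to formal sums
  in the second argument, with \<open>\<langle>s\<^sub>\<nu>(x/a), s\<^sub>\<mu>(y)\<rangle> = \<delta>\<^sub>\<nu>\<^sub>\<mu>\<close>.
\<close>

definition pairing :: "xa_series \<Rightarrow> (nat, Qa) mfps \<Rightarrow> Qa" where
  "pairing f g = (\<Sum>\<nu> \<in> {\<nu>. x_coords f \<nu> \<noteq> 0}. x_coords f \<nu> * y_coords g \<nu>)"

definition dual_schur :: "nat list \<Rightarrow> (nat, Qa) mfps" where
  "dual_schur \<mu> = (THE g. g \<in> Lambda_hat \<and>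
     (\<forall>\<nu> \<in> partitions. pairing (schur_double \<nu>) g = (if \<nu> = \<mu> then 1 else 0)))"

end

(*
  Write G_mu for the dual Schur function of mu and C_mu(m) for its coefficient at the monomial y^m.
  By the Cauchy identity, h_m = prod_k h_(m_k) equals sum_mu C_mu(m) s_mu(x||a) for every choice of
  the series H(t) = sum_r h_r t^r: only the coefficients of H enter the Jacobi-Trudi determinants.
  Comparing this identity for H and for H (1 - a_0 t) / (1 - a_1 t), that is, adding a_1 to the
  x-variables and removing a_0, turns the substitution on the determinants s_mu(x||a) into
  multiplication of the G_mu by the series K = prod_j (1 - a_0 y_j) / (1 - a_1 y_j).
  On the determinants the substitution is computed in two steps by row expansion; they remove a
  vertical and then a horizontal strip, with exactly the factors of wt. Hence
  K G_mu = sum_lambda sum_D wt(D) G_lambda, over all Lambda-decompositions D of lambda/mu. For empty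
  mu this reads K = 1 + (a_1 - a_0) G_1. Moving the northeastmost box between the two strips pairs
  up the decompositions of a nonempty lambda/mu and produces the same factor a_1 - a_0, which cancels.
*)

theory Submission
  imports Defs "HOL-Computational_Algebra.Formal_Power_Series"
begin


section \<open>Partitions and strips\<close>

text \<open>The change of H is never built as a map of power series in x. H is kept variable
  instead: \<open>schur_of G\<close> and \<open>double_schur_of G\<close> are determinants in the
  coefficients of an arbitrary series G with constant term 1, and transition coefficients in
  \<rat>[a] are found that serve all such G at once. The definitions concern only G =
  \<open>h_fps 0\<close>, the series of the h_r(x/a); there the determinants are shown to be
  linearly independent, which is what permits coefficients to be compared. The choice G = 1 singles
  out the dual Schur function of the empty partition. The row whose last box has content l carries
  H(t) (1 - a_1 t) ... (1 - a_l t), continued to negative l. A linear factor attached to H can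
  therefore be traded for a shift of l, and each shift costs one box together with a difference of
  two a_i. The pair a_1, a_0 is dictated by the case of empty \<mu>: a box of content 0 in the
  horizontal strip has factor a_1 - a_1, and a box of content -1 in the vertical strip has factor
  a_0 - a_0, so that K - 1 involves a single dual Schur function.\<close>

definition part :: "nat list \<Rightarrow> nat \<Rightarrow> nat" where
  "part \<nu> i = (if i < length \<nu> then \<nu> ! i else 0)"

lemma part_pos_iff: "\<nu> \<in> partitions \<Longrightarrow> 0 < part \<nu> i \<longleftrightarrow> i < length \<nu>"
  by (auto simp: part_def partitions_def) (metis gr0I nth_mem)

lemma part_antimono:
  assumes "\<nu> \<in> partitions" "i \<le> j"
  shows "part \<nu> j \<le> part \<nu> i"
proof (cases "i < j \<and> j < length \<nu>")
  case True
  then show ?thesis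
    using assms by (auto simp: part_def partitions_def sorted_wrt_iff_nth_less)
next
  case False
  then show ?thesis
    using assms(2) by (cases "i = j") (auto simp: part_def)
qed

lemma partition_eqI:
  assumes "\<nu> \<in> partitions" "\<mu> \<in> partitions" "\<And>i. part \<nu> i = part \<mu> i"
  shows "\<nu> = \<mu>"
proof (rule nth_equalityI)
  show *: "length \<nu> = length \<mu>"
    using part_pos_iff[OF assms(1)] part_pos_iff[OF assms(2)] assms(3)
    by (metis less_irrefl_nat linorder_neqE_nat)
  fix i assume "i < length \<nu>"
  then show "\<nu> ! i = \<mu> ! i"
    using assms(3)[of i] * by (simp add: part_def)
qed

lemma sum_list_part: "length \<nu> \<le> n \<Longrightarrow> sum_list \<nu> = (\<Sum>i<n. part \<nu> i)"
proof -
  assume n: "length \<nu> \<le> n"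
  have "sum_list \<nu> = (\<Sum>i<length \<nu>. part \<nu> i)"
    by (simp add: sum_list_sum_nth part_def atLeast0LessThan)
  also have "\<dots> = (\<Sum>i<n. part \<nu> i)"
    using n by (intro sum.mono_neutral_left) (auto simp: part_def)
  finally show ?thesis .
qed

lemma length_le_sum_list: "\<nu> \<in> partitions \<Longrightarrow> length \<nu> \<le> sum_list \<nu>"
proof (induction \<nu>)
  case (Cons a \<nu>)
  then have "\<nu> \<in> partitions" "0 < a" by (auto simp: partitions_def)
  then show ?case using Cons.IH by simp
qed simp

lemma finite_partitions_le: "finite {\<nu> \<in> partitions. sum_list \<nu> \<le> n}"
proof (rule finite_subset)
  show "{\<nu> \<in> partitions. sum_list \<nu> \<le> n} \<subseteq> {xs. set xs \<subseteq> {..n} \<and> length xs \<le> n}"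
  proof safe
    fix \<nu> x assume \<nu>: "\<nu> \<in> partitions" "sum_list \<nu> \<le> n"
    show "length \<nu> \<le> n" using length_le_sum_list[OF \<nu>(1)] \<nu>(2) by linarith
    assume "x \<in> set \<nu>"
    then show "x \<le> n" using member_le_sum_list[of x \<nu>] \<nu>(2) by simp
  qed
  show "finite {xs. set xs \<subseteq> {..n} \<and> length xs \<le> n}"
    by (rule finite_lists_length_le) simp
qed

lemma diagram_iff: "(i, j) \<in> diagram \<nu> \<longleftrightarrow> 1 \<le> i \<and> 1 \<le> j \<and> j \<le> part \<nu> (i - 1)"
  by (auto simp: diagram_def part_def)

lemma skew_iff:
  "(i, j) \<in> skew \<nu> \<mu> \<longleftrightarrow> 1 \<le> i \<and> part \<mu> (i - 1) < j \<and> j \<le> part \<nu> (i - 1)"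
  by (auto simp: skew_def diagram_iff)

lemma diagram_subset_iff: "diagram \<mu> \<subseteq> diagram \<nu> \<longleftrightarrow> (\<forall>i. part \<mu> i \<le> part \<nu> i)"
proof
  assume *: "diagram \<mu> \<subseteq> diagram \<nu>"
  show "\<forall>i. part \<mu> i \<le> part \<nu> i"
  proof
    fix i
    show "part \<mu> i \<le> part \<nu> i"
      using subsetD[OF *, of "(Suc i, part \<mu> i)"] by (cases "part \<mu> i") (auto simp: diagram_iff)
  qed
next
  assume "\<forall>i. part \<mu> i \<le> part \<nu> i"
  then show "diagram \<mu> \<subseteq> diagram \<nu>"
    by (auto simp: diagram_iff) (meson le_trans)
qed

lemma diagram_inject: "\<nu> \<in> partitions \<Longrightarrow> \<mu> \<in> partitions \<Longrightarrow> diagram \<nu> = diagram \<mu> \<Longrightarrow> \<nu> = \<mu>"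
  by (rule partition_eqI) (simp_all add: diagram_subset_iff order.antisym set_eq_subset)

lemma diagram_subset_length:
  assumes "\<mu> \<in> partitions" "\<nu> \<in> partitions" "diagram \<mu> \<subseteq> diagram \<nu>"
  shows "length \<mu> \<le> length \<nu>"
  using assms(3)[unfolded diagram_subset_iff, rule_format, of "length \<nu>"]
    part_pos_iff[OF assms(1), of "length \<nu>"] by (simp add: part_def split: if_splits)

lemma vertical_strip_skew_iff:
  "vertical_strip (skew \<nu> \<mu>) \<longleftrightarrow> (\<forall>i. part \<nu> i \<le> Suc (part \<mu> i))"
proof -
  have "{j. (i, j) \<in> skew \<nu> \<mu>} = (if 1 \<le> i then {part \<mu> (i - 1)<..part \<nu> (i - 1)} else {})" for i
    by (auto simp: skew_iff)
  then have "vertical_strip (skew \<nu> \<mu>) \<longleftrightarrow> (\<forall>i\<ge>1. part \<nu> (i - 1) \<le> Suc (part \<mu> (i - 1)))"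
    by (auto simp: vertical_strip_def)
  also have "\<dots> \<longleftrightarrow> (\<forall>i. part \<nu> i \<le> Suc (part \<mu> i))"
    by (metis One_nat_def diff_Suc_1 le_add1 plus_1_eq_Suc)
  finally show ?thesis .
qed

lemma horizontal_strip_skew_iff:
  assumes "\<nu> \<in> partitions" "\<mu> \<in> partitions"
  shows "horizontal_strip (skew \<nu> \<mu>) \<longleftrightarrow> (\<forall>i. part \<nu> (Suc i) \<le> part \<mu> i)"
proof
  assume h: "horizontal_strip (skew \<nu> \<mu>)"
  show "\<forall>i. part \<nu> (Suc i) \<le> part \<mu> i"
  proof (rule allI, rule ccontr)
    fix i assume "\<not> part \<nu> (Suc i) \<le> part \<mu> i"
    \<comment> \<open>The first column not reached by row i of \<mu>. If row i + 1 of \<nu> exceeds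
      row i of \<mu>, then rows i and i + 1 of the skew shape both have a box in it.\<close>
    define j where "j = Suc (part \<mu> i)"
    have fin: "finite {k. (k, j) \<in> skew \<nu> \<mu>}"
    proof (rule finite_subset)
      show "{k. (k, j) \<in> skew \<nu> \<mu>} \<subseteq> {..length \<nu>}"
        by (auto simp: skew_iff part_def split: if_splits)
    qed simp
    have "{Suc i, Suc (Suc i)} \<subseteq> {k. (k, j) \<in> skew \<nu> \<mu>}"
      using \<open>\<not> part \<nu> (Suc i) \<le> part \<mu> i\<close> part_antimono[OF assms(1), of i "Suc i"]
        part_antimono[OF assms(2), of i "Suc i"] by (auto simp: skew_iff j_def)
    from card_mono[OF fin this] h show False
      by (auto simp: horizontal_strip_def) (metis not_less_eq_eq numeral_2_eq_2)
  qed
next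
  assume h: "\<forall>i. part \<nu> (Suc i) \<le> part \<mu> i"
  have "x = y" if "(x, j) \<in> skew \<nu> \<mu>" "(y, j) \<in> skew \<nu> \<mu>" "x \<le> y" for x y j
  proof (rule ccontr)
    assume "x \<noteq> y"
    with that have "1 \<le> x" "x \<le> y - 1" by (auto simp: skew_iff)
    then have "part \<nu> (y - 1) \<le> part \<nu> x" using part_antimono[OF assms(1)] by simp
    also have "\<dots> \<le> part \<mu> (x - 1)" using h[rule_format, of "x - 1"] \<open>1 \<le> x\<close> by simp
    finally show False using that by (auto simp: skew_iff)
  qed
  then have "x = y" if "(x, j) \<in> skew \<nu> \<mu>" "(y, j) \<in> skew \<nu> \<mu>" for x y j
    using that by (metis nat_le_linear)
  moreover have "finite {i. (i, j) \<in> skew \<nu> \<mu>}" for j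
    by (rule finite_subset[of _ "{..length \<nu>}"]) (auto simp: skew_iff part_def split: if_splits)
  ultimately show "horizontal_strip (skew \<nu> \<mu>)"
    by (simp add: horizontal_strip_def card_le_Suc0_iff_eq)
qed

lemma skew_eq_Sigma:
  assumes "length \<nu> \<le> n"
  shows "skew \<nu> \<mu> = (\<lambda>(i, j). (Suc i, j)) ` (SIGMA i:{..<n}. {part \<mu> i<..part \<nu> i})"
proof (intro equalityI subrelI)
  fix i j assume *: "(i, j) \<in> skew \<nu> \<mu>"
  moreover from * have "i - 1 < n"
    using assms by (auto simp: skew_iff part_def split: if_splits)
  ultimately show "(i, j) \<in> (\<lambda>(i, j). (Suc i, j)) ` (SIGMA i:{..<n}. {part \<mu> i<..part \<nu> i})"
    by (intro image_eqI[of _ _ "(i - 1, j)"]) (auto simp: skew_iff)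
qed (auto simp: skew_iff)

lemma finite_skew: "finite (skew \<nu> \<mu>)"
  by (subst skew_eq_Sigma[OF order.refl]) auto

text \<open>A weight depends on a box only through its content, which is \<open>k - i - 1\<close>
  once rows are counted from 0. In this form it arises from expanding determinants by rows.\<close>

lemma prod_skew:
  assumes "length \<nu> \<le> n"
  shows "(\<Prod>(i, j)\<in>skew \<nu> \<mu>. g (int j - int i)) =
    (\<Prod>i<n. \<Prod>k\<in>{part \<mu> i<..part \<nu> i}. g (int k - int i - 1))"
proof -
  have "(\<Prod>(i, j)\<in>skew \<nu> \<mu>. g (int j - int i)) =
      (\<Prod>(i, j)\<in>(SIGMA i:{..<n}. {part \<mu> i<..part \<nu> i}). g (int j - int (Suc i)))"
    by (subst skew_eq_Sigma[OF assms], subst prod.reindex) (auto simp: inj_on_def case_prod_beta)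
  also have "\<dots> = (\<Prod>i<n. \<Prod>k\<in>{part \<mu> i<..part \<nu> i}. g (int k - int i - 1))"
    by (subst prod.Sigma) (auto simp: algebra_simps)
  finally show ?thesis .
qed

lemma card_skew:
  assumes "diagram \<mu> \<subseteq> diagram \<nu>" "length \<mu> \<le> length \<nu>"
  shows "card (skew \<nu> \<mu>) + sum_list \<mu> = sum_list \<nu>"
proof -
  have "card (skew \<nu> \<mu>) = (\<Sum>i<length \<nu>. part \<nu> i - part \<mu> i)"
    by (subst skew_eq_Sigma[OF order.refl], subst card_image) (auto simp: inj_on_def)
  then have "card (skew \<nu> \<mu>) + sum_list \<mu> = (\<Sum>i<length \<nu>. (part \<nu> i - part \<mu> i) + part \<mu> i)"
    using assms(2) by (simp add: sum_list_part[of \<mu> "length \<nu>"] sum.distrib)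
  also have "\<dots> = sum_list \<nu>"
    using assms(1) by (subst sum_list_part[of \<nu> "length \<nu>"]) (auto simp: diagram_subset_iff)
  finally show ?thesis .
qed

text \<open>Expanding a determinant by rows gives a sum over functions that choose a length for each
  of n rows. The weakly decreasing choices are the partitions with at most n parts:
  \<open>takeWhile\<close> drops the trailing zeros, and padding with zeros restores them.\<close>

lemma sum_PiE_partitions:
  fixes g :: "(nat \<Rightarrow> nat) \<Rightarrow> 'a::comm_monoid_add"
  assumes g: "\<And>\<nu>. \<nu> \<in> partitions \<Longrightarrow> g (restrict (part \<nu>) {..<n}) = h \<nu>"
  shows "(\<Sum>f | f \<in> PiE {..<n} S \<and> (\<forall>i. Suc i < n \<longrightarrow> f (Suc i) \<le> f i). g f) =
    (\<Sum>\<nu> | \<nu> \<in> partitions \<and> length \<nu> \<le> n \<and> (\<forall>i<n. part \<nu> i \<in> S i). h \<nu>)"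
proof -
  define J where "J f = takeWhile (\<lambda>x. 0 < x) (map f [0..<n])" for f :: "nat \<Rightarrow> nat"
  define I where "I \<nu> = restrict (part \<nu>) {..<n}" for \<nu>
  have inv: "I (J f) = f \<and> J f \<in> partitions"
    if f: "f \<in> PiE {..<n} S" "\<forall>i. Suc i < n \<longrightarrow> f (Suc i) \<le> f i" for f
  proof -
    let ?t = "takeWhile (\<lambda>x. 0 < x) (map f [0..<n])"
    have mono: "f j \<le> f i" if "i \<le> j" "j < n" for i j
      using that
    proof (induction j)
      case (Suc j)
      then show ?case using f(2) by (metis Suc_lessD le_Suc_eq order.refl order.trans)
    qed simp
    have len: "length ?t \<le> n"
      using length_takeWhile_le[of _ "map f [0..<n]"] by simp
    have nth: "?t ! i = f i" if "i < length ?t" for i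
      using takeWhile_nth[OF that] that len by simp
    have zero: "f i = 0" if "length ?t \<le> i" "i < n" for i
    proof -
      have "\<not> 0 < map f [0..<n] ! length ?t"
        using that by (intro nth_length_takeWhile) simp
      then have "f (length ?t) = 0" using that by simp
      then show ?thesis using mono[OF that] by simp
    qed
    have "?t \<in> partitions"
    proof -
      have "sorted_wrt (\<ge>) ?t"
        unfolding sorted_wrt_iff_nth_less
      proof (intro allI impI)
        fix i j assume "i < j" "j < length ?t"
        then show "?t ! j \<le> ?t ! i"
          using nth[of i] nth[of j] mono[of i j] len by simp
      qed
      moreover have "0 \<notin> set ?t"
        using set_takeWhileD[of 0 "\<lambda>x. 0 < x"] by blast
      ultimately show ?thesis
        by (simp add: partitions_def)
    qed
    moreover have "restrict (part ?t) {..<n} = f"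
    proof
      fix i
      show "restrict (part ?t) {..<n} i = f i"
        using nth[of i] zero[of i] f(1) by (simp add: part_def PiE_def extensional_def)
    qed
    ultimately show ?thesis by (simp add: I_def J_def)
  qed
  have inv': "J (I \<nu>) = \<nu>" if \<nu>: "\<nu> \<in> partitions" "length \<nu> \<le> n" for \<nu>
  proof -
    have upt: "[0..<n] = [0..<length \<nu>] @ [length \<nu>..<n]"
      using upt_add_eq_append[of 0 "length \<nu>" "n - length \<nu>"] \<nu>(2) by simp
    have "map (restrict (part \<nu>) {..<n}) [0..<n] = map (part \<nu>) [0..<n]"
      by simp
    also have "\<dots> = map (part \<nu>) [0..<length \<nu>] @ map (part \<nu>) [length \<nu>..<n]"
      by (simp only: upt map_append)
    finally have "takeWhile (\<lambda>x. 0 < x) (map (restrict (part \<nu>) {..<n}) [0..<n]) =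
        takeWhile (\<lambda>x. 0 < x) (map (part \<nu>) [0..<length \<nu>] @ map (part \<nu>) [length \<nu>..<n])"
      by simp
    also have "\<dots> = map (part \<nu>) [0..<length \<nu>] @
        takeWhile (\<lambda>x. 0 < x) (map (part \<nu>) [length \<nu>..<n])"
      by (rule takeWhile_append2) (auto simp: part_pos_iff[OF \<nu>(1)])
    also have "takeWhile (\<lambda>x. 0 < x) (map (part \<nu>) [length \<nu>..<n]) = []"
      by (cases "length \<nu> < n") (simp_all add: upt_conv_Cons part_def)
    also have "map (part \<nu>) [0..<length \<nu>] @ [] = map (part \<nu>) [0..<length \<nu>]"
      by simp
    also have "\<dots> = \<nu>"
      by (rule nth_equalityI) (auto simp: part_def)
    finally show ?thesis unfolding I_def J_def .
  qed
  have len: "length (J f) \<le> n" for f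
    using length_takeWhile_le[of "\<lambda>x. 0 < x" "map f [0..<n]"] by (simp add: J_def)
  have nth: "part (J f) i = f i" if "I (J f) = f" "i < n" for f i
    using fun_cong[OF that(1), of i] that(2) by (simp add: I_def)
  have mem: "I \<nu> \<in> PiE {..<n} S \<and> (\<forall>i. Suc i < n \<longrightarrow> I \<nu> (Suc i) \<le> I \<nu> i)"
    if "\<nu> \<in> partitions" "\<forall>i<n. part \<nu> i \<in> S i" for \<nu>
    using part_antimono[OF that(1)] that(2) by (simp add: I_def)
  have mem': "f i \<in> S i" if "f \<in> PiE {..<n} S" "i < n" for f i
    using that by auto
  have g': "g (I \<nu>) = h \<nu>" if "\<nu> \<in> partitions" for \<nu>
    using g[OF that] by (simp add: I_def)
  show ?thesis
  proof (rule sum.reindex_bij_witness[of _ I J])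
    fix f assume "f \<in> {f. f \<in> PiE {..<n} S \<and> (\<forall>i. Suc i < n \<longrightarrow> f (Suc i) \<le> f i)}"
    then have f: "f \<in> PiE {..<n} S" and *: "I (J f) = f" "J f \<in> partitions"
      using inv[of f] by blast+
    show "I (J f) = f" by fact
    show "J f \<in> {\<nu>. \<nu> \<in> partitions \<and> length \<nu> \<le> n \<and> (\<forall>i<n. part \<nu> i \<in> S i)}"
      using * f by (simp add: len nth mem')
    show "h (J f) = g f" using g'[OF *(2)] *(1) by simp
  next
    fix \<nu> assume "\<nu> \<in> {\<nu>. \<nu> \<in> partitions \<and> length \<nu> \<le> n \<and> (\<forall>i<n. part \<nu> i \<in> S i)}"
    then have \<nu>: "\<nu> \<in> partitions" "length \<nu> \<le> n" "\<forall>i<n. part \<nu> i \<in> S i"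
      by blast+
    show "J (I \<nu>) = \<nu>" using \<nu> by (intro inv')
    show "I \<nu> \<in> {f. f \<in> PiE {..<n} S \<and> (\<forall>i. Suc i < n \<longrightarrow> f (Suc i) \<le> f i)}"
      using mem \<nu> by blast
  qed
qed


section \<open>Jacobi--Trudi determinants\<close>

lemma det_sum_rows:
  fixes c :: "nat \<Rightarrow> 'b \<Rightarrow> 'a::comm_ring_1"
  assumes "\<And>i. i < n \<Longrightarrow> finite (S i)"
  shows "det (mat n n (\<lambda>(i, j). \<Sum>k\<in>S i. c i k * V i k j)) =
    (\<Sum>f\<in>PiE {..<n} S. (\<Prod>i<n. c i (f i)) * det (mat n n (\<lambda>(i, j). V i (f i) j)))"
proof -
  have perm: "p i < n" if "p permutes {0..<n}" "i < n" for p i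
    using permutes_in_image[OF that(1), of i] that(2) by simp
  have "det (mat n n (\<lambda>(i, j). \<Sum>k\<in>S i. c i k * V i k j)) =
      (\<Sum>p | p permutes {0..<n}. signof p * (\<Prod>i<n. \<Sum>k\<in>S i. c i k * V i k (p i)))"
    by (subst det_def'[of _ n]) (auto simp: perm atLeast0LessThan intro!: sum.cong prod.cong)
  also have "\<dots> = (\<Sum>p | p permutes {0..<n}. signof p *
      (\<Sum>f\<in>PiE {..<n} S. \<Prod>i<n. c i (f i) * V i (f i) (p i)))"
    by (subst prod_sum_PiE) (auto simp: assms)
  also have "\<dots> = (\<Sum>f\<in>PiE {..<n} S. \<Sum>p | p permutes {0..<n}.
      (\<Prod>i<n. c i (f i)) * (signof p * (\<Prod>i<n. V i (f i) (p i))))"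
    by (subst sum.swap) (simp add: sum_distrib_left prod.distrib mult_ac)
  also have "\<dots> = (\<Sum>f\<in>PiE {..<n} S. (\<Prod>i<n. c i (f i)) * det (mat n n (\<lambda>(i, j). V i (f i) j)))"
    by (intro sum.cong refl, subst det_def'[of _ n])
      (auto simp: perm atLeast0LessThan sum_distrib_left intro!: sum.cong prod.cong)
  finally show ?thesis .
qed

lemma prod_list_map_one [simp]: "prod_list (map (\<lambda>_. 1 :: 'a::monoid_mult) xs) = 1"
  by (induction xs) auto

text \<open>A unitriangular factor performs all operations simultaneously, so each row is reduced by
  the original next row and not by an already reduced one. Row n lies outside the matrix; the
  hypothesis makes its contribution vanish.\<close>

lemma det_subtract_next_row:
  fixes A :: "nat \<Rightarrow> nat \<Rightarrow> 'a::comm_ring_1"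
  assumes "\<And>i j. Suc i = n \<Longrightarrow> j < n \<Longrightarrow> w i * A n j = 0"
  shows "det (mat n n (\<lambda>(i, j). A i j - w i * A (Suc i) j)) = det (mat n n (\<lambda>(i, j). A i j))"
proof -
  define U where "U = mat n n (\<lambda>(i, k). if i = k then 1 else if k = Suc i then - w i else 0)"
  have U: "U \<in> carrier_mat n n"
    by (simp add: U_def)
  have "upper_triangular U"
    by (auto simp: U_def)
  then have "det U = prod_list (diag_mat U)"
    using U by (rule det_upper_triangular)
  also have "diag_mat U = map (\<lambda>_. 1) [0..<n]"
    by (auto simp: diag_mat_def U_def)
  also have "prod_list \<dots> = 1"
    by simp
  finally have det: "det U = 1" .
  have "mat n n (\<lambda>(i, j). A i j - w i * A (Suc i) j) = U * mat n n (\<lambda>(i, j). A i j)"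
  proof (rule eq_matI)
    fix i j assume ij: "i < dim_row (U * mat n n (\<lambda>(i, j). A i j))"
      "j < dim_col (U * mat n n (\<lambda>(i, j). A i j))"
    then have i: "i < n" and j: "j < n" by (simp_all add: U_def)
    have "(U * mat n n (\<lambda>(i, j). A i j)) $$ (i, j) =
        (\<Sum>k\<in>{0..<n}. (if i = k then 1 else if k = Suc i then - w i else 0) * A k j)"
      using i j by (simp add: U_def scalar_prod_def)
    also have "\<dots> = (\<Sum>k\<in>{0..<n}. (if k = i then A i j else 0) + (if k = Suc i then - w i * A k j else 0))"
      by (rule sum.cong) auto
    also have "\<dots> = A i j + (if Suc i < n then - w i * A (Suc i) j else 0)"
      using i by (simp add: sum.distrib)
    also have "\<dots> = A i j - w i * A (Suc i) j"
      using assms[of i j] i j by (cases "Suc i = n") auto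
    finally show "mat n n (\<lambda>(i, j). A i j - w i * A (Suc i) j) $$ (i, j) =
        (U * mat n n (\<lambda>(i, j). A i j)) $$ (i, j)"
      using i j by simp
  qed (simp_all add: U_def)
  then show ?thesis
    by (simp add: det_mult[OF U] det)
qed

lemma det_subtract_next_col:
  fixes A :: "nat \<Rightarrow> nat \<Rightarrow> 'a::comm_ring_1"
  assumes "\<And>i j. Suc j = n \<Longrightarrow> i < n \<Longrightarrow> w j * A i n = 0"
  shows "det (mat n n (\<lambda>(i, j). A i j - w j * A i (Suc j))) = det (mat n n (\<lambda>(i, j). A i j))"
proof -
  have tr: "det (mat n n (\<lambda>(i, j). B i j)) = det (mat n n (\<lambda>(i, j). B j i))"
    for B :: "nat \<Rightarrow> nat \<Rightarrow> 'a"
  proof -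
    have "transpose_mat (mat n n (\<lambda>(i, j). B j i)) = mat n n (\<lambda>(i, j). B i j)"
      by (rule eq_matI) auto
    then show ?thesis
      using det_transpose[of "mat n n (\<lambda>(i, j). B j i)" n] by simp
  qed
  show ?thesis
    using det_subtract_next_row[of n w "\<lambda>i j. A j i"] assms
      tr[of "\<lambda>i j. A j i - w i * A j (Suc i)"] tr[of "\<lambda>i j. A j i"] by simp
qed

text \<open>Truncated subtraction makes row 0 its own predecessor, so the hypothesis asks that
  \<open>w 0\<close> annihilate row 0.\<close>

lemma det_subtract_prev_row:
  fixes A :: "nat \<Rightarrow> nat \<Rightarrow> 'a::comm_ring_1"
  assumes "\<And>j. j < n \<Longrightarrow> w 0 * A (0 - 1) j = 0"
  shows "det (mat n n (\<lambda>(i, j). A i j - w i * A (i - 1) j)) = det (mat n n (\<lambda>(i, j). A i j))"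
proof -
  define U where "U = mat n n (\<lambda>(i, k). if i = k then 1 else if i = Suc k then - w i else 0)"
  have U: "U \<in> carrier_mat n n"
    by (simp add: U_def)
  have "det U = prod_list (diag_mat U)"
    by (rule det_lower_triangular[OF _ U]) (auto simp: U_def)
  also have "diag_mat U = map (\<lambda>_. 1) [0..<n]"
    by (auto simp: diag_mat_def U_def)
  also have "prod_list \<dots> = 1"
    by simp
  finally have det: "det U = 1" .
  have "mat n n (\<lambda>(i, j). A i j - w i * A (i - 1) j) = U * mat n n (\<lambda>(i, j). A i j)"
  proof (rule eq_matI)
    fix i j assume ij: "i < dim_row (U * mat n n (\<lambda>(i, j). A i j))"
      "j < dim_col (U * mat n n (\<lambda>(i, j). A i j))"
    then have i: "i < n" and j: "j < n" by (simp_all add: U_def)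
    have "(U * mat n n (\<lambda>(i, j). A i j)) $$ (i, j) =
        (\<Sum>k\<in>{0..<n}. (if i = k then 1 else if i = Suc k then - w i else 0) * A k j)"
      using i j by (simp add: U_def scalar_prod_def)
    also have "\<dots> = (\<Sum>k\<in>{0..<n}. (if k = i then A i j else 0) +
        (if k = i - 1 then if i = 0 then 0 else - w i * A k j else 0))"
      by (rule sum.cong) auto
    also have "\<dots> = A i j + (if i = 0 then 0 else - w i * A (i - 1) j)"
      using i by (simp add: sum.distrib)
    also have "\<dots> = A i j - w i * A (i - 1) j"
      using assms[of j] j by auto
    finally show "mat n n (\<lambda>(i, j). A i j - w i * A (i - 1) j) $$ (i, j) =
        (U * mat n n (\<lambda>(i, j). A i j)) $$ (i, j)"
      using i j by simp
  qed (simp_all add: U_def)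
  then show ?thesis
    by (simp add: det_mult[OF U] det)
qed

lemma det_last_row_unit:
  fixes A :: "nat \<Rightarrow> nat \<Rightarrow> 'a::comm_ring_1"
  assumes "\<And>j. j < n \<Longrightarrow> A n j = 0"
  shows "det (mat (Suc n) (Suc n) (\<lambda>(i, j). A i j)) = A n n * det (mat n n (\<lambda>(i, j). A i j))"
proof -
  let ?A = "mat (Suc n) (Suc n) (\<lambda>(i, j). A i j)"
  have "det ?A = (\<Sum>j<Suc n. ?A $$ (n, j) * cofactor ?A n j)"
    by (rule laplace_expansion_row) auto
  also have "\<dots> = A n n * cofactor ?A n n"
    using assms by simp
  also have "cofactor ?A n n = det (mat_delete ?A n n)"
    by (simp add: cofactor_def flip: mult_2)
  also have "mat_delete ?A n n = mat n n (\<lambda>(i, j). A i j)"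
    by (rule eq_matI) (auto simp: mat_delete_def)
  finally show ?thesis .
qed

section \<open>Jacobi-Trudi determinants with rows indexed by content\<close>

text \<open>
  The row of a partition with part \<open>f i\<close> in row \<open>i\<close> (counted from \<open>0\<close>) carries the series
  \<open>G l\<close>, where \<open>l = f i - i - 1\<close> is the content of the last box in that row.
\<close>

definition jt :: "(int \<Rightarrow> int \<Rightarrow> 'a::comm_ring_1) \<Rightarrow> nat \<Rightarrow> (nat \<Rightarrow> nat) \<Rightarrow> 'a" where
  "jt G n f = det (mat n n (\<lambda>(i, j). G (int (f i) - int i - 1) (int (f i) - int i + int j)))"

definition Jt :: "(int \<Rightarrow> int \<Rightarrow> 'a::comm_ring_1) \<Rightarrow> nat list \<Rightarrow> 'a" where
  "Jt G \<nu> = jt G (length \<nu>) (part \<nu>)"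

definition unital :: "(int \<Rightarrow> int \<Rightarrow> 'a::comm_ring_1) \<Rightarrow> bool" where
  "unital G \<longleftrightarrow> (\<forall>l r. r < 0 \<longrightarrow> G l r = 0) \<and> (\<forall>l. G l 0 = 1)"

lemma jt_cong:
  "n = m \<Longrightarrow> (\<And>i. i < n \<Longrightarrow> f i = g i) \<Longrightarrow> jt G n f = jt G m g"
  by (auto simp: jt_def intro!: arg_cong[of _ _ det])

text \<open>A row of length 0 in position n has entries of degree j - n, hence is the last unit
  vector. Padding by empty rows is thus harmless, and partitions of different lengths can be
  compared in matrices of one size.\<close>

lemma jt_Suc:
  assumes "unital G" "f n = 0"
  shows "jt G (Suc n) f = jt G n f"
  unfolding jt_def using assms by (subst det_last_row_unit) (auto simp: unital_def)

lemma jt_pad: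
  assumes "unital G" "length \<nu> \<le> n"
  shows "jt G n (part \<nu>) = Jt G \<nu>"
  using assms(2)
proof (induction n rule: dec_induct)
  case (step n)
  have "part \<nu> n = 0" using step(1) by (simp add: part_def)
  then show ?case using jt_Suc[OF assms(1), of "part \<nu>" n] step.IH by simp
qed (simp add: Jt_def)

text \<open>The entries of row i depend on i and \<open>f i\<close> only through the difference
  \<open>f i - i\<close>. This covers the content argument as well as the degree, so straightening
  works for the double determinants exactly as for the ordinary ones.\<close>

lemma jt_repeated_row:
  assumes "Suc i < n" "f (Suc i) = Suc (f i)"
  shows "jt G n f = 0"
  unfolding jt_def
proof (rule det_identical_rows)
  let ?A = "mat n n (\<lambda>(i, j). G (int (f i) - int i - 1) (int (f i) - int i + int j))"
  show "?A \<in> carrier_mat n n" "i \<noteq> Suc i" "i < n" "Suc i < n"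
    using assms(1) by simp_all
  show "row ?A i = row ?A (Suc i)"
    using assms by (intro eq_vecI) simp_all
qed

text \<open>Every row splits into one of the same length and one that has lost its last box, whose
  content l supplies the factor \<open>u l\<close>. A choice of rows that is not a partition can
  fail only at two equal parts of which the upper one is shortened; two rows then coincide and the
  determinant is 0. The surviving choices remove vertical strips.\<close>

lemma Jt_vertical:
  fixes F F' :: "int \<Rightarrow> int \<Rightarrow> 'a::comm_ring_1"
  assumes \<nu>: "\<nu> \<in> partitions" and F': "unital F'"
    and rec: "\<And>l r. F l r = F' l r + u l * F' (l - 1) (r - 1)"
  shows "Jt F \<nu> = (\<Sum>\<rho> | \<rho> \<in> partitions \<and> diagram \<rho> \<subseteq> diagram \<nu> \<and> vertical_strip (skew \<nu> \<rho>).
    (\<Prod>(i, j)\<in>skew \<nu> \<rho>. u (int j - int i)) * Jt F' \<rho>)"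
proof -
  define n where "n = length \<nu>"
  define S where "S i = {part \<nu> i - 1, part \<nu> i}" for i
  define c where "c i k = (if k = part \<nu> i then 1 else u (int (part \<nu> i) - int i - 1))" for i k
  have pos: "0 < part \<nu> i" if "i < n" for i
    using part_pos_iff[OF \<nu>] that by (simp add: n_def)
  have "Jt F \<nu> = det (mat n n (\<lambda>(i, j). \<Sum>k\<in>S i. c i k * F' (int k - int i - 1) (int k - int i + int j)))"
    unfolding Jt_def jt_def n_def[symmetric]
  proof (intro arg_cong[of _ _ det] cong_mat refl, clarsimp)
    fix i j assume "i < n"
    then show "F (int (part \<nu> i) - int i - 1) (int (part \<nu> i) - int i + int j) =
        (\<Sum>k\<in>S i. c i k * F' (int k - int i - 1) (int k - int i + int j))"
      using pos[of i] less_imp_neq[of "part \<nu> i - 1" "part \<nu> i"]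
      by (simp add: S_def c_def rec of_nat_diff algebra_simps)
  qed
  also have "\<dots> = (\<Sum>f\<in>PiE {..<n} S. (\<Prod>i<n. c i (f i)) * jt F' n f)"
    unfolding jt_def by (rule det_sum_rows) (simp add: S_def)
  also have "\<dots> = (\<Sum>f | f \<in> PiE {..<n} S \<and> (\<forall>i. Suc i < n \<longrightarrow> f (Suc i) \<le> f i).
      (\<Prod>i<n. c i (f i)) * jt F' n f)"
  proof (rule sum.mono_neutral_right)
    show "\<forall>f\<in>PiE {..<n} S - {f. f \<in> PiE {..<n} S \<and> (\<forall>i. Suc i < n \<longrightarrow> f (Suc i) \<le> f i)}.
        (\<Prod>i<n. c i (f i)) * jt F' n f = 0"
    proof
      fix f assume f: "f \<in> PiE {..<n} S - {f. f \<in> PiE {..<n} S \<and> (\<forall>i. Suc i < n \<longrightarrow> f (Suc i) \<le> f i)}"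
      then obtain i where i: "Suc i < n" "f i < f (Suc i)"
        by (auto simp: not_le)
      moreover have "f i \<in> S i" "f (Suc i) \<in> S (Suc i)"
        using f i(1) by (auto simp: PiE_iff)
      moreover have "part \<nu> (Suc i) \<le> part \<nu> i"
        using part_antimono[OF \<nu>, of i "Suc i"] by simp
      ultimately have "f (Suc i) = Suc (f i)"
        by (auto simp: S_def)
      from jt_repeated_row[where G = F', OF i(1) this] show "(\<Prod>i<n. c i (f i)) * jt F' n f = 0"
        by simp
    qed
  qed (auto intro!: finite_PiE simp: S_def)
  also have "\<dots> = (\<Sum>\<rho> | \<rho> \<in> partitions \<and> length \<rho> \<le> n \<and> (\<forall>i<n. part \<rho> i \<in> S i).
      (\<Prod>i<n. c i (part \<rho> i)) * jt F' n (part \<rho>))"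
  proof (rule sum_PiE_partitions)
    fix \<rho>
    show "(\<Prod>i<n. c i (restrict (part \<rho>) {..<n} i)) * jt F' n (restrict (part \<rho>) {..<n}) =
        (\<Prod>i<n. c i (part \<rho> i)) * jt F' n (part \<rho>)"
      by (intro arg_cong2[of _ _ _ _ "(*)"] prod.cong jt_cong) auto
  qed
  also have "\<dots> = (\<Sum>\<rho> | \<rho> \<in> partitions \<and> diagram \<rho> \<subseteq> diagram \<nu> \<and> vertical_strip (skew \<nu> \<rho>).
      (\<Prod>(i, j)\<in>skew \<nu> \<rho>. u (int j - int i)) * Jt F' \<rho>)"
  proof (rule sum.cong)
    have "length \<rho> \<le> n \<and> (\<forall>i<n. part \<rho> i \<in> S i) \<longleftrightarrow>
        diagram \<rho> \<subseteq> diagram \<nu> \<and> vertical_strip (skew \<nu> \<rho>)" if \<rho>: "\<rho> \<in> partitions" for \<rho>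
    proof
        assume h: "length \<rho> \<le> n \<and> (\<forall>i<n. part \<rho> i \<in> S i)"
        have "part \<rho> i \<le> part \<nu> i \<and> part \<nu> i \<le> Suc (part \<rho> i)" for i
          using h by (cases "i < n") (auto simp: S_def n_def part_def)
        then show "diagram \<rho> \<subseteq> diagram \<nu> \<and> vertical_strip (skew \<nu> \<rho>)"
          by (simp add: diagram_subset_iff vertical_strip_skew_iff)
    next
        assume h: "diagram \<rho> \<subseteq> diagram \<nu> \<and> vertical_strip (skew \<nu> \<rho>)"
        then have "part \<rho> i \<in> S i" for i
        proof -
          have "part \<rho> i \<le> part \<nu> i" "part \<nu> i \<le> Suc (part \<rho> i)"
            using h by (simp_all add: diagram_subset_iff vertical_strip_skew_iff)
          then show ?thesis unfolding S_def by (cases "part \<rho> i = part \<nu> i") auto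
        qed
        then show "length \<rho> \<le> n \<and> (\<forall>i<n. part \<rho> i \<in> S i)"
          using h diagram_subset_length[OF \<rho> \<nu>] by (simp add: n_def)
    qed
    then show "{\<rho>. \<rho> \<in> partitions \<and> length \<rho> \<le> n \<and> (\<forall>i<n. part \<rho> i \<in> S i)} =
        {\<rho>. \<rho> \<in> partitions \<and> diagram \<rho> \<subseteq> diagram \<nu> \<and> vertical_strip (skew \<nu> \<rho>)}"
      by blast
    fix \<rho> assume "\<rho> \<in> {\<rho>. \<rho> \<in> partitions \<and> diagram \<rho> \<subseteq> diagram \<nu> \<and> vertical_strip (skew \<nu> \<rho>)}"
    then have \<rho>: "\<rho> \<in> partitions" "diagram \<rho> \<subseteq> diagram \<nu>" "vertical_strip (skew \<nu> \<rho>)"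
      by auto
    have len: "length \<rho> \<le> n"
      using diagram_subset_length[OF \<rho>(1) \<nu> \<rho>(2)] by (simp add: n_def)
    have "(\<Prod>i<n. c i (part \<rho> i)) = (\<Prod>(i, j)\<in>skew \<nu> \<rho>. u (int j - int i))"
    proof (subst prod_skew[of \<nu> n], simp add: n_def, rule prod.cong[OF refl])
      fix i
      have "part \<rho> i = part \<nu> i \<or> Suc (part \<rho> i) = part \<nu> i"
        using \<rho> unfolding diagram_subset_iff vertical_strip_skew_iff
        by (metis le_Suc_eq le_antisym)
      then show "c i (part \<rho> i) = (\<Prod>k\<in>{part \<rho> i<..part \<nu> i}. u (int k - int i - 1))"
      proof
        assume *: "Suc (part \<rho> i) = part \<nu> i"
        then have "{part \<rho> i<..part \<nu> i} = {part \<nu> i}" by auto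
        then show ?thesis using * by (simp add: c_def)
      qed (simp add: c_def)
    qed
    then show "(\<Prod>i<n. c i (part \<rho> i)) * jt F' n (part \<rho>) =
        (\<Prod>(i, j)\<in>skew \<nu> \<rho>. u (int j - int i)) * Jt F' \<rho>"
      by (simp add: jt_pad[OF F' len])
  qed
  finally show ?thesis .
qed

text \<open>The recursion has \<open>F\<close> itself on the right, so it can be iterated and strips
  boxes off a row one after the other. Iterating from \<open>part \<nu> i\<close> down to
  \<open>part \<nu> (Suc i)\<close> leaves a remainder that is a multiple of the next row, which a
  row operation removes. The remaining lengths are exactly the interlacing ones, so every choice of
  rows is already a partition.\<close>

lemma Jt_horizontal:
  fixes F F' :: "int \<Rightarrow> int \<Rightarrow> 'a::comm_ring_1"
  assumes \<nu>: "\<nu> \<in> partitions" and F: "\<And>l r. r < 0 \<Longrightarrow> F l r = 0" and F': "unital F'"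
    and rec: "\<And>l r. F l r = F' l r + u l * F (l - 1) (r - 1)"
  shows "Jt F \<nu> = (\<Sum>\<mu> | \<mu> \<in> partitions \<and> diagram \<mu> \<subseteq> diagram \<nu> \<and> horizontal_strip (skew \<nu> \<mu>).
    (\<Prod>(i, j)\<in>skew \<nu> \<mu>. u (int j - int i)) * Jt F' \<mu>)"
proof -
  define n where "n = length \<nu>"
  define A where "A i j = F (int (part \<nu> i) - int i - 1) (int (part \<nu> i) - int i + int j)" for i j
  define S where "S i = {part \<nu> (Suc i)..part \<nu> i}" for i
  define c where "c i k = (\<Prod>k'\<in>{k<..part \<nu> i}. u (int k' - int i - 1))" for i k
  define w where "w i = (\<Prod>k\<in>{part \<nu> (Suc i)..part \<nu> i}. u (int k - int i - 1))" for i
  have iter: "F (int b - int i - 1) (int b - int i + int j) =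
      (\<Sum>k\<in>{a..b}. (\<Prod>k'\<in>{k<..b}. u (int k' - int i - 1)) * F' (int k - int i - 1) (int k - int i + int j)) +
      (\<Prod>k\<in>{a..b}. u (int k - int i - 1)) * F (int a - int i - 2) (int a - int i + int j - 1)"
    if "a \<le> b" for a b i j
    using that
  proof (induction b rule: dec_induct)
    case base
    then show ?case by (subst rec) (simp add: algebra_simps)
  next
    case (step b)
    have 1: "{a..Suc b} = insert (Suc b) {a..b}" using step(1) by auto
    have 2: "(\<Prod>k'\<in>{k<..Suc b}. u (int k' - int i - 1)) =
        u (int b - int i) * (\<Prod>k'\<in>{k<..b}. u (int k' - int i - 1))" if "k \<in> {a..b}" for k
    proof -
      have "{k<..Suc b} = insert (Suc b) {k<..b}" using that by auto
      then show ?thesis by simp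
    qed
    have "F (int (Suc b) - int i - 1) (int (Suc b) - int i + int j) =
        F' (int b - int i) (int (Suc b) - int i + int j) +
        u (int b - int i) * F (int b - int i - 1) (int b - int i + int j)"
      by (subst rec) (simp add: algebra_simps)
    then show ?case
      unfolding step.IH 1 by (simp add: 2 sum_distrib_left mult_ac distrib_left)
  qed
  have "Jt F \<nu> = det (mat n n (\<lambda>(i, j). A i j))"
    by (simp add: Jt_def jt_def n_def A_def)
  also have "\<dots> = det (mat n n (\<lambda>(i, j). A i j - w i * A (Suc i) j))"
    \<comment> \<open>The row below the matrix has length 0, so in columns j < n its entries have
      negative degree.\<close>
    by (rule det_subtract_next_row[symmetric]) (simp add: A_def n_def part_def F)
  also have "\<dots> = det (mat n n (\<lambda>(i, j). \<Sum>k\<in>S i. c i k * F' (int k - int i - 1) (int k - int i + int j)))"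
  proof (intro arg_cong[of _ _ det] cong_mat refl, clarsimp)
    fix i j
    have "part \<nu> (Suc i) \<le> part \<nu> i"
      by (rule part_antimono[OF \<nu>]) simp
    from iter[OF this, of i j] show "A i j - w i * A (Suc i) j =
        (\<Sum>k\<in>S i. c i k * F' (int k - int i - 1) (int k - int i + int j))"
      by (simp add: A_def S_def c_def w_def algebra_simps)
  qed
  also have "\<dots> = (\<Sum>f\<in>PiE {..<n} S. (\<Prod>i<n. c i (f i)) * jt F' n f)"
    unfolding jt_def by (rule det_sum_rows) (simp add: S_def)
  also have "PiE {..<n} S = {f. f \<in> PiE {..<n} S \<and> (\<forall>i. Suc i < n \<longrightarrow> f (Suc i) \<le> f i)}"
  proof -
    have "f (Suc i) \<le> f i" if "f \<in> PiE {..<n} S" "Suc i < n" for f i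
    proof -
      have "f (Suc i) \<in> S (Suc i)" "f i \<in> S i"
        using that by (auto simp: PiE_iff)
      then show ?thesis by (simp add: S_def)
    qed
    then show ?thesis by blast
  qed
  also have "(\<Sum>f\<in>\<dots>. (\<Prod>i<n. c i (f i)) * jt F' n f) =
      (\<Sum>\<mu> | \<mu> \<in> partitions \<and> length \<mu> \<le> n \<and> (\<forall>i<n. part \<mu> i \<in> S i).
      (\<Prod>i<n. c i (part \<mu> i)) * jt F' n (part \<mu>))"
  proof (rule sum_PiE_partitions)
    fix \<mu>
    show "(\<Prod>i<n. c i (restrict (part \<mu>) {..<n} i)) * jt F' n (restrict (part \<mu>) {..<n}) =
        (\<Prod>i<n. c i (part \<mu> i)) * jt F' n (part \<mu>)"
      by (intro arg_cong2[of _ _ _ _ "(*)"] prod.cong jt_cong) auto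
  qed
  also have "\<dots> = (\<Sum>\<mu> | \<mu> \<in> partitions \<and> diagram \<mu> \<subseteq> diagram \<nu> \<and> horizontal_strip (skew \<nu> \<mu>).
      (\<Prod>(i, j)\<in>skew \<nu> \<mu>. u (int j - int i)) * Jt F' \<mu>)"
  proof (rule sum.cong)
    have "length \<mu> \<le> n \<and> (\<forall>i<n. part \<mu> i \<in> S i) \<longleftrightarrow>
        diagram \<mu> \<subseteq> diagram \<nu> \<and> horizontal_strip (skew \<nu> \<mu>)" if \<mu>: "\<mu> \<in> partitions" for \<mu>
    proof
        assume h: "length \<mu> \<le> n \<and> (\<forall>i<n. part \<mu> i \<in> S i)"
        have "part \<mu> i \<le> part \<nu> i \<and> part \<nu> (Suc i) \<le> part \<mu> i" for i
          using h by (cases "i < n") (auto simp: S_def n_def part_def)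
        then show "diagram \<mu> \<subseteq> diagram \<nu> \<and> horizontal_strip (skew \<nu> \<mu>)"
          by (simp add: diagram_subset_iff horizontal_strip_skew_iff[OF \<nu> \<mu>])
    next
        assume h: "diagram \<mu> \<subseteq> diagram \<nu> \<and> horizontal_strip (skew \<nu> \<mu>)"
        then have "part \<mu> i \<in> S i" for i
          by (auto simp: diagram_subset_iff horizontal_strip_skew_iff[OF \<nu> \<mu>] S_def)
        then show "length \<mu> \<le> n \<and> (\<forall>i<n. part \<mu> i \<in> S i)"
          using h diagram_subset_length[OF \<mu> \<nu>] by (simp add: n_def)
    qed
    then show "{\<mu>. \<mu> \<in> partitions \<and> length \<mu> \<le> n \<and> (\<forall>i<n. part \<mu> i \<in> S i)} =
        {\<mu>. \<mu> \<in> partitions \<and> diagram \<mu> \<subseteq> diagram \<nu> \<and> horizontal_strip (skew \<nu> \<mu>)}"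
      by blast
    fix \<mu> assume "\<mu> \<in> {\<mu>. \<mu> \<in> partitions \<and> diagram \<mu> \<subseteq> diagram \<nu> \<and> horizontal_strip (skew \<nu> \<mu>)}"
    then have \<mu>: "\<mu> \<in> partitions" "diagram \<mu> \<subseteq> diagram \<nu>"
      by auto
    have len: "length \<mu> \<le> n"
      using diagram_subset_length[OF \<mu>(1) \<nu> \<mu>(2)] by (simp add: n_def)
    show "(\<Prod>i<n. c i (part \<mu> i)) * jt F' n (part \<mu>) =
        (\<Prod>(i, j)\<in>skew \<nu> \<mu>. u (int j - int i)) * Jt F' \<mu>"
      by (subst prod_skew[of \<nu> n]) (simp_all add: n_def c_def jt_pad[OF F' len, unfolded n_def])
  qed
  finally show ?thesis .
qed


section \<open>The Pieri rule for an arbitrary sequence H\<close>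

lemma finite_partitions_rows:
  assumes "\<And>i. i < n \<Longrightarrow> finite (S i)"
  shows "finite {\<nu>. \<nu> \<in> partitions \<and> length \<nu> \<le> n \<and> (\<forall>i<n. part \<nu> i \<in> S i)}"
proof (rule finite_imageD)
  let ?T = "{\<nu>. \<nu> \<in> partitions \<and> length \<nu> \<le> n \<and> (\<forall>i<n. part \<nu> i \<in> S i)}"
  let ?f = "\<lambda>\<nu>. restrict (part \<nu>) {..<n}"
  show "finite (?f ` ?T)"
  proof (rule finite_subset)
    show "?f ` ?T \<subseteq> PiE {..<n} S"
      by (rule image_subsetI) simp
    show "finite (PiE {..<n} S)"
      by (intro finite_PiE) (auto intro: assms)
  qed
  show "inj_on ?f ?T"
  proof (rule inj_onI)
    fix \<nu> \<mu> assume \<nu>: "\<nu> \<in> ?T" and \<mu>: "\<mu> \<in> ?T" and eq: "?f \<nu> = ?f \<mu>"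
    show "\<nu> = \<mu>"
    proof (rule partition_eqI)
      fix i
      show "part \<nu> i = part \<mu> i"
        using fun_cong[OF eq, of i] \<nu> \<mu> by (cases "i < n") (auto simp: part_def)
    qed (use \<nu> \<mu> in auto)
  qed
qed

interpretation fps_const_hom: comm_ring_hom "fps_const :: 'a::comm_ring_1 \<Rightarrow> 'a fps"
  by unfold_locales auto

text \<open>One determinant of size n + 1 over power series in X is evaluated twice; its rows
  consist of the tails \<open>Q m\<close>, the sum of H(m + e) X^e over e. Column operations make
  all columns but the last constant, and the last row then splits off \<open>Q 0\<close>, which
  gives the left-hand side as coefficient of X^r. Row operations instead cut every row below the
  first to the lengths between \<rho>_i and \<rho>_(i-1); multilinearity then sums over horizontal
  strips, and X counts the added boxes.\<close>

lemma pieri: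
  fixes H :: "int \<Rightarrow> 'a::comm_ring_1"
  assumes \<rho>: "\<rho> \<in> partitions" and H: "\<And>r. r < 0 \<Longrightarrow> H r = 0" "H 0 = 1"
  shows "H (int r) * Jt (\<lambda>_. H) \<rho> =
    (\<Sum>\<nu> | \<nu> \<in> partitions \<and> diagram \<rho> \<subseteq> diagram \<nu> \<and> horizontal_strip (skew \<nu> \<rho>) \<and>
      sum_list \<nu> = sum_list \<rho> + r. Jt (\<lambda>_. H) \<nu>)"
proof -
  define n where "n = length \<rho>"
  define Q where "Q m = Abs_fps (\<lambda>e. H (m + int e))" for m
  define A where "A i j = Q (int (part \<rho> i) - int i + int j)" for i j
  have Q: "Q m = fps_const (H m) + fps_X * Q (m + 1)" for m
    by (rule fps_ext) (auto simp: Q_def algebra_simps of_nat_diff)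
  have Q_sum: "Q m = (\<Sum>k\<in>{a..<a + d}. fps_X ^ (k - a) * fps_const (H (m + int (k - a)))) +
      fps_X ^ d * Q (m + int d)" for m d a
  proof (induction d)
    case (Suc d)
    show ?case
      by (subst Suc.IH, subst Q[of "m + int d"]) (simp add: algebra_simps)
  qed simp
  have "det (mat (Suc n) (Suc n) (\<lambda>(i, j). A i j)) =
      det (mat (Suc n) (Suc n) (\<lambda>(i, j). A i j - (if j = n then 0 else fps_X) * A i (Suc j)))"
    by (rule det_subtract_next_col[symmetric]) simp
  also have "\<dots> = det (mat (Suc n) (Suc n) (\<lambda>(i, j).
      if j = n then A i n else fps_const (H (int (part \<rho> i) - int i + int j))))"
  proof (intro arg_cong[of _ _ det] cong_mat refl, clarsimp)
    fix i j
    show "A i j - fps_X * A i (Suc j) = fps_const (H (int (part \<rho> i) - int i + int j))"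
      using Q[of "int (part \<rho> i) - int i + int j"] by (simp add: A_def algebra_simps)
  qed
  also have "\<dots> = A n n * det (mat n n (\<lambda>(i, j). fps_const (H (int (part \<rho> i) - int i + int j))))"
  proof (subst det_last_row_unit)
    show "(if j = n then A n n else fps_const (H (int (part \<rho> n) - int n + int j))) = 0" if "j < n" for j
      using that by (simp add: H part_def n_def)
    show "(if n = n then A n n else fps_const (H (int (part \<rho> n) - int n + int n))) *
        det (mat n n (\<lambda>(i, j). if j = n then A i n else fps_const (H (int (part \<rho> i) - int i + int j)))) =
        A n n * det (mat n n (\<lambda>(i, j). fps_const (H (int (part \<rho> i) - int i + int j))))"
      by (intro arg_cong2[of _ _ _ _ "(*)"] arg_cong[of _ _ det] cong_mat) auto
  qed
  also have "mat n n (\<lambda>(i, j). fps_const (H (int (part \<rho> i) - int i + int j))) =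
      map_mat fps_const (mat n n (\<lambda>(i, j). H (int (part \<rho> i) - int i + int j)))"
    by (rule eq_matI) auto
  also have "A n n * det \<dots> = A n n * fps_const (Jt (\<lambda>_. H) \<rho>)"
    by (simp only: fps_const_hom.hom_det) (simp add: Jt_def jt_def n_def)
  finally have det1: "det (mat (Suc n) (Suc n) (\<lambda>(i, j). A i j)) = A n n * fps_const (Jt (\<lambda>_. H) \<rho>)" .

  \<comment> \<open>The first row has no row above it by which it could be cut. It is cut at length
    B by hand: the tail that remains carries the factor X^(r+1) and does not reach the coefficient
    of X^r.\<close>
  define B where "B = part \<rho> 0 + r + 1"
  define S where "S i = (if i = 0 then {part \<rho> 0..B} else {part \<rho> i..part \<rho> (i - 1)})" for i
  define V where "V i k j = (if i = 0 \<and> k = B then Q (int k + int j)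
    else fps_const (H (int k - int i + int j)))" for i k j
  define w where "w i = (if i = 0 then 0 else fps_X ^ (part \<rho> (i - 1) - part \<rho> i + 1) :: 'a fps)" for i
  define E where "E f = (\<Sum>i<Suc n. f i - part \<rho> i)" for f
  define g where "g f = (if E f = r then jt (\<lambda>_. H) (Suc n) f else 0)" for f
  have mono: "part \<rho> (Suc i) \<le> part \<rho> i" for i
    using part_antimono[OF \<rho>, of i "Suc i"] by simp
  have finS: "finite (S i)" for i
    by (simp add: S_def)
  have "det (mat (Suc n) (Suc n) (\<lambda>(i, j). A i j)) =
      det (mat (Suc n) (Suc n) (\<lambda>(i, j). A i j - w i * A (i - 1) j))"
    by (rule det_subtract_prev_row[symmetric]) (simp add: w_def)
  also have "\<dots> = det (mat (Suc n) (Suc n) (\<lambda>(i, j). \<Sum>k\<in>S i. fps_X ^ (k - part \<rho> i) * V i k j))"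
  proof (intro arg_cong[of _ _ det] cong_mat refl, clarsimp)
    fix i j
    show "A i j - w i * A (i - Suc 0) j = (\<Sum>k\<in>S i. fps_X ^ (k - part \<rho> i) * V i k j)"
    proof (cases i)
      case 0
      have "S 0 = insert B {part \<rho> 0..<part \<rho> 0 + (r + 1)}"
        by (auto simp: S_def B_def)
      then have "(\<Sum>k\<in>S 0. fps_X ^ (k - part \<rho> 0) * V 0 k j) =
          fps_X ^ (r + 1) * Q (int B + int j) +
          (\<Sum>k\<in>{part \<rho> 0..<part \<rho> 0 + (r + 1)}. fps_X ^ (k - part \<rho> 0) * fps_const (H (int k + int j)))"
        by (simp add: V_def B_def)
      also have "(\<Sum>k\<in>{part \<rho> 0..<part \<rho> 0 + (r + 1)}. fps_X ^ (k - part \<rho> 0) * fps_const (H (int k + int j)))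
        = (\<Sum>k\<in>{part \<rho> 0..<part \<rho> 0 + (r + 1)}. fps_X ^ (k - part \<rho> 0) *
          fps_const (H (int (part \<rho> 0) + int j + int (k - part \<rho> 0))))"
        by (intro sum.cong refl) (simp add: of_nat_diff add_ac)
      finally show ?thesis
        using 0 Q_sum[of "int (part \<rho> 0) + int j" "part \<rho> 0" "r + 1"]
        by (simp add: A_def w_def B_def add_ac)
    next
      case (Suc i')
      define d where "d = part \<rho> i' - part \<rho> i + 1"
      have S: "S i = {part \<rho> i..<part \<rho> i + d}"
        using mono[of i'] Suc by (auto simp: S_def d_def)
      have "A i' j = Q (int (part \<rho> i) - int i + int j + int d)"
        using mono[of i'] Suc by (simp add: A_def d_def of_nat_diff add_ac)
      moreover have "(\<Sum>k\<in>S i. fps_X ^ (k - part \<rho> i) * V i k j) =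
          (\<Sum>k\<in>{part \<rho> i..<part \<rho> i + d}. fps_X ^ (k - part \<rho> i) *
          fps_const (H (int (part \<rho> i) - int i + int j + int (k - part \<rho> i))))"
        unfolding S using Suc by (intro sum.cong refl) (simp add: V_def of_nat_diff algebra_simps)
      moreover have "w i = fps_X ^ d"
        using Suc by (simp add: w_def d_def)
      ultimately show ?thesis
        using Suc Q_sum[of "int (part \<rho> i) - int i + int j" "part \<rho> i" d]
        by (simp add: A_def)
    qed
  qed
  also have "\<dots> = (\<Sum>f\<in>PiE {..<Suc n} S. fps_X ^ E f * det (mat (Suc n) (Suc n) (\<lambda>(i, j). V i (f i) j)))"
    by (subst det_sum_rows) (simp_all only: finS E_def power_sum)
  finally have det2: "det (mat (Suc n) (Suc n) (\<lambda>(i, j). A i j)) = \<dots>" .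

  have coeff: "fps_nth (fps_X ^ E f * det (mat (Suc n) (Suc n) (\<lambda>(i, j). V i (f i) j))) r = g f"
    if f: "f \<in> PiE {..<Suc n} S" for f
  proof (cases "f 0 = B")
    case True
    have "r < f 0 - part \<rho> 0" using True by (simp add: B_def)
    also have "\<dots> \<le> E f" unfolding E_def by (rule member_le_sum) auto
    finally show ?thesis by (simp add: fps_X_power_mult_nth g_def)
  next
    case False
    have "mat (Suc n) (Suc n) (\<lambda>(i, j). V i (f i) j) =
        map_mat fps_const (mat (Suc n) (Suc n) (\<lambda>(i, j). H (int (f i) - int i + int j)))"
      using False by (intro eq_matI) (auto simp: V_def)
    then have "det (mat (Suc n) (Suc n) (\<lambda>(i, j). V i (f i) j)) = fps_const (jt (\<lambda>_. H) (Suc n) f)"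
      by (simp only: fps_const_hom.hom_det) (simp add: jt_def)
    then show ?thesis
      by (auto simp: fps_X_power_mult_nth g_def)
  qed

  have "H (int r) * Jt (\<lambda>_. H) \<rho> = fps_nth (det (mat (Suc n) (Suc n) (\<lambda>(i, j). A i j))) r"
    unfolding det1 by (simp add: A_def Q_def part_def n_def)
  also have "\<dots> = (\<Sum>f\<in>PiE {..<Suc n} S. g f)"
    unfolding det2 fps_sum_nth by (rule sum.cong[OF refl coeff])
  also have "PiE {..<Suc n} S = {f. f \<in> PiE {..<Suc n} S \<and> (\<forall>i. Suc i < Suc n \<longrightarrow> f (Suc i) \<le> f i)}"
  proof -
    have "f (Suc i) \<le> f i" if "f \<in> PiE {..<Suc n} S" "Suc i < Suc n" for f i
    proof -
      have "f (Suc i) \<in> S (Suc i)" "f i \<in> S i"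
        using that by (auto simp: PiE_iff)
      then show ?thesis by (auto simp: S_def split: if_splits)
    qed
    then show ?thesis by blast
  qed
  also have "(\<Sum>f\<in>\<dots>. g f) =
      (\<Sum>\<nu> | \<nu> \<in> partitions \<and> length \<nu> \<le> Suc n \<and> (\<forall>i<Suc n. part \<nu> i \<in> S i). g (part \<nu>))"
  proof (rule sum_PiE_partitions)
    fix \<nu>
    have "E (restrict (part \<nu>) {..<Suc n}) = E (part \<nu>)"
      unfolding E_def by (intro sum.cong) auto
    moreover have "jt (\<lambda>_. H) (Suc n) (restrict (part \<nu>) {..<Suc n}) = jt (\<lambda>_. H) (Suc n) (part \<nu>)"
      by (rule jt_cong) auto
    ultimately show "g (restrict (part \<nu>) {..<Suc n}) = g (part \<nu>)"
      by (simp add: g_def)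
  qed
  also have "\<dots> = (\<Sum>\<nu> | \<nu> \<in> partitions \<and> diagram \<rho> \<subseteq> diagram \<nu> \<and> horizontal_strip (skew \<nu> \<rho>) \<and>
      sum_list \<nu> = sum_list \<rho> + r. Jt (\<lambda>_. H) \<nu>)"
  proof (rule sum.mono_neutral_cong_right)
    let ?T = "{\<nu>. \<nu> \<in> partitions \<and> length \<nu> \<le> Suc n \<and> (\<forall>i<Suc n. part \<nu> i \<in> S i)}"
    let ?U = "{\<nu>. \<nu> \<in> partitions \<and> diagram \<rho> \<subseteq> diagram \<nu> \<and> horizontal_strip (skew \<nu> \<rho>) \<and>
      sum_list \<nu> = sum_list \<rho> + r}"
    show "finite ?T"
      by (rule finite_partitions_rows[OF finS])
    have size: "E (part \<nu>) + sum_list \<rho> = sum_list \<nu>"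
      if "\<forall>i. part \<rho> i \<le> part \<nu> i" "length \<nu> \<le> Suc n" for \<nu>
    proof -
      have "E (part \<nu>) + sum_list \<rho> = (\<Sum>i<Suc n. (part \<nu> i - part \<rho> i) + part \<rho> i)"
        unfolding E_def sum.distrib by (subst sum_list_part[of \<rho> "Suc n"]) (simp_all add: n_def)
      also have "\<dots> = sum_list \<nu>"
        using that by (subst sum_list_part[of \<nu> "Suc n"]) simp_all
      finally show ?thesis .
    qed
    show sub: "?U \<subseteq> ?T"
    proof clarify
      fix \<nu> assume \<nu>: "\<nu> \<in> partitions" "diagram \<rho> \<subseteq> diagram \<nu>" "horizontal_strip (skew \<nu> \<rho>)"
        "sum_list \<nu> = sum_list \<rho> + r"
      have le: "part \<rho> i \<le> part \<nu> i" and strip: "part \<nu> (Suc i) \<le> part \<rho> i" for i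
        using \<nu> horizontal_strip_skew_iff[OF \<nu>(1) \<rho>] by (simp_all add: diagram_subset_iff)
      have "part \<nu> (Suc n) = 0"
        using strip[of n] by (simp add: part_def n_def)
      then have len: "length \<nu> \<le> Suc n"
        using part_pos_iff[OF \<nu>(1), of "Suc n"] by simp
      have "part \<nu> 0 - part \<rho> 0 \<le> E (part \<nu>)"
        unfolding E_def by (rule member_le_sum[of 0 "{..<Suc n}" "\<lambda>i. part \<nu> i - part \<rho> i"]) auto
      then have "part \<nu> 0 \<le> B"
        using size[of \<nu>] le len \<nu>(4) by (simp add: B_def)
      then have "part \<nu> i \<in> S i" for i
        using le[of i] strip[of "i - 1"] by (auto simp: S_def)
      then show "length \<nu> \<le> Suc n \<and> (\<forall>i<Suc n. part \<nu> i \<in> S i)"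
        using len by blast
    qed
    have T: "(\<forall>i. part \<rho> i \<le> part \<nu> i) \<and> (\<forall>i. part \<nu> (Suc i) \<le> part \<rho> i)" if "\<nu> \<in> ?T" for \<nu>
    proof (intro conjI allI)
      fix i
      show "part \<rho> i \<le> part \<nu> i"
      proof (cases "i < Suc n")
        case True
        then have "part \<nu> i \<in> S i" using that by blast
        then show ?thesis by (auto simp: S_def split: if_splits)
      qed (simp add: part_def n_def)
      show "part \<nu> (Suc i) \<le> part \<rho> i"
      proof (cases "Suc i < Suc n")
        case True
        then have "part \<nu> (Suc i) \<in> S (Suc i)" using that by blast
        then show ?thesis by (auto simp: S_def split: if_splits)
      next
        case False
        then have "part \<nu> (Suc i) = 0" using that by (simp add: part_def)
        then show ?thesis by simp
      qed
    qed
    show "\<forall>\<nu>\<in>?T - ?U. g (part \<nu>) = 0"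
    proof
      fix \<nu> assume \<nu>: "\<nu> \<in> ?T - ?U"
      then have T': "(\<forall>i. part \<rho> i \<le> part \<nu> i) \<and> (\<forall>i. part \<nu> (Suc i) \<le> part \<rho> i)"
        using T by blast
      have p: "\<nu> \<in> partitions" "length \<nu> \<le> Suc n" using \<nu> by blast+
      have "diagram \<rho> \<subseteq> diagram \<nu>" "horizontal_strip (skew \<nu> \<rho>)"
        using T' by (simp_all add: diagram_subset_iff horizontal_strip_skew_iff[OF p(1) \<rho>])
      with \<nu> p have "sum_list \<nu> \<noteq> sum_list \<rho> + r" by blast
      then show "g (part \<nu>) = 0"
        using size[of \<nu>] T' p by (auto simp: g_def)
    qed
    fix \<nu> assume \<nu>: "\<nu> \<in> ?U"
    then have "\<nu> \<in> ?T" using sub by blast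
    then have len: "length \<nu> \<le> Suc n" by blast
    have "\<forall>i. part \<rho> i \<le> part \<nu> i"
      using \<nu> unfolding diagram_subset_iff by blast
    then have "E (part \<nu>) = r"
      using size[of \<nu>] len \<nu> by simp
    moreover have "unital (\<lambda>_. H)"
      using H by (simp add: unital_def)
    ultimately show "g (part \<nu>) = Jt (\<lambda>_. H) \<nu>"
      by (simp add: g_def jt_pad[OF _ len])
  qed
  finally show ?thesis .
qed


section \<open>Schur functions and the Cauchy identity\<close>

definition mdeg :: "('v \<Rightarrow>\<^sub>0 nat) \<Rightarrow> nat" where
  "mdeg m = (\<Sum>i\<in>Poly_Mapping.keys m. Poly_Mapping.lookup m i)"

lemma keys_add_nat: "Poly_Mapping.keys (u + w :: 'v \<Rightarrow>\<^sub>0 nat) = Poly_Mapping.keys u \<union> Poly_Mapping.keys w"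
  by (auto simp: in_keys_iff lookup_add)

lemma mdeg_eq_sum:
  "finite A \<Longrightarrow> Poly_Mapping.keys m \<subseteq> A \<Longrightarrow> mdeg m = (\<Sum>i\<in>A. Poly_Mapping.lookup m i)"
  unfolding mdeg_def by (rule sum.mono_neutral_left) (auto simp: in_keys_iff)

lemma mdeg_add: "mdeg (u + w) = mdeg u + mdeg w"
proof -
  let ?A = "Poly_Mapping.keys u \<union> Poly_Mapping.keys w"
  have "mdeg (u + w) = (\<Sum>i\<in>?A. Poly_Mapping.lookup (u + w) i)"
    by (rule mdeg_eq_sum) (auto simp: keys_add_nat)
  also have "\<dots> = mdeg u + mdeg w"
    by (simp add: lookup_add sum.distrib mdeg_eq_sum[of ?A u] mdeg_eq_sum[of ?A w])
  finally show ?thesis .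
qed

lemma mdeg_single [simp]: "mdeg (Poly_Mapping.single i k) = k"
  by (simp add: mdeg_def)

lemma mdeg_zero [simp]: "mdeg 0 = 0"
  by (simp add: mdeg_def)

lemma mdeg_eq_0_iff: "mdeg m = 0 \<longleftrightarrow> m = 0"
proof
  assume "mdeg m = 0"
  then have "Poly_Mapping.lookup m i = 0" for i
    by (cases "i \<in> Poly_Mapping.keys m") (auto simp: mdeg_def in_keys_iff)
  then show "m = 0"
    by (intro poly_mapping_eqI) simp
qed simp

lemma single_minus_add: "m = (m - Poly_Mapping.single i (Poly_Mapping.lookup m i)) + Poly_Mapping.single i (Poly_Mapping.lookup m i)"
  for m :: "'v \<Rightarrow>\<^sub>0 nat"
  by (rule poly_mapping_eqI) (simp add: lookup_add lookup_minus lookup_single when_def)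

lemma mcoeff_simps [simp]:
  "mcoeff 0 m = 0"
  "mcoeff 1 m = (if m = 0 then 1 else 0)"
  "mcoeff (F + G) m = mcoeff F m + mcoeff G m"
  "mcoeff (F - G) m = mcoeff F m - mcoeff G m"
  "mcoeff (- F) m = - mcoeff F m"
  "mcoeff (mconst c) m = (if m = 0 then c else 0)"
  by (simp_all add: mfps_defs mconst_def)

lemma mcoeff_times: "mcoeff (F * G) m = (\<Sum>(u, w)\<in>splits m. mcoeff F u * mcoeff G w)"
  by (simp add: mfps_defs)

lemma mcoeff_sum [simp]: "mcoeff (sum f A) m = (\<Sum>i\<in>A. mcoeff (f i) m)"
  by (induction A rule: infinite_finite_induct) simp_all

lemma mcoeff_mconst_times [simp]: "mcoeff (mconst c * F) m = c * mcoeff F m"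
proof -
  have "mcoeff (mconst c * F) m = (\<Sum>p\<in>splits m. if p = (0, m) then c * mcoeff F m else 0)"
    unfolding mcoeff_times by (rule sum.cong) (auto simp: splits_def split: if_splits)
  also have "\<dots> = c * mcoeff F m"
    by (simp add: finite_splits) (simp add: splits_def)
  finally show ?thesis .
qed

interpretation mconst_hom: comm_ring_hom "mconst :: 'a::comm_ring_1 \<Rightarrow> ('v, 'a) mfps"
  by unfold_locales (auto intro!: mfps_eqI)

definition map_coeffs :: "('a \<Rightarrow> 'b) \<Rightarrow> ('v, 'a) mfps \<Rightarrow> ('v, 'b) mfps" where
  "map_coeffs \<phi> F = Mfps (\<lambda>m. \<phi> (mcoeff F m))"

lemma mcoeff_map_coeffs [simp]: "mcoeff (map_coeffs \<phi> F) m = \<phi> (mcoeff F m)"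
  by (simp add: map_coeffs_def)

lemma comm_ring_hom_map_coeffs:
  assumes "comm_ring_hom \<phi>"
  shows "comm_ring_hom (map_coeffs \<phi> :: ('v, 'a::comm_ring_1) mfps \<Rightarrow> ('v, 'b::comm_ring_1) mfps)"
proof -
  interpret \<phi>: comm_ring_hom \<phi> by fact
  show ?thesis
    by unfold_locales
      (auto intro!: mfps_eqI simp: mcoeff_times \<phi>.hom_sum \<phi>.hom_mult \<phi>.hom_add case_prod_beta)
qed

text \<open>Sets the variables of index at least n to 0. Being a ring homomorphism, it passes
  through determinants, and it makes induction on the number of variables possible.\<close>

definition restrict_vars :: "nat \<Rightarrow> (nat, 'a::zero) mfps \<Rightarrow> (nat, 'a) mfps" where
  "restrict_vars n F = Mfps (\<lambda>m. if Poly_Mapping.keys m \<subseteq> {..<n} then mcoeff F m else 0)"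

lemma mcoeff_restrict_vars [simp]:
  "mcoeff (restrict_vars n F) m = (if Poly_Mapping.keys m \<subseteq> {..<n} then mcoeff F m else 0)"
  by (simp add: restrict_vars_def)

interpretation restrict_vars: comm_ring_hom "restrict_vars n :: (nat, 'a::comm_ring_1) mfps \<Rightarrow> (nat, 'a) mfps"
proof
  fix F G :: "(nat, 'a) mfps"
  show "restrict_vars n (F * G) = restrict_vars n F * restrict_vars n G"
  proof (rule mfps_eqI)
    fix m
    show "mcoeff (restrict_vars n (F * G)) m = mcoeff (restrict_vars n F * restrict_vars n G) m"
    proof (cases "Poly_Mapping.keys m \<subseteq> {..<n}")
      case True
      then show ?thesis
        by (auto simp: mcoeff_times splits_def keys_add_nat intro!: sum.cong)
    next
      case False
      have "mcoeff (restrict_vars n F) u * mcoeff (restrict_vars n G) w = 0" if "(u, w) \<in> splits m" for u w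
        using that False by (auto simp: splits_def keys_add_nat)
      then have "mcoeff (restrict_vars n F * restrict_vars n G) m = 0"
        unfolding mcoeff_times by (intro sum.neutral) auto
      then show ?thesis using False by simp
    qed
  qed
qed (auto intro!: mfps_eqI)

definition mvar :: "'v \<Rightarrow> ('v, 'a::comm_ring_1) mfps" where
  "mvar i = Mfps (\<lambda>m. if m = Poly_Mapping.single i 1 then 1 else 0)"

lemma mcoeff_mvar_power_times:
  fixes F :: "('v, 'a::comm_ring_1) mfps"
  shows "mcoeff (mvar i ^ k * F) m = (if k \<le> Poly_Mapping.lookup m i then mcoeff F (m - Poly_Mapping.single i k) else 0)"
proof (induction k arbitrary: m)
  case (Suc k)
  have "mcoeff (mvar i * G) m = (if 1 \<le> Poly_Mapping.lookup m i then mcoeff G (m - Poly_Mapping.single i 1) else 0)"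
    for G :: "('v, 'a) mfps" and m
  proof -
    let ?e = "Poly_Mapping.single i (1::nat)"
    have "mcoeff (mvar i * G) m = (\<Sum>p\<in>splits m. if fst p = ?e then mcoeff G (snd p) else 0)"
      unfolding mcoeff_times by (rule sum.cong) (auto simp: mvar_def case_prod_beta)
    also have "\<dots> = (\<Sum>p\<in>{p \<in> splits m. fst p = ?e}. mcoeff G (snd p))"
      by (subst sum.inter_filter[OF finite_splits, symmetric]) simp
    also have "{p \<in> splits m. fst p = ?e} =
        (if 1 \<le> Poly_Mapping.lookup m i then {(?e, m - ?e)} else {})"
    proof (cases "1 \<le> Poly_Mapping.lookup m i")
      case True
      then have "?e + (m - ?e) = m"
        by (intro poly_mapping_eqI) (auto simp: lookup_add lookup_minus lookup_single when_def)
      then show ?thesis using True by (auto simp: splits_def)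
    next
      case False
      then have "?e + w \<noteq> m" for w
        by (metis add_diff_cancel_left' le_add1 lookup_add lookup_single_eq)
      then show ?thesis using False by (auto simp: splits_def)
    qed
    finally show ?thesis by simp
  qed
  then have "mcoeff (mvar i ^ Suc k * F) m =
      (if 1 \<le> Poly_Mapping.lookup m i then mcoeff (mvar i ^ k * F) (m - Poly_Mapping.single i 1) else 0)"
    by (simp only: power_Suc mult.assoc)
  also have "\<dots> = (if Suc k \<le> Poly_Mapping.lookup m i then
      mcoeff F (m - Poly_Mapping.single i 1 - Poly_Mapping.single i k) else 0)"
    by (auto simp: Suc.IH lookup_minus)
  also have "m - Poly_Mapping.single i 1 - Poly_Mapping.single i k = m - Poly_Mapping.single i (Suc k)"
    by (rule poly_mapping_eqI) (auto simp: lookup_minus lookup_single when_def)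
  finally show ?case .
qed simp

section \<open>Schur functions over any coefficient ring, Kostka numbers and branching\<close>

lemma mcoeff_hsym: "mcoeff (hsym r) m = (if int (mdeg m) = r then 1 else 0)"
  by (simp add: hsym_def mdeg_def)

lemma unital_hsym: "unital (\<lambda>_. hsym :: int \<Rightarrow> (nat, 'a::comm_ring_1) mfps)"
proof -
  have "hsym r = (0 :: (nat, 'a) mfps)" if "r < 0" for r
    using that by (intro mfps_eqI) (simp add: mcoeff_hsym)
  moreover have "hsym 0 = (1 :: (nat, 'a) mfps)"
    by (rule mfps_eqI) (simp add: mcoeff_hsym mdeg_eq_0_iff)
  ultimately show ?thesis
    by (simp add: unital_def)
qed

lemma schur_eq_Jt: "schur \<nu> = Jt (\<lambda>_. hsym) \<nu>"
  unfolding schur_def Jt_def jt_def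
  by (intro arg_cong[of _ _ det] cong_mat refl) (simp add: part_def)

lemma (in comm_ring_hom) hom_Jt: "hom (Jt G \<nu>) = Jt (\<lambda>l r. hom (G l r)) \<nu>"
proof -
  have "map_mat hom (mat n n (\<lambda>(i, j). G (a i) (b i j))) = mat n n (\<lambda>(i, j). hom (G (a i) (b i j)))" for n a b
    by (rule eq_matI) auto
  then show ?thesis
    by (simp add: Jt_def jt_def flip: hom_det)
qed

text \<open>Jacobi-Trudi determinants commute with a change of coefficients because the h_r do.
  Applied to the map from the integers, this makes the coefficients of Schur functions integers that
  are the same over every ring.\<close>

lemma map_coeffs_schur:
  assumes "comm_ring_hom \<phi>"
  shows "map_coeffs \<phi> (schur \<nu>) = schur \<nu>"
proof -
  interpret \<phi>: comm_ring_hom \<phi> by fact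
  interpret m: comm_ring_hom "map_coeffs \<phi> :: (nat, 'a) mfps \<Rightarrow> (nat, 'b) mfps"
    by (rule comm_ring_hom_map_coeffs[OF assms])
  have "map_coeffs \<phi> (hsym r) = hsym r" for r
    by (rule mfps_eqI) (simp add: mcoeff_hsym)
  then show ?thesis
    by (simp add: schur_eq_Jt m.hom_Jt)
qed

text \<open>The Kostka numbers, taken as coefficients of the integral Jacobi-Trudi determinant and
  not as counts of tableaux. What is used of them are branching, dominance and the value 1 on the
  diagonal.\<close>

definition kostka :: "nat list \<Rightarrow> (nat \<Rightarrow>\<^sub>0 nat) \<Rightarrow> int" where
  "kostka \<nu> m = mcoeff (schur \<nu>) m"

lemma mcoeff_schur: "mcoeff (schur \<nu> :: (nat, 'a::comm_ring_1) mfps) m = of_int (kostka \<nu> m)"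
proof -
  have "comm_ring_hom (of_int :: int \<Rightarrow> 'a)"
    by unfold_locales auto
  from map_coeffs_schur[OF this, of \<nu>] show ?thesis
    unfolding kostka_def by (metis mcoeff_map_coeffs)
qed

abbreviation hstrips_below :: "nat list \<Rightarrow> nat list set" where
  "hstrips_below \<nu> \<equiv> {\<mu>. \<mu> \<in> partitions \<and> diagram \<mu> \<subseteq> diagram \<nu> \<and> horizontal_strip (skew \<nu> \<mu>)}"

lemma finite_below: "\<nu> \<in> partitions \<Longrightarrow> finite {\<mu>. \<mu> \<in> partitions \<and> diagram \<mu> \<subseteq> diagram \<nu> \<and> P \<mu>}"
proof (rule finite_subset[OF _ finite_partitions_le])
  assume \<nu>: "\<nu> \<in> partitions"
  have "sum_list \<mu> \<le> sum_list \<nu>" if "\<mu> \<in> partitions" "diagram \<mu> \<subseteq> diagram \<nu>" for \<mu>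
    using card_skew[OF that(2) diagram_subset_length[OF that(1) \<nu> that(2)]] by simp
  then show "{\<mu>. \<mu> \<in> partitions \<and> diagram \<mu> \<subseteq> diagram \<nu> \<and> P \<mu>} \<subseteq> {\<mu> \<in> partitions. sum_list \<mu> \<le> sum_list \<nu>}"
    by blast
qed

text \<open>In n + 1 variables h_r is the h_r in n variables plus the last variable times the
  h_(r-1) in n + 1 variables. This is a recursion of the kind treated by
  \<open>Jt_horizontal\<close>, with the last variable as factor of every box.\<close>

lemma kostka_branch:
  assumes \<nu>: "\<nu> \<in> partitions" and m: "Poly_Mapping.keys m \<subseteq> {..<Suc n}"
  shows "kostka \<nu> m = (\<Sum>\<mu> | \<mu> \<in> hstrips_below \<nu> \<and> card (skew \<nu> \<mu>) = Poly_Mapping.lookup m n.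
    kostka \<mu> (m - Poly_Mapping.single n (Poly_Mapping.lookup m n)))"
proof -
  let ?h = "\<lambda>n r. restrict_vars n (hsym r) :: (nat, int) mfps"
  have rec: "?h (Suc n) r = ?h n r + mvar n * ?h (Suc n) (r - 1)" for r
  proof (rule mfps_eqI)
    fix m :: "nat \<Rightarrow>\<^sub>0 nat"
    have *: "Poly_Mapping.keys m \<subseteq> {..<n} \<longleftrightarrow> Poly_Mapping.keys m \<subseteq> {..<Suc n} \<and> Poly_Mapping.lookup m n = 0"
    proof (cases "Poly_Mapping.lookup m n = 0")
      case True
      then have "n \<notin> Poly_Mapping.keys m" by (simp add: in_keys_iff)
      then show ?thesis using True by (simp add: lessThan_Suc subset_insert)
    next
      case False
      then have "n \<in> Poly_Mapping.keys m" by (simp add: in_keys_iff)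
      then show ?thesis using False by auto
    qed
    have "mcoeff (mvar n * ?h (Suc n) (r - 1)) m =
        (if 1 \<le> Poly_Mapping.lookup m n \<and> Poly_Mapping.keys m \<subseteq> {..<Suc n} \<and> int (mdeg m) = r then 1 else 0)"
    proof (cases "1 \<le> Poly_Mapping.lookup m n")
      case True
      let ?w = "m - Poly_Mapping.single n 1"
      have m: "m = ?w + Poly_Mapping.single n 1"
        using True by (intro poly_mapping_eqI) (auto simp: lookup_add lookup_minus lookup_single when_def)
      have "mdeg m = mdeg ?w + 1"
        using arg_cong[OF m, of mdeg] by (simp add: mdeg_add)
      moreover have "Poly_Mapping.keys m = Poly_Mapping.keys ?w \<union> {n}"
        using arg_cong[OF m, of Poly_Mapping.keys] by (simp add: keys_add_nat)
      ultimately show ?thesis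
        using True mcoeff_mvar_power_times[of n 1 "?h (Suc n) (r - 1)" m] by (auto simp: mcoeff_hsym)
    next
      case False
      then show ?thesis
        using mcoeff_mvar_power_times[of n 1 "?h (Suc n) (r - 1)" m] by simp
    qed
    then show "mcoeff (?h (Suc n) r) m = mcoeff (?h n r + mvar n * ?h (Suc n) (r - 1)) m"
      by (auto simp: mcoeff_hsym *)
  qed
  have un: "unital (\<lambda>_. ?h n)"
    using unital_hsym[where 'a = int] unfolding unital_def by simp
  let ?e = "Poly_Mapping.single n (Poly_Mapping.lookup m n)"
  have "restrict_vars (Suc n) (schur \<nu> :: (nat, int) mfps) = Jt (\<lambda>_. ?h (Suc n)) \<nu>"
    by (simp add: schur_eq_Jt restrict_vars.hom_Jt)
  also have "\<dots> = (\<Sum>\<mu>\<in>hstrips_below \<nu>. (\<Prod>(i, j)\<in>skew \<nu> \<mu>. mvar n) * Jt (\<lambda>_. ?h n) \<mu>)"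
    using unital_hsym[where 'a = int]
    by (intro Jt_horizontal[where F = "\<lambda>_. ?h (Suc n)" and F' = "\<lambda>_. ?h n" and u = "\<lambda>_. mvar n"] \<nu> un rec)
      (simp add: unital_def)
  also have "\<dots> = (\<Sum>\<mu>\<in>hstrips_below \<nu>. mvar n ^ card (skew \<nu> \<mu>) * restrict_vars n (schur \<mu>))"
    by (simp add: schur_eq_Jt restrict_vars.hom_Jt case_prod_beta)
  finally have expand: "restrict_vars (Suc n) (schur \<nu> :: (nat, int) mfps) =
    (\<Sum>\<mu>\<in>hstrips_below \<nu>. mvar n ^ card (skew \<nu> \<mu>) * restrict_vars n (schur \<mu>))" .
  have "kostka \<nu> m = mcoeff (restrict_vars (Suc n) (schur \<nu>)) m"
    using m by (simp add: kostka_def)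
  also have "\<dots> = (\<Sum>\<mu>\<in>hstrips_below \<nu>. mcoeff (mvar n ^ card (skew \<nu> \<mu>) * restrict_vars n (schur \<mu>)) m)"
    unfolding expand by (rule mcoeff_sum)
  also have "\<dots> = (\<Sum>\<mu>\<in>hstrips_below \<nu>.
      if card (skew \<nu> \<mu>) = Poly_Mapping.lookup m n then kostka \<mu> (m - ?e) else 0)"
  proof (rule sum.cong)
    fix \<mu>
    let ?k = "card (skew \<nu> \<mu>)"
    \<comment> \<open>The restricted Schur function does not contain the last variable, so the power
      \<open>?k\<close> split off must exhaust its exponent in m.\<close>
    have "Poly_Mapping.keys (m - Poly_Mapping.single n ?k) \<subseteq> {..<n} \<longleftrightarrow> Poly_Mapping.lookup m n \<le> ?k"
    proof
      assume "Poly_Mapping.keys (m - Poly_Mapping.single n ?k) \<subseteq> {..<n}"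
      then have "n \<notin> Poly_Mapping.keys (m - Poly_Mapping.single n ?k)"
        by auto
      then show "Poly_Mapping.lookup m n \<le> ?k"
        by (simp add: in_keys_iff lookup_minus)
    next
      assume *: "Poly_Mapping.lookup m n \<le> ?k"
      show "Poly_Mapping.keys (m - Poly_Mapping.single n ?k) \<subseteq> {..<n}"
      proof
        fix i assume "i \<in> Poly_Mapping.keys (m - Poly_Mapping.single n ?k)"
        then have "i \<noteq> n" "i \<in> Poly_Mapping.keys m"
          using * by (auto simp: in_keys_iff lookup_minus)
        then show "i \<in> {..<n}"
          using m by (auto simp: less_Suc_eq)
      qed
    qed
    then show "mcoeff (mvar n ^ ?k * restrict_vars n (schur \<mu>)) m =
        (if ?k = Poly_Mapping.lookup m n then kostka \<mu> (m - ?e) else 0)"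
      by (auto simp: kostka_def mcoeff_mvar_power_times)
  qed simp
  also have "\<dots> = (\<Sum>\<mu> | \<mu> \<in> hstrips_below \<nu> \<and> card (skew \<nu> \<mu>) = Poly_Mapping.lookup m n. kostka \<mu> (m - ?e))"
    by (rule sum.inter_filter[symmetric]) (rule finite_below[OF \<nu>])
  finally show ?thesis .
qed

lemma keys_minus_last:
  fixes m :: "nat \<Rightarrow>\<^sub>0 nat"
  assumes "Poly_Mapping.keys m \<subseteq> {..<Suc n}"
  shows "Poly_Mapping.keys (m - Poly_Mapping.single n (Poly_Mapping.lookup m n)) \<subseteq> {..<n}"
proof
  fix i assume "i \<in> Poly_Mapping.keys (m - Poly_Mapping.single n (Poly_Mapping.lookup m n))"
  then have "i \<noteq> n" "i \<in> Poly_Mapping.keys m"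
    by (auto simp: in_keys_iff lookup_minus)
  then show "i \<in> {..<n}"
    using assms by (auto simp: less_Suc_eq)
qed

lemma Nil_partition [simp]: "[] \<in> partitions"
  by (simp add: partitions_def)

text \<open>Without variables h_r is 0 for r > 0, and the first row of the determinant of a nonempty
  partition has only entries of positive degree.\<close>

lemma kostka_zero: "\<nu> \<in> partitions \<Longrightarrow> kostka \<nu> 0 = (if \<nu> = [] then 1 else 0)"
proof -
  assume \<nu>: "\<nu> \<in> partitions"
  let ?h = "\<lambda>r. restrict_vars 0 (hsym r) :: (nat, int) mfps"
  have h: "?h r = (if r = 0 then 1 else 0)" for r
    by (rule mfps_eqI) (auto simp: mcoeff_hsym)
  have "kostka \<nu> 0 = mcoeff (restrict_vars 0 (schur \<nu>)) 0"
    by (simp add: kostka_def)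
  also have "restrict_vars 0 (schur \<nu>) = Jt (\<lambda>_. ?h) \<nu>"
    by (simp add: schur_eq_Jt restrict_vars.hom_Jt)
  also have "\<dots> = (if \<nu> = [] then 1 else 0)"
  proof (cases \<nu>)
    case Nil
    then show ?thesis by (simp add: Jt_def jt_def)
  next
    case (Cons a \<nu>')
    let ?n = "length \<nu>"
    let ?A = "mat ?n ?n (\<lambda>(i, j). ?h (int (part \<nu> i) - int i + int j))"
    have "?A $$ (0, j) = 0" if "j < ?n" for j
      using that part_pos_iff[OF \<nu>, of 0] Cons by (simp add: h)
    then have "det ?A = 0"
      using Cons by (subst laplace_expansion_row[of _ ?n 0]) (auto simp del: index_mat)
    then show ?thesis using Cons by (simp add: Jt_def jt_def)
  qed
  finally show ?thesis by simp
qed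

text \<open>The inequality says that \<nu> dominates m. In the induction along the branching rule,
  partial sums with k \<le> n are inherited from \<mu>, which lies inside \<nu>; for k > n both
  sides are the common total. Interlacing with a \<mu> of at most n rows bounds the length.\<close>

lemma kostka_nonzero:
  assumes "\<nu> \<in> partitions" "Poly_Mapping.keys m \<subseteq> {..<n}" "kostka \<nu> m \<noteq> 0"
  shows "length \<nu> \<le> n \<and> sum_list \<nu> = mdeg m \<and>
    (\<forall>k. (\<Sum>i<k. Poly_Mapping.lookup m i) \<le> (\<Sum>i<k. part \<nu> i))"
  using assms
proof (induction n arbitrary: \<nu> m)
  case 0
  then have "m = 0" by (simp flip: keys_eq_empty)
  with 0 have "\<nu> = []" by (simp add: kostka_zero split: if_splits)
  then show ?case using \<open>m = 0\<close> by simp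
next
  case (Suc n)
  let ?a = "Poly_Mapping.lookup m n"
  let ?w = "m - Poly_Mapping.single n ?a"
  have "(\<Sum>\<mu> | \<mu> \<in> hstrips_below \<nu> \<and> card (skew \<nu> \<mu>) = ?a. kostka \<mu> ?w) \<noteq> 0"
    using kostka_branch[OF Suc.prems(1,2)] Suc.prems(3) by simp
  then obtain \<mu> where "\<mu> \<in> {\<mu>. \<mu> \<in> hstrips_below \<nu> \<and> card (skew \<nu> \<mu>) = ?a}" "kostka \<mu> ?w \<noteq> 0"
    by (rule sum.not_neutral_contains_not_neutral)
  then have \<mu>: "\<mu> \<in> partitions" "diagram \<mu> \<subseteq> diagram \<nu>" "horizontal_strip (skew \<nu> \<mu>)"
    "card (skew \<nu> \<mu>) = ?a" "kostka \<mu> ?w \<noteq> 0"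
    by auto
  have IH: "length \<mu> \<le> n" "sum_list \<mu> = mdeg ?w"
    "\<And>k. (\<Sum>i<k. Poly_Mapping.lookup ?w i) \<le> (\<Sum>i<k. part \<mu> i)"
    using Suc.IH[OF \<mu>(1) keys_minus_last[OF Suc.prems(2)] \<mu>(5)] by auto
  have "part \<nu> (Suc n) \<le> part \<mu> n"
    using \<mu>(3) horizontal_strip_skew_iff[OF Suc.prems(1) \<mu>(1)] by blast
  also have "\<dots> = 0" using IH(1) by (simp add: part_def)
  finally have len: "length \<nu> \<le> Suc n"
    using part_pos_iff[OF Suc.prems(1), of "Suc n"] by simp
  have m: "mdeg m = mdeg ?w + ?a"
    by (subst single_minus_add[of m n]) (simp add: mdeg_add)
  have size: "sum_list \<nu> = mdeg m"
    using card_skew[OF \<mu>(2) diagram_subset_length[OF \<mu>(1) Suc.prems(1) \<mu>(2)]] \<mu>(4) IH(2) m by simp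
  have "(\<Sum>i<k. Poly_Mapping.lookup m i) \<le> (\<Sum>i<k. part \<nu> i)" for k
  proof (cases "k \<le> n")
    case True
    then have "(\<Sum>i<k. Poly_Mapping.lookup m i) = (\<Sum>i<k. Poly_Mapping.lookup ?w i)"
      by (intro sum.cong) (auto simp: lookup_minus lookup_single when_def)
    also have "\<dots> \<le> (\<Sum>i<k. part \<mu> i)" by (rule IH)
    also have "\<dots> \<le> (\<Sum>i<k. part \<nu> i)"
      using \<mu>(2) by (intro sum_mono) (simp add: diagram_subset_iff)
    finally show ?thesis .
  next
    case False
    then have "(\<Sum>i<k. Poly_Mapping.lookup m i) = mdeg m"
      using Suc.prems(2) by (intro mdeg_eq_sum[symmetric]) auto
    also have "\<dots> = (\<Sum>i<k. part \<nu> i)"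
      using False len by (subst size[symmetric], intro sum_list_part) simp
    finally show ?thesis by simp
  qed
  then show ?case using len size by blast
qed

lemma take_partition: "\<nu> \<in> partitions \<Longrightarrow> take n \<nu> \<in> partitions"
  by (auto simp: partitions_def sorted_wrt_take dest: in_set_takeD)

lemma part_take: "part (take n \<nu>) i = (if i < n then part \<nu> i else 0)"
  by (auto simp: part_def)

text \<open>Only one \<mu> contributes to the branching rule. It has at most n rows, lies inside
  \<nu>, and its size is that of \<nu> without row n, so it equals \<nu> without that row.\<close>

lemma kostka_diagonal:
  assumes "\<nu> \<in> partitions" "length \<nu> \<le> n" "\<And>i. Poly_Mapping.lookup m i = part \<nu> i"
  shows "kostka \<nu> m = 1"
  using assms
proof (induction n arbitrary: \<nu> m)
  case 0
  then have "m = 0" by (intro poly_mapping_eqI) (simp add: part_def)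
  then show ?case using 0 by (simp add: kostka_zero)
next
  case (Suc n)
  let ?a = "Poly_Mapping.lookup m n"
  let ?w = "m - Poly_Mapping.single n ?a"
  let ?S = "{\<mu>. \<mu> \<in> hstrips_below \<nu> \<and> card (skew \<nu> \<mu>) = ?a}"
  have keys: "Poly_Mapping.keys m \<subseteq> {..<Suc n}"
    using Suc.prems(2,3) by (auto simp: in_keys_iff part_def split: if_splits)
  have w: "Poly_Mapping.lookup ?w i = part (take n \<nu>) i" for i
    using Suc.prems(2,3) by (auto simp: lookup_minus lookup_single when_def part_take part_def)
  have size: "sum_list \<nu> = sum_list (take n \<nu>) + part \<nu> n"
    using Suc.prems(2) by (simp add: sum_list_part[of \<nu> "Suc n"] sum_list_part[of "take n \<nu>" n] part_take)
  have sub: "diagram (take n \<nu>) \<subseteq> diagram \<nu>"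
    by (simp add: diagram_subset_iff part_take)
  have strip: "horizontal_strip (skew \<nu> (take n \<nu>))"
    unfolding horizontal_strip_skew_iff[OF Suc.prems(1) take_partition[OF Suc.prems(1)]]
  proof
    fix i
    show "part \<nu> (Suc i) \<le> part (take n \<nu>) i"
      using part_antimono[OF Suc.prems(1), of i "Suc i"] Suc.prems(2)
      by (cases "i < n") (simp_all add: part_take, simp add: part_def)
  qed
  have "card (skew \<nu> (take n \<nu>)) = ?a"
    using card_skew[OF sub] size Suc.prems(3) by simp
  then have mem: "take n \<nu> \<in> ?S"
    using sub strip take_partition[OF Suc.prems(1)] by simp
  have other: "kostka \<mu> ?w = 0" if "\<mu> \<in> ?S - {take n \<nu>}" for \<mu>
  proof (rule ccontr)
    assume nz: "kostka \<mu> ?w \<noteq> 0"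
    have \<mu>: "\<mu> \<in> partitions" "diagram \<mu> \<subseteq> diagram \<nu>" "card (skew \<nu> \<mu>) = ?a" "\<mu> \<noteq> take n \<nu>"
      using that by auto
    have len: "length \<mu> \<le> n"
      using kostka_nonzero[OF \<mu>(1) keys_minus_last[OF keys] nz] by blast
    have "sum_list \<mu> = sum_list (take n \<nu>)"
      using card_skew[OF \<mu>(2) diagram_subset_length[OF \<mu>(1) Suc.prems(1) \<mu>(2)]] \<mu>(3) size Suc.prems(3)
      by simp
    then have eq: "(\<Sum>i<n. part \<mu> i) = (\<Sum>i<n. part (take n \<nu>) i)"
      using len sum_list_part[of \<mu> n] sum_list_part[of "take n \<nu>" n] by simp
    have le: "part \<mu> i \<le> part (take n \<nu>) i" if "i < n" for i
      using \<mu>(2) that by (simp add: part_take diagram_subset_iff)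
    have "part \<mu> i = part (take n \<nu>) i" for i
    proof (cases "i < n")
      case True
      show ?thesis
        using sum_mono_inv[OF eq, of i] le True by simp
    qed (use len in \<open>simp add: part_def\<close>)
    then show False
      using partition_eqI[OF \<mu>(1) take_partition[OF Suc.prems(1)]] \<mu>(4) by blast
  qed
  have fin: "finite ?S"
    by (rule finite_subset[OF _ finite_below[OF Suc.prems(1), of "\<lambda>_. True"]]) auto
  have "kostka \<nu> m = (\<Sum>\<mu>\<in>?S. kostka \<mu> ?w)"
    by (rule kostka_branch[OF Suc.prems(1) keys])
  also have "\<dots> = kostka (take n \<nu>) ?w"
    using sum.remove[OF fin mem, of "\<lambda>\<mu>. kostka \<mu> ?w"] sum.neutral[of "?S - {take n \<nu>}"] other
    by simp
  also have "\<dots> = 1"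
    by (rule Suc.IH[OF take_partition[OF Suc.prems(1)] _ w]) simp
  finally show ?case .
qed

text \<open>The coefficient of y^m in the product of H(y_j) over all j, for series H with constant
  term 1.\<close>

definition hprod :: "(int \<Rightarrow> 'a::comm_ring_1) \<Rightarrow> ('v \<Rightarrow>\<^sub>0 nat) \<Rightarrow> 'a" where
  "hprod H m = (\<Prod>k\<in>Poly_Mapping.keys m. H (int (Poly_Mapping.lookup m k)))"

lemma hprod_eq_prod:
  "H 0 = 1 \<Longrightarrow> finite A \<Longrightarrow> Poly_Mapping.keys m \<subseteq> A \<Longrightarrow>
    hprod H m = (\<Prod>k\<in>A. H (int (Poly_Mapping.lookup m k)))"
  unfolding hprod_def by (rule prod.mono_neutral_left) (auto simp: in_keys_iff)

lemma finite_partitions_eq: "finite {\<nu> \<in> partitions. sum_list \<nu> = n}"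
  by (rule finite_subset[OF _ finite_partitions_le[of n]]) auto

text \<open>The last variable is split off. The factor H of its exponent acts on determinants by the
  Pieri rule, while Kostka numbers obey the branching rule; both involve the same pairs of
  partitions that differ by a horizontal strip, and exchanging the two sums closes the induction.
  Nothing about H enters except its vanishing in negative degrees and its constant term, so the
  identity may later be specialised freely.\<close>

theorem cauchy_identity:
  fixes H :: "int \<Rightarrow> 'a::comm_ring_1"
  assumes H: "\<And>r. r < 0 \<Longrightarrow> H r = 0" "H 0 = 1"
  shows "hprod H m = (\<Sum>\<nu> | \<nu> \<in> partitions \<and> sum_list \<nu> = mdeg m. of_int (kostka \<nu> m) * Jt (\<lambda>_. H) \<nu>)"
proof -
  have "Poly_Mapping.keys m \<subseteq> {..<n} \<Longrightarrow> hprod H m =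
      (\<Sum>\<nu> | \<nu> \<in> partitions \<and> sum_list \<nu> = mdeg m. of_int (kostka \<nu> m) * Jt (\<lambda>_. H) \<nu>)" for n
  proof (induction n arbitrary: m)
    case 0
    then have m: "m = 0" by (simp flip: keys_eq_empty)
    have "\<nu> = []" if "\<nu> \<in> partitions" "sum_list \<nu> = 0" for \<nu>
      using length_le_sum_list[OF that(1)] that(2) by simp
    then have "{\<nu>. \<nu> \<in> partitions \<and> sum_list \<nu> = 0} = {[]}"
      by auto
    then show ?case by (simp add: m hprod_def kostka_zero Jt_def jt_def)
  next
    case (Suc n)
    let ?a = "Poly_Mapping.lookup m n"
    let ?w = "m - Poly_Mapping.single n ?a"
    let ?P = "\<lambda>d. {\<nu> \<in> partitions. sum_list \<nu> = d}"
    let ?R = "\<lambda>\<mu> \<nu>. diagram \<mu> \<subseteq> diagram \<nu> \<and> horizontal_strip (skew \<nu> \<mu>)"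
    have m: "mdeg m = mdeg ?w + ?a"
      by (subst single_minus_add[of m n]) (simp add: mdeg_add)
    have "hprod H m = (\<Prod>k<n. H (int (Poly_Mapping.lookup m k))) * H (int ?a)"
      using Suc.prems by (subst hprod_eq_prod[of H "{..<Suc n}"]) (simp_all add: H)
    also have "(\<Prod>k<n. H (int (Poly_Mapping.lookup m k))) = hprod H ?w"
      using keys_minus_last[OF Suc.prems]
      by (subst hprod_eq_prod[of H "{..<n}"])
        (auto simp: H lookup_minus lookup_single when_def intro!: prod.cong)
    also have "hprod H ?w = (\<Sum>\<mu>\<in>?P (mdeg ?w). of_int (kostka \<mu> ?w) * Jt (\<lambda>_. H) \<mu>)"
      by (rule Suc.IH[OF keys_minus_last[OF Suc.prems]])
    also have "\<dots> * H (int ?a) = (\<Sum>\<mu>\<in>?P (mdeg ?w). of_int (kostka \<mu> ?w) * (H (int ?a) * Jt (\<lambda>_. H) \<mu>))"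
      by (simp add: sum_distrib_left mult_ac)
    also have "\<dots> = (\<Sum>\<mu>\<in>?P (mdeg ?w). \<Sum>\<nu>\<in>{\<nu>. \<nu> \<in> ?P (mdeg m) \<and> ?R \<mu> \<nu>}.
        of_int (kostka \<mu> ?w) * Jt (\<lambda>_. H) \<nu>)"
    proof (rule sum.cong[OF refl])
      fix \<mu> assume \<mu>: "\<mu> \<in> ?P (mdeg ?w)"
      have "{\<nu>. \<nu> \<in> partitions \<and> diagram \<mu> \<subseteq> diagram \<nu> \<and> horizontal_strip (skew \<nu> \<mu>) \<and>
          sum_list \<nu> = sum_list \<mu> + ?a} = {\<nu>. \<nu> \<in> ?P (mdeg m) \<and> ?R \<mu> \<nu>}"
        using \<mu> m by auto
      moreover have "\<mu> \<in> partitions" using \<mu> by blast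
      ultimately show "of_int (kostka \<mu> ?w) * (H (int ?a) * Jt (\<lambda>_. H) \<mu>) =
          (\<Sum>\<nu>\<in>{\<nu>. \<nu> \<in> ?P (mdeg m) \<and> ?R \<mu> \<nu>}. of_int (kostka \<mu> ?w) * Jt (\<lambda>_. H) \<nu>)"
        using pieri[where H = H and r = ?a and \<rho> = \<mu>] H by (simp add: sum_distrib_left)
    qed
    also have "\<dots> = (\<Sum>\<nu>\<in>?P (mdeg m). \<Sum>\<mu>\<in>{\<mu>. \<mu> \<in> ?P (mdeg ?w) \<and> ?R \<mu> \<nu>}.
        of_int (kostka \<mu> ?w) * Jt (\<lambda>_. H) \<nu>)"
      by (rule sum.swap_restrict) (rule finite_partitions_eq)+
    also have "\<dots> = (\<Sum>\<nu>\<in>?P (mdeg m). of_int (kostka \<nu> m) * Jt (\<lambda>_. H) \<nu>)"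
    proof (rule sum.cong[OF refl])
      fix \<nu> assume \<nu>: "\<nu> \<in> ?P (mdeg m)"
      have "sum_list \<mu> = mdeg ?w \<longleftrightarrow> card (skew \<nu> \<mu>) = ?a"
        if "\<mu> \<in> partitions" "diagram \<mu> \<subseteq> diagram \<nu>" for \<mu>
        using card_skew[OF that(2) diagram_subset_length[OF that(1) _ that(2)]] \<nu> m by auto
      then have "{\<mu>. \<mu> \<in> ?P (mdeg ?w) \<and> ?R \<mu> \<nu>} = {\<mu>. \<mu> \<in> hstrips_below \<nu> \<and> card (skew \<nu> \<mu>) = ?a}"
        by blast
      then have "kostka \<nu> m = (\<Sum>\<mu>\<in>{\<mu>. \<mu> \<in> ?P (mdeg ?w) \<and> ?R \<mu> \<nu>}. kostka \<mu> ?w)"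
        using kostka_branch[OF _ Suc.prems, of \<nu>] \<nu> by simp
      then show "(\<Sum>\<mu>\<in>{\<mu>. \<mu> \<in> ?P (mdeg ?w) \<and> ?R \<mu> \<nu>}. of_int (kostka \<mu> ?w) * Jt (\<lambda>_. H) \<nu>) =
          of_int (kostka \<nu> m) * Jt (\<lambda>_. H) \<nu>"
        by (simp add: sum_distrib_right)
    qed
    finally show ?case by simp
  qed
  moreover obtain n where "Poly_Mapping.keys m \<subseteq> {..<n}"
    using finite_nat_bounded[OF finite_keys] by blast
  ultimately show ?thesis .
qed


section \<open>Polynomials in the power sums\<close>

lemma poly_mapping_eq_sum_single:
  fixes p :: "'a \<Rightarrow>\<^sub>0 'b::comm_monoid_add"
  shows "p = (\<Sum>m\<in>Poly_Mapping.keys p. Poly_Mapping.single m (Poly_Mapping.lookup p m))"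
proof (rule poly_mapping_eqI)
  fix k
  show "Poly_Mapping.lookup p k =
      Poly_Mapping.lookup (\<Sum>m\<in>Poly_Mapping.keys p. Poly_Mapping.single m (Poly_Mapping.lookup p m)) k"
    by (cases "k \<in> Poly_Mapping.keys p")
      (auto simp: lookup_sum lookup_single when_def in_keys_iff)
qed

text \<open>Both sides are biadditive, so multiplicativity needs to be checked on single terms
  only.\<close>

lemma poly_mapping_mult_hom:
  fixes f :: "('a::comm_monoid_add \<Rightarrow>\<^sub>0 'b::comm_ring_1) \<Rightarrow> 'c::comm_ring_1"
  assumes add: "\<And>p q. f (p + q) = f p + f q"
    and single: "\<And>m n x y. f (Poly_Mapping.single (m + n) (x * y)) =
      f (Poly_Mapping.single m x) * f (Poly_Mapping.single n y)"
  shows "f (p * q) = f p * f q"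
proof -
  have zero: "f 0 = 0"
    using add[of 0 0] by simp
  have sum1: "f (sum g A) = (\<Sum>i\<in>A. f (g i))" for g :: "'a \<Rightarrow> _" and A
    by (induction A rule: infinite_finite_induct) (simp_all add: zero add)
  have sum2: "f (sum g A) = (\<Sum>i\<in>A. f (g i))" for g :: "'a \<times> 'a \<Rightarrow> _" and A
    by (induction A rule: infinite_finite_induct) (simp_all add: zero add)
  let ?s = "\<lambda>p m. Poly_Mapping.single m (Poly_Mapping.lookup p m)"
  have "p * q = (\<Sum>m\<in>Poly_Mapping.keys p. ?s p m) * (\<Sum>n\<in>Poly_Mapping.keys q. ?s q n)"
    by (simp flip: poly_mapping_eq_sum_single)
  also have "\<dots> = (\<Sum>(m, n)\<in>Poly_Mapping.keys p \<times> Poly_Mapping.keys q. ?s p m * ?s q n)"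
    by (simp add: sum_product sum.cartesian_product)
  finally have "f (p * q) = (\<Sum>(m, n)\<in>Poly_Mapping.keys p \<times> Poly_Mapping.keys q. f (?s p m) * f (?s q n))"
    by (simp add: sum2 case_prod_beta mult_single single)
  also have "\<dots> = (\<Sum>m\<in>Poly_Mapping.keys p. f (?s p m)) * (\<Sum>n\<in>Poly_Mapping.keys q. f (?s q n))"
    by (simp add: sum_product sum.cartesian_product)
  also have "\<dots> = f (\<Sum>m\<in>Poly_Mapping.keys p. ?s p m) * f (\<Sum>n\<in>Poly_Mapping.keys q. ?s q n)"
    by (simp add: sum1)
  finally show ?thesis
    by (simp flip: poly_mapping_eq_sum_single)
qed

definition mon_eval :: "('v \<Rightarrow> 'r::comm_ring_1) \<Rightarrow> ('v \<Rightarrow>\<^sub>0 nat) \<Rightarrow> 'r" where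
  "mon_eval v m = (\<Prod>k\<in>Poly_Mapping.keys m. v k ^ Poly_Mapping.lookup m k)"

lemma mon_eval_eq_prod:
  "finite A \<Longrightarrow> Poly_Mapping.keys m \<subseteq> A \<Longrightarrow> mon_eval v m = (\<Prod>k\<in>A. v k ^ Poly_Mapping.lookup m k)"
  unfolding mon_eval_def by (rule prod.mono_neutral_left) (auto simp: in_keys_iff)

lemma mon_eval_add: "mon_eval v (m + n) = mon_eval v m * mon_eval v n"
proof -
  let ?A = "Poly_Mapping.keys m \<union> Poly_Mapping.keys n"
  have "mon_eval v (m + n) = (\<Prod>k\<in>?A. v k ^ Poly_Mapping.lookup (m + n) k)"
    by (rule mon_eval_eq_prod) (auto simp: keys_add_nat)
  also have "\<dots> = mon_eval v m * mon_eval v n"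
    by (simp add: lookup_add power_add prod.distrib mon_eval_eq_prod[of ?A m] mon_eval_eq_prod[of ?A n])
  finally show ?thesis .
qed

lemma mon_eval_zero [simp]: "mon_eval v 0 = 1"
  by (simp add: mon_eval_def)

lemma mon_eval_single [simp]: "mon_eval v (Poly_Mapping.single k n) = v k ^ n"
  by (simp add: mon_eval_def)

lemma poly_subst_eq_sum:
  assumes "comm_ring_hom \<phi>" "finite A" "Poly_Mapping.keys P \<subseteq> A"
  shows "poly_subst \<phi> v P = (\<Sum>m\<in>A. \<phi> (Poly_Mapping.lookup P m) * mon_eval v m)"
proof -
  interpret \<phi>: comm_ring_hom \<phi> by fact
  show ?thesis
    unfolding poly_subst_def mon_eval_def
    using assms(2,3) by (intro sum.mono_neutral_left) (auto simp: in_keys_iff)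
qed

lemma poly_subst_single:
  assumes "comm_ring_hom \<phi>"
  shows "poly_subst \<phi> v (Poly_Mapping.single m c) = \<phi> c * mon_eval v m"
  using poly_subst_eq_sum[OF assms, of "{m}" "Poly_Mapping.single m c" v] by (simp split: if_splits)

lemma comm_ring_hom_poly_subst:
  assumes "comm_ring_hom \<phi>"
  shows "comm_ring_hom (poly_subst \<phi> v)"
proof -
  interpret \<phi>: comm_ring_hom \<phi> by fact
  have add: "poly_subst \<phi> v (P + Q) = poly_subst \<phi> v P + poly_subst \<phi> v Q" for P Q
  proof -
    let ?A = "Poly_Mapping.keys P \<union> Poly_Mapping.keys Q"
    have "poly_subst \<phi> v (P + Q) = (\<Sum>m\<in>?A. \<phi> (Poly_Mapping.lookup (P + Q) m) * mon_eval v m)"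
      by (rule poly_subst_eq_sum[OF assms]) (auto simp: in_keys_iff lookup_add)
    also have "\<dots> = (\<Sum>m\<in>?A. \<phi> (Poly_Mapping.lookup P m) * mon_eval v m) +
        (\<Sum>m\<in>?A. \<phi> (Poly_Mapping.lookup Q m) * mon_eval v m)"
      by (simp add: lookup_add \<phi>.hom_add distrib_right sum.distrib)
    also have "\<dots> = poly_subst \<phi> v P + poly_subst \<phi> v Q"
      by (simp add: poly_subst_eq_sum[OF assms, of ?A])
    finally show ?thesis .
  qed
  have one: "poly_subst \<phi> v 1 = 1"
    using poly_subst_single[OF assms, of v 0 1] by simp
  show ?thesis
  proof
    fix P Q
    show "poly_subst \<phi> v (P * Q) = poly_subst \<phi> v P * poly_subst \<phi> v Q"
      by (rule poly_mapping_mult_hom[OF add])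
        (simp add: poly_subst_single[OF assms] mon_eval_add \<phi>.hom_mult mult_ac)
    show "poly_subst \<phi> v 0 = 0"
      by (simp add: poly_subst_def)
  qed (fact add one)+
qed

section \<open>Algebraic independence of the power sums\<close>

lemma mcoeff_psum_times:
  fixes F :: "(nat, 'c::comm_ring_1) mfps"
  assumes "1 \<le> k"
  shows "mcoeff (psum k * F) m =
    (\<Sum>i | i \<in> Poly_Mapping.keys m \<and> k \<le> Poly_Mapping.lookup m i. mcoeff F (m - Poly_Mapping.single i k))"
proof -
  let ?I = "{i. i \<in> Poly_Mapping.keys m \<and> k \<le> Poly_Mapping.lookup m i}"
  let ?g = "\<lambda>i. (Poly_Mapping.single i k, m - Poly_Mapping.single i k)"
  have split: "Poly_Mapping.single i k + (m - Poly_Mapping.single i k) = m" if "k \<le> Poly_Mapping.lookup m i" for i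
    using that by (intro poly_mapping_eqI) (auto simp: lookup_add lookup_minus lookup_single when_def)
  have inj: "i = j" if "Poly_Mapping.single i k = Poly_Mapping.single j k" for i j
    using that assms by (metis lookup_single_eq lookup_single_not_eq not_one_le_zero)
  have mem: "i \<in> ?I" if "Poly_Mapping.single i k + w = m" for i w
  proof -
    have "k \<le> Poly_Mapping.lookup m i"
      unfolding that[symmetric] by (simp add: lookup_add)
    then show ?thesis using assms by (auto simp: in_keys_iff)
  qed
  have "mcoeff (psum k * F) m = (\<Sum>(u, w)\<in>?g ` ?I. mcoeff (psum k) u * mcoeff F w)"
    unfolding mcoeff_times
  proof (rule sum.mono_neutral_right[OF finite_splits])
    show "?g ` ?I \<subseteq> splits m"
      using split by (auto simp: splits_def)
    show "\<forall>p\<in>splits m - ?g ` ?I. (case p of (u, w) \<Rightarrow> mcoeff (psum k) u * mcoeff F w) = 0"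
    proof
      fix p assume p: "p \<in> splits m - ?g ` ?I"
      obtain u w where uw: "p = (u, w)" by (cases p)
      have "\<nexists>i. u = Poly_Mapping.single i k"
      proof
        assume "\<exists>i. u = Poly_Mapping.single i k"
        then obtain i where i: "u = Poly_Mapping.single i k" ..
        then have *: "Poly_Mapping.single i k + w = m" using p uw by (simp add: splits_def)
        then have "w = m - Poly_Mapping.single i k" by auto
        then have "p = ?g i" using i uw by simp
        then show False using p mem[OF *] by blast
      qed
      then show "(case p of (u, w) \<Rightarrow> mcoeff (psum k) u * mcoeff F w) = 0"
        by (simp add: uw psum_def)
    qed
  qed
  also have "\<dots> = (\<Sum>i\<in>?I. mcoeff F (m - Poly_Mapping.single i k))"
  proof -
    have "mcoeff (psum k :: (nat, 'c) mfps) (Poly_Mapping.single i k) = 1" for i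
      by (auto simp: psum_def)
    then show ?thesis
      by (subst sum.reindex) (auto simp: inj_on_def intro: inj)
  qed
  finally show ?thesis .
qed

text \<open>The multiplicity of k + 1 as an exponent of m. The shift by 1 allows comparison with a
  monomial e whose variable k stands for p_(k+1).\<close>

definition type_count :: "(nat \<Rightarrow>\<^sub>0 nat) \<Rightarrow> nat \<Rightarrow> nat" where
  "type_count m k = card {i. Poly_Mapping.lookup m i = Suc k}"

lemma finite_type: "finite {i. Poly_Mapping.lookup (m :: 'v \<Rightarrow>\<^sub>0 nat) i = Suc k}"
  by (rule finite_subset[OF _ finite_keys[of m]]) (auto simp: in_keys_iff)

lemma type_count_remove:
  assumes "Poly_Mapping.lookup m i = Suc k"
  shows "type_count m j = type_count (m - Poly_Mapping.single i (Suc k)) j + (if j = k then 1 else 0)"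
proof (cases "j = k")
  case True
  have "{l. Poly_Mapping.lookup m l = Suc k} =
      insert i {l. Poly_Mapping.lookup (m - Poly_Mapping.single i (Suc k)) l = Suc k}"
    using assms by (auto simp: lookup_minus lookup_single when_def split: if_splits)
  moreover have "i \<notin> {l. Poly_Mapping.lookup (m - Poly_Mapping.single i (Suc k)) l = Suc k}"
    using assms by (simp add: lookup_minus)
  ultimately show ?thesis
    using True by (simp add: type_count_def finite_type)
next
  case False
  then have "{l. Poly_Mapping.lookup m l = Suc j} =
      {l. Poly_Mapping.lookup (m - Poly_Mapping.single i (Suc k)) l = Suc j}"
    using assms by (auto simp: lookup_minus lookup_single when_def split: if_splits)
  then show ?thesis
    using False by (simp add: type_count_def)
qed

text \<open>
  A product of \<open>d\<close> power sums has no monomial in more than \<open>d\<close> variables, and its monomials in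
  exactly \<open>d\<close> variables determine the factors.
\<close>

lemma mcoeff_psum_monomial:
  fixes e :: "nat \<Rightarrow>\<^sub>0 nat"
  shows "(mdeg e < card (Poly_Mapping.keys m) \<longrightarrow>
      mcoeff (mon_eval (\<lambda>k. psum (Suc k)) e :: (nat, rat) mfps) m = 0) \<and>
    (mdeg e = card (Poly_Mapping.keys m) \<longrightarrow>
      (if type_count m = Poly_Mapping.lookup e
       then 0 < mcoeff (mon_eval (\<lambda>k. psum (Suc k)) e :: (nat, rat) mfps) m
       else mcoeff (mon_eval (\<lambda>k. psum (Suc k)) e :: (nat, rat) mfps) m = 0))"
proof (induction "mdeg e" arbitrary: e m)
  case 0
  then have "e = 0" by (simp add: mdeg_eq_0_iff)
  then show ?case by (auto simp: type_count_def)
next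
  case (Suc d)
  let ?P = "\<lambda>e. mon_eval (\<lambda>k. psum (Suc k)) e :: (nat, rat) mfps"
  have "e \<noteq> 0" using Suc(2) by auto
  then obtain k where k: "k \<in> Poly_Mapping.keys e" by fastforce
  define e' where "e' = e - Poly_Mapping.single k 1"
  have e: "e = Poly_Mapping.single k 1 + e'"
    using k unfolding e'_def
    by (intro poly_mapping_eqI) (auto simp: lookup_add lookup_minus lookup_single when_def in_keys_iff)
  have d: "d = mdeg e'"
    using Suc(2) mdeg_add[of "Poly_Mapping.single k 1" e'] e by simp
  have P: "?P e = psum (Suc k) * ?P e'"
    using mon_eval_add[of "\<lambda>k. psum (Suc k)" "Poly_Mapping.single k 1" e'] e by simp
  let ?I = "{i. i \<in> Poly_Mapping.keys m \<and> Suc k \<le> Poly_Mapping.lookup m i}"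
  let ?m = "\<lambda>i. m - Poly_Mapping.single i (Suc k)"
  have coeff: "mcoeff (?P e) m = (\<Sum>i\<in>?I. mcoeff (?P e') (?m i))"
    unfolding P by (rule mcoeff_psum_times) simp
  have keys: "card (Poly_Mapping.keys (?m i)) + (if Poly_Mapping.lookup m i = Suc k then 1 else 0) =
      card (Poly_Mapping.keys m)" if "i \<in> ?I" for i
  proof -
    have "Poly_Mapping.keys m = insert i (Poly_Mapping.keys (?m i))"
      using that by (auto simp: in_keys_iff lookup_minus lookup_single when_def split: if_splits)
    moreover have "i \<in> Poly_Mapping.keys (?m i) \<longleftrightarrow> Poly_Mapping.lookup m i \<noteq> Suc k"
      using that by (auto simp: in_keys_iff lookup_minus)
    ultimately show ?thesis
      by (cases "Poly_Mapping.lookup m i = Suc k") (simp_all add: insert_absorb)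
  qed
  note IH = Suc(1)[OF d]
  show ?case
  proof (intro conjI impI)
    assume lt: "mdeg e < card (Poly_Mapping.keys m)"
    have "mcoeff (?P e') (?m i) = 0" if "i \<in> ?I" for i
      using IH[of "?m i"] keys[OF that] lt Suc(2) d by (auto split: if_splits)
    then show "mcoeff (?P e) m = 0"
      unfolding coeff by (intro sum.neutral) blast
  next
    assume eq: "mdeg e = card (Poly_Mapping.keys m)"
    have big: "mcoeff (?P e') (?m i) = 0" if "i \<in> ?I" "Poly_Mapping.lookup m i \<noteq> Suc k" for i
      using IH[of "?m i"] keys[OF that(1)] that(2) eq Suc(2) d by auto
    have small: "if type_count m = Poly_Mapping.lookup e then 0 < mcoeff (?P e') (?m i)
        else mcoeff (?P e') (?m i) = 0" if "i \<in> ?I" "Poly_Mapping.lookup m i = Suc k" for i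
    proof -
      have "type_count m = Poly_Mapping.lookup e \<longleftrightarrow> type_count (?m i) = Poly_Mapping.lookup e'"
        unfolding fun_eq_iff using type_count_remove[OF that(2)]
        by (auto simp: e lookup_add lookup_single when_def split: if_splits)
      moreover have "mdeg e' = card (Poly_Mapping.keys (?m i))"
        using keys[OF that(1)] that(2) eq Suc(2) d by simp
      ultimately show ?thesis
        using IH[of "?m i"] by auto
    qed
    show "if type_count m = Poly_Mapping.lookup e then 0 < mcoeff (?P e) m else mcoeff (?P e) m = 0"
    proof (cases "type_count m = Poly_Mapping.lookup e")
      case True
      have "type_count m k \<noteq> 0" using k True by (simp add: in_keys_iff)
      then have "{i. Poly_Mapping.lookup m i = Suc k} \<noteq> {}"
        unfolding type_count_def by (metis card.empty)
      then obtain i where i: "Poly_Mapping.lookup m i = Suc k" by auto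
      then have iI: "i \<in> ?I" by (simp add: in_keys_iff)
      have "0 < mcoeff (?P e') (?m i)" using small[OF iI i] True by simp
      moreover have "0 \<le> mcoeff (?P e') (?m j)" if "j \<in> ?I" for j
        using small[OF that] big[OF that] True by (cases "Poly_Mapping.lookup m j = Suc k") auto
      ultimately have "0 < (\<Sum>i\<in>?I. mcoeff (?P e') (?m i))"
        using iI by (intro sum_pos2[of _ i]) auto
      then show ?thesis using True coeff by simp
    next
      case False
      have "mcoeff (?P e') (?m j) = 0" if "j \<in> ?I" for j
        using small[OF that] big[OF that] False by (cases "Poly_Mapping.lookup m j = Suc k") auto
      then have "mcoeff (?P e) m = 0"
        unfolding coeff by (intro sum.neutral) blast
      then show ?thesis using False by simp
    qed
  qed
qed

text \<open>Each factor p_(k+1) of e receives a fresh variable with exponent k + 1.\<close>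

lemma exists_type:
  fixes e :: "nat \<Rightarrow>\<^sub>0 nat"
  shows "\<exists>m. type_count m = Poly_Mapping.lookup e \<and> card (Poly_Mapping.keys m) = mdeg e"
proof (induction "mdeg e" arbitrary: e)
  case 0
  then have "e = 0" by (simp add: mdeg_eq_0_iff)
  then show ?case by (intro exI[of _ 0]) (auto simp: type_count_def)
next
  case (Suc d)
  have "e \<noteq> 0" using Suc(2) by auto
  then obtain k where k: "k \<in> Poly_Mapping.keys e" by fastforce
  define e' where "e' = e - Poly_Mapping.single k 1"
  have e: "e = Poly_Mapping.single k 1 + e'"
    using k unfolding e'_def
    by (intro poly_mapping_eqI) (auto simp: lookup_add lookup_minus lookup_single when_def in_keys_iff)
  have d: "d = mdeg e'"
    using Suc(2) mdeg_add[of "Poly_Mapping.single k 1" e'] e by simp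
  obtain m where m: "type_count m = Poly_Mapping.lookup e'" "card (Poly_Mapping.keys m) = mdeg e'"
    using Suc(1)[OF d] by blast
  obtain i where i: "i \<notin> Poly_Mapping.keys m"
    using ex_new_if_finite[OF infinite_UNIV_nat finite_keys] by blast
  let ?m = "m + Poly_Mapping.single i (Suc k)"
  have "type_count ?m j = Poly_Mapping.lookup e j" for j
  proof -
    have "Poly_Mapping.lookup ?m i = Suc k" using i by (simp add: lookup_add in_keys_iff)
    from type_count_remove[OF this, of j] m(1) show ?thesis
      by (simp add: e lookup_add lookup_single when_def)
  qed
  moreover have "card (Poly_Mapping.keys ?m) = mdeg e"
    using i m(2) by (simp add: keys_add_nat e mdeg_add)
  ultimately show ?case by blast
qed

abbreviation psum_eval :: "((nat \<Rightarrow>\<^sub>0 nat) \<Rightarrow>\<^sub>0 rat) \<Rightarrow> (nat, rat) mfps" where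
  "psum_eval \<equiv> poly_subst mconst (\<lambda>k. psum (Suc k))"

interpretation psum_eval: comm_ring_hom psum_eval
  by (rule comm_ring_hom_poly_subst) (rule mconst_hom.comm_ring_hom_axioms)

text \<open>Among the monomials of P one with the largest number of factors is selected. A monomial
  in x that has one variable for each of its factors occurs in no other term of P. This uniqueness
  gives the description in \<open>super\<close> a meaning.\<close>

lemma psum_eval_eq_0:
  assumes "psum_eval P = 0"
  shows "P = 0"
proof (rule ccontr)
  assume "P \<noteq> 0"
  then have ne: "Poly_Mapping.keys P \<noteq> {}" by simp
  then have "Max (mdeg ` Poly_Mapping.keys P) \<in> mdeg ` Poly_Mapping.keys P"
    by (intro Max_in) auto
  then obtain e where e: "e \<in> Poly_Mapping.keys P" "mdeg e = Max (mdeg ` Poly_Mapping.keys P)"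
    by auto
  have e_max: "mdeg e' \<le> mdeg e" if "e' \<in> Poly_Mapping.keys P" for e'
    unfolding e(2) using that by (intro Max_ge) auto
  obtain m where m: "type_count m = Poly_Mapping.lookup e" "card (Poly_Mapping.keys m) = mdeg e"
    using exists_type by blast
  let ?c = "\<lambda>e. mcoeff (mon_eval (\<lambda>k. psum (Suc k)) e :: (nat, rat) mfps) m"
  have zero: "?c e' = 0" if "e' \<in> Poly_Mapping.keys P - {e}" for e'
  proof (cases "mdeg e' = mdeg e")
    case True
    have "type_count m \<noteq> Poly_Mapping.lookup e'"
      using that m(1) by (metis DiffE insertCI lookup_inject)
    then show ?thesis
      using mcoeff_psum_monomial[of e' m] True m(2) by simp
  next
    case False
    then have "mdeg e' < mdeg e" using e_max[of e'] that by simp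
    then show ?thesis
      using mcoeff_psum_monomial[of e' m] m(2) by simp
  qed
  have "0 = mcoeff (psum_eval P) m"
    using assms by simp
  also have "\<dots> = (\<Sum>e\<in>Poly_Mapping.keys P. Poly_Mapping.lookup P e * ?c e)"
    by (subst poly_subst_eq_sum[OF mconst_hom.comm_ring_hom_axioms finite_keys order.refl]) simp
  also have "\<dots> = Poly_Mapping.lookup P e * ?c e"
    using zero by (subst sum.remove[OF finite_keys e(1)]) (simp add: sum.neutral)
  finally have "Poly_Mapping.lookup P e * ?c e = 0" by simp
  moreover have "0 < ?c e"
    using mcoeff_psum_monomial[of e m] m by simp
  ultimately show False
    using e(1) by (simp add: in_keys_iff)
qed

lemma psum_eval_inject: "psum_eval P = psum_eval Q \<longleftrightarrow> P = Q"
  using psum_eval_eq_0[of "P - Q"] by (auto simp: psum_eval.hom_minus)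

abbreviation p_xa_eval :: "((nat \<Rightarrow>\<^sub>0 nat) \<Rightarrow>\<^sub>0 rat) \<Rightarrow> xa_series" where
  "p_xa_eval \<equiv> poly_subst (\<lambda>q. mconst (mconst q)) (\<lambda>k. p_xa (Suc k))"

interpretation mconst2_hom: comm_ring_hom "\<lambda>q :: rat. mconst (mconst q) :: xa_series"
  by unfold_locales (simp_all add: mconst_hom.hom_add mconst_hom.hom_mult)

interpretation p_xa_eval: comm_ring_hom p_xa_eval
  by (rule comm_ring_hom_poly_subst) (rule mconst2_hom.comm_ring_hom_axioms)

lemma super_psum_eval: "super (psum_eval P) = p_xa_eval P"
  unfolding super_def by (simp add: psum_eval_inject)


section \<open>The double complete symmetric functions\<close>

text \<open>At a monomial m of degree n + 1 the right-hand side counts the pairs of a variable and a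
  positive power of it dividing m. Each variable contributes its exponent, so there are n + 1
  pairs.\<close>

lemma newton_hsym:
  "of_nat (Suc n) * hsym (int (Suc n)) = (\<Sum>k\<le>n. psum (Suc k) * hsym (int (n - k)) :: (nat, 'c::comm_ring_1) mfps)"
proof (rule mfps_eqI)
  fix m :: "nat \<Rightarrow>\<^sub>0 nat"
  let ?K = "Poly_Mapping.keys m"
  have "mcoeff (\<Sum>k\<le>n. psum (Suc k) * hsym (int (n - k)) :: (nat, 'c) mfps) m =
      (\<Sum>k\<le>n. \<Sum>i | i \<in> ?K \<and> Suc k \<le> Poly_Mapping.lookup m i.
        if mdeg m = Suc n then 1 else 0)"
    unfolding mcoeff_sum
  proof (intro sum.cong refl)
    fix k assume k: "k \<in> {..n}"
    have "mcoeff (hsym (int (n - k)) :: (nat, 'c) mfps) (m - Poly_Mapping.single i (Suc k)) =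
        (if mdeg m = Suc n then 1 else 0)" if "Suc k \<le> Poly_Mapping.lookup m i" for i
    proof -
      have "m = (m - Poly_Mapping.single i (Suc k)) + Poly_Mapping.single i (Suc k)"
        using that by (intro poly_mapping_eqI) (auto simp: lookup_add lookup_minus lookup_single when_def)
      from arg_cong[OF this, of mdeg] have "mdeg m = mdeg (m - Poly_Mapping.single i (Suc k)) + Suc k"
        by (simp add: mdeg_add)
      then show ?thesis using k by (auto simp: mcoeff_hsym)
    qed
    then show "mcoeff (psum (Suc k) * hsym (int (n - k)) :: (nat, 'c) mfps) m =
        (\<Sum>i | i \<in> ?K \<and> Suc k \<le> Poly_Mapping.lookup m i. if mdeg m = Suc n then 1 else 0)"
      by (subst mcoeff_psum_times) (auto intro!: sum.cong)
  qed
  also have "\<dots> = (\<Sum>i\<in>?K. \<Sum>k | k \<in> {..n} \<and> Suc k \<le> Poly_Mapping.lookup m i.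
      if mdeg m = Suc n then 1 else 0)"
    by (rule sum.swap_restrict) auto
  also have "\<dots> = of_nat (Suc n) * (if mdeg m = Suc n then 1 else 0)"
  proof (cases "mdeg m = Suc n")
    case True
    have "{k. k \<in> {..n} \<and> Suc k \<le> Poly_Mapping.lookup m i} = {..<Poly_Mapping.lookup m i}" if "i \<in> ?K" for i
    proof -
      have "Poly_Mapping.lookup m i \<le> mdeg m"
        unfolding mdeg_def using that by (intro member_le_sum) auto
      then show ?thesis using True by auto
    qed
    then have "(\<Sum>i\<in>?K. \<Sum>k | k \<in> {..n} \<and> Suc k \<le> Poly_Mapping.lookup m i. 1 :: 'c) =
        (\<Sum>i\<in>?K. of_nat (Poly_Mapping.lookup m i))"
      by (intro sum.cong) simp_all
    also have "\<dots> = of_nat (mdeg m)" by (simp add: mdeg_def)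
    finally show ?thesis using True by simp
  qed simp
  also have "\<dots> = mcoeff (of_nat (Suc n) * hsym (int (Suc n))) m"
  proof -
    have "of_nat (Suc n) = (mconst (of_nat (Suc n)) :: (nat, 'c) mfps)"
      by (simp only: mconst_hom.hom_of_nat)
    then show ?thesis by (simp only: mcoeff_mconst_times) (simp add: mcoeff_hsym)
  qed
  finally show "mcoeff (of_nat (Suc n) * hsym (int (Suc n))) m =
      mcoeff (\<Sum>k\<le>n. psum (Suc k) * hsym (int (n - k)) :: (nat, 'c) mfps) m" ..
qed

text \<open>The polynomial that expresses h_n in the power sums, obtained by solving Newton's
  identity for its leading term. The division is the reason for rational coefficients.\<close>

fun hpoly :: "nat \<Rightarrow> (nat \<Rightarrow>\<^sub>0 nat) \<Rightarrow>\<^sub>0 rat" where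
  "hpoly 0 = 1"
| "hpoly (Suc n) = Poly_Mapping.single 0 (1 / of_nat (Suc n)) *
    (\<Sum>k\<le>n. Poly_Mapping.single (Poly_Mapping.single k 1) 1 * hpoly (n - k))"

declare hpoly.simps(2) [simp del]

lemma poly_subst_hpoly:
  assumes \<phi>: "comm_ring_hom \<phi>"
  shows "of_nat (Suc n) * poly_subst \<phi> v (hpoly (Suc n)) = (\<Sum>k\<le>n. v k * poly_subst \<phi> v (hpoly (n - k)))"
proof -
  interpret \<phi>: comm_ring_hom \<phi> by fact
  interpret ev: comm_ring_hom "poly_subst \<phi> v" by (rule comm_ring_hom_poly_subst[OF \<phi>])
  have "of_nat (Suc n) * \<phi> (1 / of_nat (Suc n)) = \<phi> (of_nat (Suc n) * (1 / of_nat (Suc n)))"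
    by (simp only: \<phi>.hom_mult \<phi>.hom_of_nat)
  also have "\<dots> = 1" by simp
  finally have inv: "of_nat (Suc n) * \<phi> (1 / of_nat (Suc n)) = 1" .
  have "poly_subst \<phi> v (hpoly (Suc n)) =
      \<phi> (1 / of_nat (Suc n)) * (\<Sum>k\<le>n. v k * poly_subst \<phi> v (hpoly (n - k)))"
    by (simp add: hpoly.simps(2) ev.hom_mult ev.hom_sum poly_subst_single[OF \<phi>])
  then show ?thesis
    by (simp only: mult.assoc[symmetric] inv mult_1)
qed

lemma psum_eval_hpoly: "psum_eval (hpoly n) = hsym (int n)"
proof (induction n rule: less_induct)
  case (less n)
  show ?case
  proof (cases n)
    case 0
    then show ?thesis
      using unital_hsym[where 'a = rat] by (simp add: unital_def)
  next
    case (Suc n')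
    have "of_nat n * psum_eval (hpoly n) = (\<Sum>k\<le>n'. psum (Suc k) * hsym (int (n' - k)))"
      unfolding Suc poly_subst_hpoly[OF mconst_hom.comm_ring_hom_axioms]
      using less Suc by (intro sum.cong) auto
    also have "\<dots> = of_nat n * hsym (int n)"
      unfolding Suc newton_hsym ..
    finally have eq: "of_nat n * psum_eval (hpoly n) = of_nat n * hsym (int n)" .
    have "mconst (1 / of_nat n) * of_nat n = (mconst (1 / of_nat n * of_nat n) :: (nat, rat) mfps)"
      by (simp only: mconst_hom.hom_mult mconst_hom.hom_of_nat)
    then have "mconst (1 / of_nat n) * of_nat n = (1 :: (nat, rat) mfps)"
      using Suc by simp
    then show ?thesis
      using arg_cong[OF eq, of "\<lambda>x. mconst (1 / of_nat n) * x"] by (simp add: mult.assoc[symmetric])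
  qed
qed

section \<open>The functions h_r(x/a) and the Schur functions s(x/a)\<close>

definition h_xa :: "int \<Rightarrow> xa_series" where
  "h_xa r = super (hsym r)"

lemma h_xa_neg: "r < 0 \<Longrightarrow> h_xa r = 0"
  using super_psum_eval[of 0] unital_hsym[where 'a = rat]
  by (simp add: h_xa_def unital_def psum_eval.hom_zero p_xa_eval.hom_zero)

lemma h_xa_nat: "h_xa (int n) = p_xa_eval (hpoly n)"
  unfolding h_xa_def psum_eval_hpoly[symmetric] by (rule super_psum_eval)

lemma h_xa_0: "h_xa 0 = 1"
  using h_xa_nat[of 0] by simp

lemma newton_h_xa: "of_nat (Suc n) * h_xa (int (Suc n)) = (\<Sum>k\<le>n. p_xa (Suc k) * h_xa (int (n - k)))"
  by (simp only: h_xa_nat poly_subst_hpoly[OF mconst2_hom.comm_ring_hom_axioms])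

text \<open>The determinant is formed once, over the polynomials in the power sums, where it
  represents the Schur function. Both evaluations are ring homomorphisms and carry it to the two
  sides.\<close>

lemma super_schur: "super (schur \<nu>) = Jt (\<lambda>_. h_xa) \<nu>"
proof -
  define G :: "int \<Rightarrow> int \<Rightarrow> (nat \<Rightarrow>\<^sub>0 nat) \<Rightarrow>\<^sub>0 rat" where
    "G l r = (if r < 0 then 0 else hpoly (nat r))" for l r
  have "psum_eval (G l r) = hsym r" for l r
    using psum_eval_hpoly[of "nat r"] unital_hsym[where 'a = rat]
    by (auto simp: G_def unital_def psum_eval.hom_zero)
  then have "schur \<nu> = psum_eval (Jt G \<nu>)"
    by (simp add: schur_eq_Jt psum_eval.hom_Jt)
  moreover have "p_xa_eval (G l r) = h_xa r" for l r
    using h_xa_nat[of "nat r"] h_xa_neg[of r] by (auto simp: G_def p_xa_eval.hom_zero)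
  ultimately show ?thesis
    by (simp add: super_psum_eval p_xa_eval.hom_Jt)
qed

lemma of_nat_xa_cancel:
  assumes "of_nat (Suc n) * F = (of_nat (Suc n) * G :: xa_series)"
  shows "F = G"
proof -
  let ?q = "mconst (mconst (1 / of_nat (Suc n))) :: xa_series"
  have "?q * of_nat (Suc n) = mconst (mconst (1 / of_nat (Suc n) * of_nat (Suc n)))"
    by (simp only: mconst2_hom.hom_mult mconst2_hom.hom_of_nat)
  also have "\<dots> = 1" by simp
  finally have *: "?q * of_nat (Suc n) = 1" .
  have "?q * of_nat (Suc n) * F = ?q * of_nat (Suc n) * G"
    using assms by (simp only: mult.assoc)
  then show ?thesis by (simp only: * mult_1)
qed

text \<open>A series is determined by its logarithmic derivative and its constant term, since n + 1
  can be cancelled. This replaces writing the series of the h_n as an exponential of the power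
  sums.\<close>

lemma fps_ode_unique:
  fixes F G R :: "xa_series fps"
  assumes "fps_deriv F = R * F" "fps_deriv G = R * G" "fps_nth F 0 = fps_nth G 0"
  shows "F = G"
proof (rule fps_ext)
  fix n
  show "fps_nth F n = fps_nth G n"
  proof (induction n rule: less_induct)
    case (less n)
    show ?case
    proof (cases n)
      case (Suc k)
      have "of_nat (Suc k) * fps_nth F (Suc k) = fps_nth (R * F) k"
        using assms(1) by (simp flip: assms(1))
      also have "\<dots> = fps_nth (R * G) k"
        unfolding fps_mult_nth using less Suc by (intro sum.cong) auto
      also have "\<dots> = of_nat (Suc k) * fps_nth G (Suc k)"
        by (simp flip: assms(2))
      finally show ?thesis using of_nat_xa_cancel Suc by blast
    qed (use assms(3) in simp)
  qed
qed

interpretation Qa_embed: comm_ring_hom Qa_embed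
proof -
  let ?f = "\<lambda>c :: Qa. Mfps (Poly_Mapping.lookup c)"
  have add: "?f (p + q) = ?f p + ?f q" for p q
    by (rule mfps_eqI) (simp add: lookup_add)
  have single: "?f (Poly_Mapping.single (m + n) (x * y)) = ?f (Poly_Mapping.single m x) * ?f (Poly_Mapping.single n y)"
    for m n x y
  proof (rule mfps_eqI)
    fix k
    have "mcoeff (?f (Poly_Mapping.single m x) * ?f (Poly_Mapping.single n y)) k =
        (\<Sum>p\<in>splits k. if p = (m, n) then x * y else 0)"
      unfolding mcoeff_times by (rule sum.cong) (auto simp: lookup_single when_def split: if_splits)
    also have "\<dots> = (if m + n = k then x * y else 0)"
      by (simp add: finite_splits) (simp add: splits_def)
    finally show "mcoeff (?f (Poly_Mapping.single (m + n) (x * y))) k =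
        mcoeff (?f (Poly_Mapping.single m x) * ?f (Poly_Mapping.single n y)) k"
      by (simp add: lookup_single when_def)
  qed
  have mult: "?f (p * q) = ?f p * ?f q" for p q
    by (rule poly_mapping_mult_hom[of ?f, OF add single])
  have one: "?f 1 = 1"
    by (rule mfps_eqI) (simp add: lookup_one when_def)
  have zero: "?f 0 = 0"
    by (rule mfps_eqI) simp
  show "comm_ring_hom Qa_embed"
    by unfold_locales (simp_all add: Qa_embed_def add mult one zero mconst_hom.hom_add mconst_hom.hom_mult)
qed

lemma Qa_embed_eq_0_iff: "Qa_embed c = 0 \<longleftrightarrow> c = 0"
proof
  assume "Qa_embed c = 0"
  then have "mcoeff (mcoeff (Qa_embed c) 0) m = 0" for m by simp
  then have "Poly_Mapping.lookup c m = 0" for m by (simp add: Qa_embed_def)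
  then show "c = 0" by (intro poly_mapping_eqI) simp
qed simp

lemma gamma_zero: "gamma n 0 = 0"
  using gamma_add[of n 0 0] by simp

lemma comm_ring_hom_gamma: "comm_ring_hom (gamma n)"
  by unfold_locales (simp_all add: gamma_add gamma_mult gamma_one gamma_zero)

abbreviation a_xa :: "int \<Rightarrow> xa_series" where
  "a_xa i \<equiv> Qa_embed (avar i)"

section \<open>Generating series and the shift of the a_i\<close>

definition lin_fps :: "'a::comm_ring_1 \<Rightarrow> 'a fps" where
  "lin_fps c = 1 - fps_const c * fps_X"

definition geo_fps :: "'a::comm_ring_1 \<Rightarrow> 'a fps" where
  "geo_fps c = Abs_fps (\<lambda>n. c ^ n)"

lemma geo_lin [simp]: "geo_fps c * lin_fps c = 1"
proof (rule fps_ext)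
  fix n
  have "geo_fps c * lin_fps c = geo_fps c - fps_const c * (fps_X * geo_fps c)"
    by (simp add: lin_fps_def algebra_simps)
  then show "fps_nth (geo_fps c * lin_fps c) n = fps_nth 1 n"
    by (cases n) (simp_all add: geo_fps_def)
qed

lemma lin_fps_nth_0 [simp]: "fps_nth (lin_fps c) 0 = 1"
  by (simp add: lin_fps_def)

lemma geo_fps_nth_0 [simp]: "fps_nth (geo_fps c) 0 = 1"
  by (simp add: geo_fps_def)

definition h_fps :: "int \<Rightarrow> xa_series fps" where
  "h_fps l = Abs_fps (\<lambda>n. gamma l (h_xa (int n)))"

text \<open>Newton's recursion says H' = P H, where P collects the p_(k+1)(x\<parallel>a). The shift
  gamma_a subtracts a_1^(k+1) from each of them, that is, the series A = a_1 / (1 - a_1 t) from P.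
  Multiplying H by 1 - a_1 t changes its logarithmic derivative in the same way.\<close>

lemma h_fps_1: "h_fps 1 = h_fps 0 * lin_fps (a_xa 1)"
proof (rule fps_ode_unique)
  define P where "P = Abs_fps (\<lambda>k. p_xa (Suc k))"
  define A where "A = fps_const (a_xa 1) * geo_fps (a_xa 1)"
  have deriv0: "fps_deriv (h_fps 0) = P * h_fps 0"
  proof (rule fps_ext)
    fix n
    have "fps_nth (fps_deriv (h_fps 0)) n = of_nat (Suc n) * h_xa (int (Suc n))"
      by (simp add: h_fps_def)
    also have "\<dots> = fps_nth (P * h_fps 0) n"
      unfolding newton_h_xa fps_mult_nth by (simp add: P_def h_fps_def atMost_atLeast0)
    finally show "fps_nth (fps_deriv (h_fps 0)) n = fps_nth (P * h_fps 0) n" .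
  qed
  have A: "A * lin_fps (a_xa 1) = fps_const (a_xa 1)"
    by (simp add: A_def mult.assoc)
  have "fps_deriv (h_fps 0 * lin_fps (a_xa 1)) = P * h_fps 0 * lin_fps (a_xa 1) - h_fps 0 * fps_const (a_xa 1)"
    by (simp add: deriv0 lin_fps_def algebra_simps)
  also have "h_fps 0 * fps_const (a_xa 1) = h_fps 0 * (A * lin_fps (a_xa 1))"
    by (simp only: A)
  also have "P * h_fps 0 * lin_fps (a_xa 1) - h_fps 0 * (A * lin_fps (a_xa 1)) =
      (P - A) * (h_fps 0 * lin_fps (a_xa 1))"
    by (simp add: algebra_simps)
  finally show "fps_deriv (h_fps 0 * lin_fps (a_xa 1)) = (P - A) * (h_fps 0 * lin_fps (a_xa 1))" .
  show "fps_deriv (h_fps 1) = (P - A) * h_fps 1"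
  proof (rule fps_ext)
    fix n
    interpret g: comm_ring_hom "gamma 1" by (rule comm_ring_hom_gamma)
    have p: "gamma 1 (p_xa (Suc k)) = p_xa (Suc k) - a_xa 1 ^ Suc k" for k
      using gamma_p_xa[of "Suc k"] by (simp add: Qa_embed.hom_power del: power_Suc)
    have "fps_nth (fps_deriv (h_fps 1)) n = of_nat (Suc n) * gamma 1 (h_xa (int (Suc n)))"
      by (simp add: h_fps_def)
    also have "\<dots> = gamma 1 (of_nat (Suc n) * h_xa (int (Suc n)))"
      by (simp only: g.hom_mult g.hom_of_nat)
    also have "\<dots> = (\<Sum>k\<le>n. (p_xa (Suc k) - a_xa 1 ^ Suc k) * gamma 1 (h_xa (int (n - k))))"
      unfolding newton_h_xa
      by (simp only: g.hom_sum g.hom_mult p)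
    also have "\<dots> = fps_nth ((P - A) * h_fps 1) n"
      unfolding fps_mult_nth by (simp add: P_def A_def h_fps_def geo_fps_def atMost_atLeast0)
    finally show "fps_nth (fps_deriv (h_fps 1)) n = fps_nth ((P - A) * h_fps 1) n" .
  qed
  show "fps_nth (h_fps 1) 0 = fps_nth (h_fps 0 * lin_fps (a_xa 1)) 0"
    by (simp add: h_fps_def h_xa_0 gamma_one)
qed

lemma h_fps_step: "h_fps (l + 1) = h_fps l * lin_fps (a_xa (l + 1))"
proof (rule fps_ext)
  fix n
  interpret g: comm_ring_hom "gamma l" by (rule comm_ring_hom_gamma)
  have eq: "fps_nth (F * lin_fps c) n = fps_nth F n - (if n = 0 then 0 else c * fps_nth F (n - 1))"
    for F and c :: xa_series
  proof -
    have "F * lin_fps c = F - fps_const c * (fps_X * F)"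
      by (simp add: lin_fps_def algebra_simps)
    then show ?thesis by simp
  qed
  have "fps_nth (h_fps (l + 1)) n = gamma l (fps_nth (h_fps 1) n)"
    by (simp add: h_fps_def gamma_gamma)
  also have "\<dots> = gamma l (h_xa (int n) - (if n = 0 then 0 else a_xa 1 * h_xa (int (n - 1))))"
    unfolding h_fps_1 eq by (simp add: h_fps_def)
  also have "\<dots> = fps_nth (h_fps l * lin_fps (a_xa (l + 1))) n"
    unfolding eq by (simp add: h_fps_def gamma_diff gamma_mult gamma_avar gamma_zero add.commute)
  finally show "fps_nth (h_fps (l + 1)) n = fps_nth (h_fps l * lin_fps (a_xa (l + 1))) n" .
qed

definition cf :: "'a::comm_ring_1 fps \<Rightarrow> int \<Rightarrow> 'a" where
  "cf F r = (if r < 0 then 0 else fps_nth F (nat r))"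

lemma unital_cf: "(\<And>l. fps_nth (F l) 0 = 1) \<Longrightarrow> unital (\<lambda>l. cf (F l))"
  by (simp add: unital_def cf_def)

lemma cf_h_fps: "cf (h_fps l) r = gamma l (h_xa r)"
  by (simp add: cf_def h_fps_def h_xa_neg gamma_zero)

text \<open>In entry (i, j) the power gamma_a^(-j) meets gamma_a^(r-1) with r = \<nu>_i - i + j. The
  total shift \<nu>_i - i - 1 is constant along the row and equals the content of its last box,
  which puts the double Schur function into the form \<open>Jt\<close>.\<close>

lemma schur_double_eq_Jt: "schur_double \<nu> = Jt (\<lambda>l. cf (h_fps l)) \<nu>"
  unfolding schur_double_def Jt_def jt_def
proof (intro arg_cong[of _ _ det] cong_mat refl, clarsimp)
  fix i j assume "i < length \<nu>"
  then show "gamma (- int j) (h_double (int (\<nu> ! i) - int i + int j)) =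
      cf (h_fps (int (part \<nu> i) - int i - 1)) (int (part \<nu> i) - int i + int j)"
    by (simp add: h_double_def cf_h_fps gamma_gamma part_def h_xa_def algebra_simps)
qed

lemma super_schur_eq_Jt: "super (schur \<nu>) = Jt (\<lambda>_. cf (h_fps 0)) \<nu>"
proof -
  have "cf (h_fps 0) = h_xa"
    by (rule ext) (simp add: cf_h_fps)
  then show ?thesis by (simp add: super_schur)
qed


section \<open>Transition between Schur and double Schur functions\<close>

text \<open>The product of 1 - a_i t for i from 1 to l. The recursion \<open>e_fps_step\<close> has
  to hold at all integers, which forces the inverse factors for i from l + 1 to 0 when l is
  negative.\<close>

definition e_fps :: "int \<Rightarrow> xa_series fps" where
  "e_fps l = (if 0 \<le> l then \<Prod>i\<in>{1..l}. lin_fps (a_xa i) else \<Prod>i\<in>{l + 1..0}. geo_fps (a_xa i))"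

lemma e_fps_0 [simp]: "e_fps 0 = 1"
  by (simp add: e_fps_def)

lemma e_fps_step: "e_fps (l + 1) = e_fps l * lin_fps (a_xa (l + 1))"
proof -
  consider "0 \<le> l" | "l = -1" | "l < -1" by linarith
  then show ?thesis
  proof cases
    case 1
    then have "{1..l + 1} = insert (l + 1) {1..l}" by auto
    then show ?thesis using 1 by (simp add: e_fps_def mult.commute)
  next
    case 2
    then show ?thesis by (simp add: e_fps_def)
  next
    case 3
    then have *: "{l + 1..0} = insert (l + 1) {l + 1 + 1..0}" by auto
    have "e_fps l = geo_fps (a_xa (l + 1)) * e_fps (l + 1)"
      using 3 by (simp add: e_fps_def *)
    then have "e_fps l * lin_fps (a_xa (l + 1)) = (geo_fps (a_xa (l + 1)) * lin_fps (a_xa (l + 1))) * e_fps (l + 1)"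
      by (simp only: mult_ac)
    then show ?thesis by simp
  qed
qed

lemma prod_nth_0: "fps_nth (\<Prod>i\<in>A. F i) 0 = (\<Prod>i\<in>A. fps_nth (F i) 0 :: 'a::comm_ring_1)"
  by (induction A rule: infinite_finite_induct) simp_all

lemma e_fps_nth_0 [simp]: "fps_nth (e_fps l) 0 = 1"
  by (simp add: e_fps_def prod_nth_0)

text \<open>This separates the x-variables from the shifts: every power of gamma_a becomes
  multiplication by a series free of x. After that \<open>h_fps 0\<close> can be replaced by a
  generic series.\<close>

lemma h_fps_eq: "h_fps l = h_fps 0 * e_fps l"
proof (induction l rule: int_induct[of _ 0])
  case (step1 l)
  then show ?case by (simp add: h_fps_step e_fps_step mult.assoc)
next
  case (step2 l)
  have lin_geo: "lin_fps (a_xa l) * geo_fps (a_xa l) = 1"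
    by (simp add: mult.commute)
  have "h_fps l * geo_fps (a_xa l) = h_fps (l - 1) * (lin_fps (a_xa l) * geo_fps (a_xa l))"
    using h_fps_step[of "l - 1"] by (simp add: mult.assoc)
  moreover have "e_fps l * geo_fps (a_xa l) = e_fps (l - 1) * (lin_fps (a_xa l) * geo_fps (a_xa l))"
    using e_fps_step[of "l - 1"] by (simp add: mult.assoc)
  ultimately show ?case
    using step2 by (simp add: lin_geo mult.assoc)
qed simp

text \<open>The ring \<open>xa_series\<close> also contains infinite series in the a_i, whereas
  transition coefficients have to lie in \<rat>[a]. The inverse factors are allowed because the
  coefficients of a geometric series are powers of a_i.\<close>

definition Qa_coeffs :: "xa_series fps \<Rightarrow> bool" where
  "Qa_coeffs F \<longleftrightarrow> (\<forall>n. fps_nth F n \<in> range Qa_embed)"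

lemma Qa_coeffs_mult: "Qa_coeffs F \<Longrightarrow> Qa_coeffs G \<Longrightarrow> Qa_coeffs (F * G)"
proof -
  assume F: "Qa_coeffs F" and G: "Qa_coeffs G"
  have "\<exists>f. fps_nth F n = Qa_embed f" "\<exists>g. fps_nth G n = Qa_embed g" for n
    using F G by (auto simp: Qa_coeffs_def image_iff)
  then obtain f g where "\<And>n. fps_nth F n = Qa_embed (f n)" "\<And>n. fps_nth G n = Qa_embed (g n)"
    by metis
  then have "fps_nth (F * G) n = Qa_embed (\<Sum>i=0..n. f i * g (n - i))" for n
    by (simp add: fps_mult_nth Qa_embed.hom_sum Qa_embed.hom_mult)
  then show ?thesis by (simp add: Qa_coeffs_def)
qed

lemma Qa_coeffs_1: "Qa_coeffs 1"
proof -
  have "fps_nth 1 n = Qa_embed (if n = 0 then 1 else 0)" for n by simp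
  then show ?thesis unfolding Qa_coeffs_def by blast
qed

lemma Qa_coeffs_prod: "(\<And>i. i \<in> A \<Longrightarrow> Qa_coeffs (F i)) \<Longrightarrow> Qa_coeffs (\<Prod>i\<in>A. F i)"
  by (induction A rule: infinite_finite_induct) (auto simp: Qa_coeffs_1 Qa_coeffs_mult)

lemma Qa_coeffs_lin: "Qa_coeffs (lin_fps (Qa_embed c))"
proof -
  have "fps_nth (lin_fps (Qa_embed c)) n = Qa_embed (if n = 0 then 1 else if n = 1 then - c else 0)" for n
    by (simp add: lin_fps_def Qa_embed.hom_uminus fps_X_nth)
  then show ?thesis by (simp add: Qa_coeffs_def)
qed

lemma Qa_coeffs_geo: "Qa_coeffs (geo_fps (Qa_embed c))"
proof -
  have "fps_nth (geo_fps (Qa_embed c)) n = Qa_embed (c ^ n)" for n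
    by (simp add: geo_fps_def Qa_embed.hom_power)
  then show ?thesis by (simp add: Qa_coeffs_def)
qed

lemma Qa_coeffs_e_fps: "Qa_coeffs (e_fps l)"
  by (simp add: e_fps_def Qa_coeffs_prod Qa_coeffs_lin Qa_coeffs_geo)

section \<open>Determinants of a generic series and their filtration by size\<close>

definition schur_of :: "xa_series fps \<Rightarrow> nat list \<Rightarrow> xa_series" where
  "schur_of G \<nu> = Jt (\<lambda>_. cf G) \<nu>"

definition double_schur_of :: "xa_series fps \<Rightarrow> nat list \<Rightarrow> xa_series" where
  "double_schur_of G \<nu> = Jt (\<lambda>l. cf (G * e_fps l)) \<nu>"

lemma super_schur_eq_schur_of: "super (schur \<nu>) = schur_of (h_fps 0) \<nu>"
  by (simp add: super_schur_eq_Jt schur_of_def)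

lemma schur_double_eq_double_schur_of: "schur_double \<nu> = double_schur_of (h_fps 0) \<nu>"
  unfolding schur_double_eq_Jt double_schur_of_def by (subst h_fps_eq) (rule refl)

lemma h_fps_nth_0 [simp]: "fps_nth (h_fps 0) 0 = 1"
  by (simp add: h_fps_def h_xa_0)

text \<open>The bound is an integer so that n - 1 makes sense for n = 0, where the set becomes
  empty.\<close>

definition parts_le :: "int \<Rightarrow> nat list set" where
  "parts_le n = {\<nu> \<in> partitions. int (sum_list \<nu>) \<le> n}"

lemma finite_parts_le [simp]: "finite (parts_le n)"
  by (rule finite_subset[OF _ finite_partitions_le[of "nat n"]]) (auto simp: parts_le_def)

lemma parts_le_mono: "m \<le> n \<Longrightarrow> parts_le m \<subseteq> parts_le n"
  by (auto simp: parts_le_def)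

text \<open>
  Expressions in the coefficients of a generic series with constant term \<open>1\<close>, filtered by the
  size of the partitions needed to expand them in the basis \<open>schur_of\<close>.
\<close>

definition expandable :: "int \<Rightarrow> (xa_series fps \<Rightarrow> xa_series) set" where
  "expandable n = {\<phi>. \<exists>c. \<forall>G. fps_nth G 0 = 1 \<longrightarrow> \<phi> G = (\<Sum>\<nu>\<in>parts_le n. Qa_embed (c \<nu>) * schur_of G \<nu>)}"

lemma expandableI: "(\<And>G. fps_nth G 0 = 1 \<Longrightarrow> \<phi> G = (\<Sum>\<nu>\<in>parts_le n. Qa_embed (c \<nu>) * schur_of G \<nu>)) \<Longrightarrow> \<phi> \<in> expandable n"
  unfolding expandable_def by blast

lemma expandableE:
  assumes "\<phi> \<in> expandable n"
  obtains c where "\<And>G. fps_nth G 0 = 1 \<Longrightarrow> \<phi> G = (\<Sum>\<nu>\<in>parts_le n. Qa_embed (c \<nu>) * schur_of G \<nu>)"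
  using assms unfolding expandable_def by blast

lemma expandable_mono:
  assumes "\<phi> \<in> expandable m" "m \<le> n"
  shows "\<phi> \<in> expandable n"
proof -
  obtain c where c: "\<And>G. fps_nth G 0 = 1 \<Longrightarrow> \<phi> G = (\<Sum>\<nu>\<in>parts_le m. Qa_embed (c \<nu>) * schur_of G \<nu>)"
    using expandableE[OF assms(1)] by blast
  show ?thesis
  proof (rule expandableI[where c = "\<lambda>\<nu>. if \<nu> \<in> parts_le m then c \<nu> else 0"])
    fix G :: "xa_series fps" assume "fps_nth G 0 = 1"
    then have "\<phi> G = (\<Sum>\<nu>\<in>parts_le m. Qa_embed (if \<nu> \<in> parts_le m then c \<nu> else 0) * schur_of G \<nu>)"
      by (simp add: c)
    also have "\<dots> = (\<Sum>\<nu>\<in>parts_le n. Qa_embed (if \<nu> \<in> parts_le m then c \<nu> else 0) * schur_of G \<nu>)"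
      using parts_le_mono[OF assms(2)] by (intro sum.mono_neutral_left) auto
    finally show "\<phi> G = (\<Sum>\<nu>\<in>parts_le n. Qa_embed (if \<nu> \<in> parts_le m then c \<nu> else 0) * schur_of G \<nu>)" .
  qed
qed

lemma expandable_zero: "(\<lambda>G. 0) \<in> expandable n"
  by (rule expandableI[where c = "\<lambda>_. 0"]) simp

lemma expandable_add: "\<phi> \<in> expandable n \<Longrightarrow> \<psi> \<in> expandable n \<Longrightarrow> (\<lambda>G. \<phi> G + \<psi> G) \<in> expandable n"
proof (erule expandableE, erule expandableE)
  fix c d
  assume "\<And>G. fps_nth G 0 = 1 \<Longrightarrow> \<phi> G = (\<Sum>\<nu>\<in>parts_le n. Qa_embed (c \<nu>) * schur_of G \<nu>)"
    "\<And>G. fps_nth G 0 = 1 \<Longrightarrow> \<psi> G = (\<Sum>\<nu>\<in>parts_le n. Qa_embed (d \<nu>) * schur_of G \<nu>)"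
  then show "(\<lambda>G. \<phi> G + \<psi> G) \<in> expandable n"
    by (intro expandableI[where c = "\<lambda>\<nu>. c \<nu> + d \<nu>"]) (simp add: Qa_embed.hom_add distrib_right sum.distrib)
qed

lemma expandable_scale: "\<phi> \<in> expandable n \<Longrightarrow> (\<lambda>G. Qa_embed a * \<phi> G) \<in> expandable n"
proof (erule expandableE)
  fix c
  assume "\<And>G. fps_nth G 0 = 1 \<Longrightarrow> \<phi> G = (\<Sum>\<nu>\<in>parts_le n. Qa_embed (c \<nu>) * schur_of G \<nu>)"
  then show "(\<lambda>G. Qa_embed a * \<phi> G) \<in> expandable n"
    by (intro expandableI[where c = "\<lambda>\<nu>. a * c \<nu>"]) (simp add: Qa_embed.hom_mult sum_distrib_left mult.assoc)
qed

lemma expandable_sum: "(\<And>i. i \<in> A \<Longrightarrow> \<phi> i \<in> expandable n) \<Longrightarrow> (\<lambda>G. \<Sum>i\<in>A. \<phi> i G) \<in> expandable n"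
  by (induction A rule: infinite_finite_induct) (simp_all add: expandable_zero expandable_add)

lemma expandable_one: "(\<lambda>G. 1) \<in> expandable 0"
proof (rule expandableI[where c = "\<lambda>\<nu>. 1"])
  have "\<nu> = []" if "\<nu> \<in> partitions" "sum_list \<nu> = 0" for \<nu>
    using length_le_sum_list[OF that(1)] that(2) by simp
  then have "parts_le 0 = {[]}"
    by (auto simp: parts_le_def)
  then show "1 = (\<Sum>\<nu>\<in>parts_le 0. Qa_embed 1 * schur_of G \<nu>)" for G
    by (simp add: schur_of_def Jt_def jt_def)
qed

text \<open>By the Pieri rule each \<nu> is replaced by partitions that have r more boxes; for
  negative r the factor is 0.\<close>

lemma expandable_times_cf:
  assumes "\<phi> \<in> expandable n"
  shows "(\<lambda>G. \<phi> G * cf G r) \<in> expandable (n + r)"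
proof (cases "r < 0")
  case True
  then show ?thesis using expandable_zero by (simp add: cf_def)
next
  case False
  obtain c where c: "\<And>G. fps_nth G 0 = 1 \<Longrightarrow> \<phi> G = (\<Sum>\<nu>\<in>parts_le n. Qa_embed (c \<nu>) * schur_of G \<nu>)"
    using expandableE[OF assms] by blast
  let ?R = "\<lambda>\<nu> \<kappa>. diagram \<nu> \<subseteq> diagram \<kappa> \<and> horizontal_strip (skew \<kappa> \<nu>) \<and> sum_list \<kappa> = sum_list \<nu> + nat r"
  show ?thesis
  proof (rule expandableI[where c = "\<lambda>\<kappa>. \<Sum>\<nu>\<in>{\<nu>. \<nu> \<in> parts_le n \<and> ?R \<nu> \<kappa>}. c \<nu>"])
    fix G :: "xa_series fps" assume G: "fps_nth G 0 = 1"
    have "\<phi> G * cf G r = (\<Sum>\<nu>\<in>parts_le n. Qa_embed (c \<nu>) * (cf G (int (nat r)) * schur_of G \<nu>))"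
      using False by (simp add: c[OF G] sum_distrib_left mult_ac)
    also have "\<dots> = (\<Sum>\<nu>\<in>parts_le n. \<Sum>\<kappa>\<in>{\<kappa>. \<kappa> \<in> parts_le (n + r) \<and> ?R \<nu> \<kappa>}. Qa_embed (c \<nu>) * schur_of G \<kappa>)"
    proof (rule sum.cong[OF refl])
      fix \<nu> assume \<nu>: "\<nu> \<in> parts_le n"
      have "cf G (int (nat r)) * schur_of G \<nu> = (\<Sum>\<kappa> | \<kappa> \<in> partitions \<and> ?R \<nu> \<kappa>. schur_of G \<kappa>)"
        unfolding schur_of_def using \<nu> G by (intro pieri) (simp_all add: parts_le_def cf_def)
      also have "{\<kappa>. \<kappa> \<in> partitions \<and> ?R \<nu> \<kappa>} = {\<kappa>. \<kappa> \<in> parts_le (n + r) \<and> ?R \<nu> \<kappa>}"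
        using \<nu> False by (auto simp: parts_le_def)
      finally show "Qa_embed (c \<nu>) * (cf G (int (nat r)) * schur_of G \<nu>) =
          (\<Sum>\<kappa>\<in>{\<kappa>. \<kappa> \<in> parts_le (n + r) \<and> ?R \<nu> \<kappa>}. Qa_embed (c \<nu>) * schur_of G \<kappa>)"
        by (simp add: sum_distrib_left)
    qed
    also have "\<dots> = (\<Sum>\<kappa>\<in>parts_le (n + r). \<Sum>\<nu>\<in>{\<nu>. \<nu> \<in> parts_le n \<and> ?R \<nu> \<kappa>}. Qa_embed (c \<nu>) * schur_of G \<kappa>)"
      by (rule sum.swap_restrict) simp_all
    also have "\<dots> = (\<Sum>\<kappa>\<in>parts_le (n + r).
        Qa_embed (\<Sum>\<nu>\<in>{\<nu>. \<nu> \<in> parts_le n \<and> ?R \<nu> \<kappa>}. c \<nu>) * schur_of G \<kappa>)"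
      by (simp only: Qa_embed.hom_sum sum_distrib_right)
    finally show "\<phi> G * cf G r = (\<Sum>\<kappa>\<in>parts_le (n + r).
        Qa_embed (\<Sum>\<nu>\<in>{\<nu>. \<nu> \<in> parts_le n \<and> ?R \<nu> \<kappa>}. c \<nu>) * schur_of G \<kappa>)" .
  qed
qed

text \<open>Since \<open>e_fps l\<close> has constant term 1, the difference involves only
  coefficients of G of index below r. This gains one step in the filtration.\<close>

lemma expandable_times_shifted:
  assumes "\<phi> \<in> expandable n"
  shows "(\<lambda>G. \<phi> G * (cf (G * e_fps l) r - cf G r)) \<in> expandable (n + r - 1)"
proof (cases "r < 0")
  case True
  then show ?thesis using expandable_zero by (simp add: cf_def)
next
  case False
  obtain e where e: "\<And>k. fps_nth (e_fps l) k = Qa_embed (e k)"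
    using Qa_coeffs_e_fps[of l] unfolding Qa_coeffs_def image_iff by metis
  have "(\<lambda>G. \<Sum>k\<in>{1..nat r}. Qa_embed (e k) * (\<phi> G * cf G (r - int k))) \<in> expandable (n + r - 1)"
  proof (rule expandable_sum, rule expandable_scale, rule expandable_mono, rule expandable_times_cf[OF assms])
    fix k assume "k \<in> {1..nat r}"
    then show "n + (r - int k) \<le> n + r - 1" by simp
  qed
  moreover have "\<phi> G * (cf (G * e_fps l) r - cf G r) =
      (\<Sum>k\<in>{1..nat r}. Qa_embed (e k) * (\<phi> G * cf G (r - int k)))" for G
  proof -
    have "cf (G * e_fps l) r = (\<Sum>k\<in>{0..nat r}. Qa_embed (e k) * fps_nth G (nat r - k))"
      using False by (simp add: cf_def mult.commute[of G] fps_mult_nth e)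
    also have "\<dots> = (\<Sum>k\<in>{0..nat r}. Qa_embed (e k) * cf G (r - int k))"
      using False by (intro sum.cong) (auto simp: cf_def nat_diff_distrib' intro!: arg_cong[of _ _ "fps_nth G"])
    also have "{0..nat r} = insert 0 {1..nat r}" by auto
    also have "(\<Sum>k\<in>\<dots>. Qa_embed (e k) * cf G (r - int k)) =
        Qa_embed (e 0) * cf G r + (\<Sum>k\<in>{1..nat r}. Qa_embed (e k) * cf G (r - int k))"
      by simp
    also have "Qa_embed (e 0) = 1" using e[of 0] by simp
    finally show ?thesis by (simp add: sum_distrib_left mult_ac)
  qed
  ultimately show ?thesis by simp
qed

text \<open>Factors are replaced one at a time. If P is the shifted product, Q the plain one and p,
  q are the next factors, then P p - Q q = P (p - q) + (P - Q) q. The first term is controlled by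
  the first claim for P, the second by the induction hypothesis on P - Q.\<close>

lemma expandable_prod_shifted:
  fixes k :: nat
  shows "(\<lambda>G. \<Prod>i<k. cf (G * e_fps (l i)) (r i)) \<in> expandable (\<Sum>i<k. r i) \<and>
   (\<lambda>G. (\<Prod>i<k. cf (G * e_fps (l i)) (r i)) - (\<Prod>i<k. cf G (r i))) \<in> expandable ((\<Sum>i<k. r i) - 1)"
proof (induction k)
  case 0
  then show ?case using expandable_one expandable_zero by simp
next
  case (Suc k)
  let ?P = "\<lambda>G. \<Prod>i<k. cf (G * e_fps (l i)) (r i)" and ?Q = "\<lambda>G. \<Prod>i<k. cf G (r i)"
  have 1: "(\<lambda>G. ?P G * (cf (G * e_fps (l k)) (r k) - cf G (r k))) \<in> expandable ((\<Sum>i<k. r i) + r k - 1)"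
    using Suc by (intro expandable_times_shifted) simp
  have 2: "(\<lambda>G. ?P G * cf G (r k)) \<in> expandable ((\<Sum>i<k. r i) + r k)"
    using Suc by (intro expandable_times_cf) simp
  have 3: "(\<lambda>G. (?P G - ?Q G) * cf G (r k)) \<in> expandable ((\<Sum>i<k. r i) - 1 + r k)"
    using Suc by (intro expandable_times_cf) simp
  have "(\<lambda>G. ?P G * (cf (G * e_fps (l k)) (r k) - cf G (r k)) + ?P G * cf G (r k)) \<in> expandable ((\<Sum>i<k. r i) + r k)"
    by (intro expandable_add 2 expandable_mono[OF 1]) simp
  moreover have "(\<lambda>G. ?P G * (cf (G * e_fps (l k)) (r k) - cf G (r k)) + (?P G - ?Q G) * cf G (r k)) \<in>
      expandable ((\<Sum>i<k. r i) + r k - 1)"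
    by (intro expandable_add 1 expandable_mono[OF 3]) simp
  ultimately show ?case
    by (simp add: algebra_simps)
qed

text \<open>Row shifts and permuted column shifts cancel, so every term of the determinant has total
  degree |\<nu>|.\<close>

lemma sum_permuted_degrees:
  assumes "p permutes {0..<length \<nu>}"
  shows "(\<Sum>i<length \<nu>. int (part \<nu> i) - int i + int (p i)) = int (sum_list \<nu>)"
proof -
  have "(\<Sum>i\<in>{0..<length \<nu>}. int (p i)) = (\<Sum>i\<in>{0..<length \<nu>}. int i)"
    using sum.permute[OF assms, of int] by (simp add: comp_def)
  then show ?thesis
    by (simp add: sum.distrib sum_subtractf sum_list_part[OF order.refl] atLeast0LessThan)
qed

text \<open>Both determinants are expanded over permutations. Every term has degree |\<nu>| and
  differs from its unshifted counterpart by lower terms only, so the transition is unitriangular for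
  the filtration by size. The coefficients c are chosen before G.\<close>

lemma double_schur_of_expand:
  "\<exists>c. \<forall>G. fps_nth G 0 = 1 \<longrightarrow>
    double_schur_of G \<nu> = schur_of G \<nu> + (\<Sum>\<kappa>\<in>parts_le (int (sum_list \<nu>) - 1). Qa_embed (c \<kappa>) * schur_of G \<kappa>)"
proof -
  let ?n = "length \<nu>"
  let ?l = "\<lambda>i. int (part \<nu> i) - int i - 1"
  let ?r = "\<lambda>p i. int (part \<nu> i) - int i + int (p i)"
  let ?T = "{p. p permutes {0..<?n}}"
  have perm: "p i < ?n" if "p \<in> ?T" "i < ?n" for p i
    using permutes_in_image[of p "{0..<?n}" i] that by simp
  have double_schur_of: "double_schur_of G \<nu> = (\<Sum>p\<in>?T. signof p * (\<Prod>i<?n. cf (G * e_fps (?l i)) (?r p i)))" for G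
    unfolding double_schur_of_def Jt_def jt_def
    by (subst det_def'[of _ ?n]) (auto simp: perm atLeast0LessThan intro!: sum.cong prod.cong)
  have schur_of: "schur_of G \<nu> = (\<Sum>p\<in>?T. signof p * (\<Prod>i<?n. cf G (?r p i)))" for G
    unfolding schur_of_def Jt_def jt_def
    by (subst det_def'[of _ ?n]) (auto simp: perm atLeast0LessThan intro!: sum.cong prod.cong)
  have "(\<lambda>G. \<Sum>p\<in>?T. Qa_embed (signof p) * ((\<Prod>i<?n. cf (G * e_fps (?l i)) (?r p i)) - (\<Prod>i<?n. cf G (?r p i))))
      \<in> expandable (int (sum_list \<nu>) - 1)"
  proof (rule expandable_sum, rule expandable_scale)
    fix p assume "p \<in> ?T"
    then have "(\<Sum>i<?n. ?r p i) = int (sum_list \<nu>)"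
      using sum_permuted_degrees by blast
    then show "(\<lambda>G. (\<Prod>i<?n. cf (G * e_fps (?l i)) (?r p i)) - (\<Prod>i<?n. cf G (?r p i))) \<in> expandable (int (sum_list \<nu>) - 1)"
      using expandable_prod_shifted[where k = ?n and l = ?l and r = "?r p"] by simp
  qed
  moreover have "Qa_embed (signof p) = signof p" for p :: "nat \<Rightarrow> nat"
    by (simp add: sign_def Qa_embed.hom_uminus)
  ultimately have "(\<lambda>G. double_schur_of G \<nu> - schur_of G \<nu>) \<in> expandable (int (sum_list \<nu>) - 1)"
    by (simp add: double_schur_of schur_of sum_subtractf right_diff_distrib)
  then obtain c where c: "\<And>G. fps_nth G 0 = 1 \<Longrightarrow> double_schur_of G \<nu> - schur_of G \<nu> = (\<Sum>\<kappa>\<in>parts_le (int (sum_list \<nu>) - 1). Qa_embed (c \<kappa>) * schur_of G \<kappa>)"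
    by (rule expandableE) blast
  then show ?thesis
    by (intro exI[of _ c]) (simp add: diff_eq_eq add.commute)
qed

text \<open>The unitriangular relation is inverted by induction on the size; the coefficients remain
  independent of G.\<close>

lemma schur_of_expand:
  assumes "\<nu> \<in> partitions"
  shows "\<exists>d. \<forall>G. fps_nth G 0 = 1 \<longrightarrow> schur_of G \<nu> = (\<Sum>\<mu>\<in>parts_le (int (sum_list \<nu>)). Qa_embed (d \<mu>) * double_schur_of G \<mu>)"
  using assms
proof (induction "sum_list \<nu>" arbitrary: \<nu> rule: less_induct)
  case less
  let ?n = "int (sum_list \<nu>)"
  obtain c where c: "\<And>G. fps_nth G 0 = 1 \<Longrightarrow> double_schur_of G \<nu> = schur_of G \<nu> + (\<Sum>\<kappa>\<in>parts_le (?n - 1). Qa_embed (c \<kappa>) * schur_of G \<kappa>)"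
    using double_schur_of_expand by blast
  have "\<forall>\<kappa>\<in>parts_le (?n - 1). \<exists>d. \<forall>G. fps_nth G 0 = 1 \<longrightarrow>
      schur_of G \<kappa> = (\<Sum>\<mu>\<in>parts_le (int (sum_list \<kappa>)). Qa_embed (d \<mu>) * double_schur_of G \<mu>)"
  proof
    fix \<kappa> assume "\<kappa> \<in> parts_le (?n - 1)"
    then have "sum_list \<kappa> < sum_list \<nu>" "\<kappa> \<in> partitions"
      by (simp_all add: parts_le_def)
    then show "\<exists>d. \<forall>G. fps_nth G 0 = 1 \<longrightarrow>
        schur_of G \<kappa> = (\<Sum>\<mu>\<in>parts_le (int (sum_list \<kappa>)). Qa_embed (d \<mu>) * double_schur_of G \<mu>)"
      by (rule less.hyps)
  qed
  from bchoice[OF this] obtain d where "\<forall>\<kappa>\<in>parts_le (?n - 1). \<forall>G. fps_nth G 0 = 1 \<longrightarrow>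
      schur_of G \<kappa> = (\<Sum>\<mu>\<in>parts_le (int (sum_list \<kappa>)). Qa_embed (d \<kappa> \<mu>) * double_schur_of G \<mu>)" ..
  then have d: "schur_of G \<kappa> = (\<Sum>\<mu>\<in>parts_le (int (sum_list \<kappa>)). Qa_embed (d \<kappa> \<mu>) * double_schur_of G \<mu>)"
    if "\<kappa> \<in> parts_le (?n - 1)" "fps_nth G 0 = 1" for \<kappa> G
    using that by simp
  define d' where "d' \<kappa> \<mu> = (if \<mu> \<in> parts_le (int (sum_list \<kappa>)) then d \<kappa> \<mu> else 0)" for \<kappa> \<mu>
  have d': "schur_of G \<kappa> = (\<Sum>\<mu>\<in>parts_le ?n. Qa_embed (d' \<kappa> \<mu>) * double_schur_of G \<mu>)"
    if "\<kappa> \<in> parts_le (?n - 1)" "fps_nth G 0 = 1" for \<kappa> G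
  proof -
    have "parts_le (int (sum_list \<kappa>)) \<subseteq> parts_le ?n"
      using that(1) by (intro parts_le_mono) (simp add: parts_le_def)
    then show ?thesis
      unfolding d[OF that] by (intro sum.mono_neutral_cong_left) (auto simp: d'_def)
  qed
  have mem: "\<nu> \<in> parts_le ?n"
    using less.prems by (simp add: parts_le_def)
  define e where "e \<mu> = (if \<mu> = \<nu> then 1 else 0) - (\<Sum>\<kappa>\<in>parts_le (?n - 1). c \<kappa> * d' \<kappa> \<mu>)" for \<mu>
  have "schur_of G \<nu> = (\<Sum>\<mu>\<in>parts_le ?n. Qa_embed (e \<mu>) * double_schur_of G \<mu>)" if G: "fps_nth G 0 = 1" for G
  proof -
    have "(\<Sum>\<kappa>\<in>parts_le (?n - 1). Qa_embed (c \<kappa>) * schur_of G \<kappa>) =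
        (\<Sum>\<kappa>\<in>parts_le (?n - 1). \<Sum>\<mu>\<in>parts_le ?n. Qa_embed (c \<kappa> * d' \<kappa> \<mu>) * double_schur_of G \<mu>)"
      by (rule sum.cong) (simp_all add: d'[OF _ G] Qa_embed.hom_mult sum_distrib_left mult.assoc)
    also have "\<dots> = (\<Sum>\<mu>\<in>parts_le ?n. Qa_embed (\<Sum>\<kappa>\<in>parts_le (?n - 1). c \<kappa> * d' \<kappa> \<mu>) * double_schur_of G \<mu>)"
      by (subst sum.swap) (simp add: Qa_embed.hom_sum sum_distrib_right)
    finally have *: "(\<Sum>\<kappa>\<in>parts_le (?n - 1). Qa_embed (c \<kappa>) * schur_of G \<kappa>) = \<dots>" .
    have "double_schur_of G \<nu> = (\<Sum>\<mu>\<in>parts_le ?n. if \<mu> = \<nu> then double_schur_of G \<mu> else 0)"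
      using mem by simp
    also have "\<dots> = (\<Sum>\<mu>\<in>parts_le ?n. Qa_embed (if \<mu> = \<nu> then 1 else 0) * double_schur_of G \<mu>)"
      by (intro sum.cong) auto
    finally have **: "double_schur_of G \<nu> = \<dots>" .
    have "schur_of G \<nu> = double_schur_of G \<nu> - (\<Sum>\<kappa>\<in>parts_le (?n - 1). Qa_embed (c \<kappa>) * schur_of G \<kappa>)"
      using c[OF G] by simp
    then show ?thesis
      unfolding * ** e_def by (simp only: Qa_embed.hom_minus left_diff_distrib sum_subtractf)
  qed
  then show ?case by (intro exI[of _ e] allI impI)
qed


section \<open>Linear independence and dual Schur functions\<close>

text \<open>Kostka numbers are unitriangular for dominance. The statistic w, the sum of all partial
  sums, is monotone for dominance. If \<nu> has maximal w among the partitions with nonzero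
  coefficient and m has the exponents \<nu>, any other contributing \<kappa> dominates \<nu>;
  maximality then forces equal partial sums and hence \<kappa> = \<nu>.\<close>

lemma kostka_independent:
  fixes c :: "nat list \<Rightarrow> 'b::comm_ring_1"
  assumes zero: "\<And>m. mdeg m = n \<Longrightarrow> (\<Sum>\<nu> | \<nu> \<in> partitions \<and> sum_list \<nu> = n. of_int (kostka \<nu> m) * c \<nu>) = 0"
    and \<nu>0: "\<nu>0 \<in> partitions" "sum_list \<nu>0 = n"
  shows "c \<nu>0 = 0"
proof (rule ccontr)
  assume c0: "c \<nu>0 \<noteq> 0"
  define w where "w \<nu> = (\<Sum>k\<in>{..n}. \<Sum>i<k. part \<nu> i)" for \<nu>
  let ?P = "{\<nu> \<in> partitions. sum_list \<nu> = n}"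
  let ?B = "{\<nu> \<in> ?P. c \<nu> \<noteq> 0}"
  have fin: "finite ?B"
    by (rule finite_subset[OF _ finite_partitions_eq[of n]]) auto
  have "?B \<noteq> {}" using \<nu>0 c0 by blast
  then have "Max (w ` ?B) \<in> w ` ?B"
    using fin by (intro Max_in) auto
  then obtain \<nu> where \<nu>B: "\<nu> \<in> ?B" and w_max: "w \<nu> = Max (w ` ?B)"
    by auto
  then have \<nu>: "\<nu> \<in> partitions" "sum_list \<nu> = n" "c \<nu> \<noteq> 0" by auto
  define m where "m = Abs_poly_mapping (part \<nu>)"
  have "finite {i. part \<nu> i \<noteq> 0}"
    by (rule finite_subset[of _ "{..<length \<nu>}"]) (auto simp: part_def)
  then have m: "Poly_Mapping.lookup m i = part \<nu> i" for i
    by (simp add: m_def)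
  have keys: "Poly_Mapping.keys m \<subseteq> {..<length \<nu>}"
    by (auto simp: in_keys_iff m part_def split: if_splits)
  have "mdeg m = n"
    using mdeg_eq_sum[OF _ keys] \<nu>(2) by (simp add: m sum_list_part[OF order.refl])
  have one: "kostka \<nu> m = 1"
    by (rule kostka_diagonal[OF \<nu>(1) order.refl m])
  have other: "of_int (kostka \<kappa> m) * c \<kappa> = 0" if \<kappa>: "\<kappa> \<in> ?P - {\<nu>}" for \<kappa>
  proof (rule ccontr)
    assume nz: "of_int (kostka \<kappa> m) * c \<kappa> \<noteq> 0"
    have \<kappa>P: "\<kappa> \<in> partitions" "sum_list \<kappa> = n" "\<kappa> \<noteq> \<nu>" using \<kappa> by auto
    have knz: "kostka \<kappa> m \<noteq> 0" and cnz: "c \<kappa> \<noteq> 0" using nz by auto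
    have dom: "(\<Sum>i<k. part \<nu> i) \<le> (\<Sum>i<k. part \<kappa> i)" for k
      using kostka_nonzero[OF \<kappa>P(1) keys knz] by (simp add: m)
    have "\<kappa> \<in> ?B" using \<kappa>P cnz by simp
    then have "w \<kappa> \<le> w \<nu>" unfolding w_max using fin by (intro Max_ge) auto
    moreover have "w \<nu> \<le> w \<kappa>" unfolding w_def by (intro sum_mono dom)
    ultimately have eq: "(\<Sum>k\<in>{..n}. \<Sum>i<k. part \<nu> i) = (\<Sum>k\<in>{..n}. \<Sum>i<k. part \<kappa> i)"
      by (simp add: w_def)
    have partial: "(\<Sum>i<k. part \<nu> i) = (\<Sum>i<k. part \<kappa> i)" if "k \<le> n" for k
      using sum_mono_inv[OF eq dom, of k] that by simp
    have "part \<nu> i = part \<kappa> i" for i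
    proof (cases "i < n")
      case True
      then show ?thesis using partial[of i] partial[of "Suc i"] by simp
    next
      case False
      then show ?thesis
        using length_le_sum_list[OF \<nu>(1)] length_le_sum_list[OF \<kappa>P(1)] \<nu>(2) \<kappa>P(2) by (simp add: part_def)
    qed
    then show False using partition_eqI[OF \<nu>(1) \<kappa>P(1)] \<kappa>P(3) by blast
  qed
  have "0 = (\<Sum>\<kappa>\<in>?P. of_int (kostka \<kappa> m) * c \<kappa>)"
    using zero[OF \<open>mdeg m = n\<close>] by simp
  also have "\<dots> = of_int (kostka \<nu> m) * c \<nu> + (\<Sum>\<kappa>\<in>?P - {\<nu>}. of_int (kostka \<kappa> m) * c \<kappa>)"
    using \<nu> by (intro sum.remove finite_partitions_eq) simp
  also have "(\<Sum>\<kappa>\<in>?P - {\<nu>}. of_int (kostka \<kappa> m) * c \<kappa>) = 0"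
    using other by (intro sum.neutral ballI)
  finally show False using \<nu>(3) one by simp
qed

lemma kostka_degree:
  assumes "\<nu> \<in> partitions" "kostka \<nu> m \<noteq> 0"
  shows "sum_list \<nu> = mdeg m"
proof -
  obtain n where "Poly_Mapping.keys m \<subseteq> {..<n}"
    using finite_nat_bounded[OF finite_keys] by blast
  then show ?thesis using kostka_nonzero[OF assms(1) _ assms(2)] by blast
qed

text \<open>F has degree at most n in x and agrees with F' in degree n, while lower degrees are
  unconstrained. In this form the relation is compatible with sums and products, and hence with
  determinants.\<close>

definition top_part :: "int \<Rightarrow> (nat, 'c::comm_ring_1) mfps \<Rightarrow> (nat, 'c) mfps \<Rightarrow> bool" where
  "top_part n F F' \<longleftrightarrow> (\<forall>m. (n \<le> int (mdeg m) \<longrightarrow> mcoeff F m = mcoeff F' m) \<and>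
    (n < int (mdeg m) \<longrightarrow> mcoeff F' m = 0))"

lemma top_part_mult:
  assumes "top_part n F F'" "top_part k G G'"
  shows "top_part (n + k) (F * G) (F' * G')"
proof -
  have *: "(n + k \<le> int (mdeg m) \<longrightarrow> mcoeff F u * mcoeff G w = mcoeff F' u * mcoeff G' w) \<and>
      (n + k < int (mdeg m) \<longrightarrow> mcoeff F' u * mcoeff G' w = 0)" if "(u, w) \<in> splits m" for u w m
  proof -
    have deg: "int (mdeg m) = int (mdeg u) + int (mdeg w)"
      using that by (auto simp: splits_def mdeg_add)
    have F: "(n \<le> int (mdeg u) \<longrightarrow> mcoeff F u = mcoeff F' u) \<and> (n < int (mdeg u) \<longrightarrow> mcoeff F' u = 0)"
      and G: "(k \<le> int (mdeg w) \<longrightarrow> mcoeff G w = mcoeff G' w) \<and> (k < int (mdeg w) \<longrightarrow> mcoeff G' w = 0)"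
      using assms unfolding top_part_def by blast+
    consider "n + k > int (mdeg m)" | "n < int (mdeg u)" | "k < int (mdeg w)"
      | "n = int (mdeg u)" "k = int (mdeg w)"
      using deg by linarith
    then show ?thesis
      by cases (use F G deg in auto)
  qed
  show ?thesis
    unfolding top_part_def mcoeff_times
    by (intro allI conjI impI sum.cong sum.neutral) (use * in auto)
qed

lemma top_part_one: "top_part 0 1 1"
  by (auto simp: top_part_def)

lemma top_part_add: "top_part n F F' \<Longrightarrow> top_part n G G' \<Longrightarrow> top_part n (F + G) (F' + G')"
  by (simp add: top_part_def)

lemma top_part_zero: "top_part n 0 0"
  by (simp add: top_part_def)

lemma top_part_uminus: "top_part n F F' \<Longrightarrow> top_part n (- F) (- F')"
  by (simp add: top_part_def)

lemma top_part_prod: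
  "(\<And>i. i \<in> A \<Longrightarrow> top_part (r i) (F i) (F' i)) \<Longrightarrow> top_part (\<Sum>i\<in>A. r i) (\<Prod>i\<in>A. F i) (\<Prod>i\<in>A. F' i)"
  by (induction A rule: infinite_finite_induct) (auto simp: top_part_one top_part_mult)

lemma top_part_sum:
  "(\<And>i. i \<in> A \<Longrightarrow> top_part n (F i) (F' i)) \<Longrightarrow> top_part n (\<Sum>i\<in>A. F i) (\<Sum>i\<in>A. F' i)"
  by (induction A rule: infinite_finite_induct) (auto simp: top_part_zero top_part_add)

lemma mcoeff_of_nat_times: "mcoeff (of_nat k * F) m = of_nat k * mcoeff F m"
proof -
  have "of_nat k * F = mconst (of_nat k) * F" by (simp only: mconst_hom.hom_of_nat)
  then show ?thesis by simp
qed

lemma of_nat_a_cancel: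
  assumes "of_nat (Suc n) * x = (of_nat (Suc n) * y :: (int, rat) mfps)"
  shows "x = y"
proof -
  have "of_nat (Suc n) * (mconst x :: xa_series) = of_nat (Suc n) * mconst y"
    using arg_cong[OF assms, of "mconst :: _ \<Rightarrow> xa_series"]
    by (simp only: mconst_hom.hom_mult mconst_hom.hom_of_nat)
  then have "(mconst x :: xa_series) = mconst y" by (rule of_nat_xa_cancel)
  from arg_cong[OF this, of "\<lambda>F. mcoeff F 0"] show ?thesis by simp
qed

text \<open>The functions p_k(x\<parallel>a) and p_k(x) differ by a term free of x. In Newton's
  recursion this term multiplies some h of smaller index, which by induction has no coefficients in
  the degrees considered.\<close>

lemma top_part_h_xa: "top_part r (h_xa r) (hsym r)"
proof (cases "r < 0")
  case True
  then show ?thesis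
    using unital_hsym[where 'a = "(int, rat) mfps"] by (simp add: h_xa_neg unital_def top_part_zero)
next
  case False
  have "int n \<le> int (mdeg m) \<Longrightarrow> mcoeff (h_xa (int n)) m = mcoeff (hsym (int n)) m" for n m
  proof (induction n arbitrary: m rule: less_induct)
    case (less n)
    show ?case
    proof (cases n)
      case 0
      then show ?thesis
        using unital_hsym[where 'a = "(int, rat) mfps"] by (simp add: h_xa_0 unital_def)
    next
      case (Suc k)
      have "of_nat (Suc k) * mcoeff (h_xa (int n)) m = mcoeff (\<Sum>j\<le>k. p_xa (Suc j) * h_xa (int (k - j))) m"
        unfolding Suc newton_h_xa[symmetric] by (rule mcoeff_of_nat_times[symmetric])
      also have "\<dots> = mcoeff (\<Sum>j\<le>k. psum (Suc j) * hsym (int (k - j))) m"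
        unfolding mcoeff_sum
      proof (rule sum.cong[OF refl])
        fix j assume j: "j \<in> {..k}"
        have IH: "mcoeff (h_xa (int (k - j))) u = mcoeff (hsym (int (k - j))) u" if "k - j \<le> mdeg u" for u
          using less.IH[of "k - j" u] Suc that by simp
        have "mcoeff (h_xa (int (k - j))) m = 0"
          using IH[of m] less.prems Suc by (simp add: mcoeff_hsym)
        then have "mcoeff (p_xa (Suc j) * h_xa (int (k - j))) m = mcoeff (psum (Suc j) * h_xa (int (k - j))) m"
          by (simp add: p_xa_def left_diff_distrib)
        also have "\<dots> = mcoeff (psum (Suc j) * hsym (int (k - j))) m"
        proof -
          have "k - j \<le> mdeg (m - Poly_Mapping.single i (Suc j))" if i: "Suc j \<le> Poly_Mapping.lookup m i" for i
          proof -
            have "m = (m - Poly_Mapping.single i (Suc j)) + Poly_Mapping.single i (Suc j)"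
              using i by (intro poly_mapping_eqI) (auto simp: lookup_add lookup_minus lookup_single when_def)
            from arg_cong[OF this, of mdeg] have "mdeg m = mdeg (m - Poly_Mapping.single i (Suc j)) + Suc j"
              by (simp add: mdeg_add)
            then show ?thesis
              using less.prems Suc by simp
          qed
          then show ?thesis
            by (subst (1 2) mcoeff_psum_times) (auto intro!: sum.cong IH)
        qed
        finally show "mcoeff (p_xa (Suc j) * h_xa (int (k - j))) m = mcoeff (psum (Suc j) * hsym (int (k - j))) m" .
      qed
      also have "\<dots> = of_nat (Suc k) * mcoeff (hsym (int n)) m"
        unfolding Suc newton_hsym[symmetric] by (rule mcoeff_of_nat_times)
      finally show ?thesis by (rule of_nat_a_cancel)
    qed
  qed
  from this[of "nat r"] False show ?thesis
    by (simp add: top_part_def mcoeff_hsym)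
qed

lemma top_part_schur_of: "top_part (int (sum_list \<nu>)) (schur_of (h_fps 0) \<nu>) (schur \<nu>)"
proof -
  let ?n = "length \<nu>"
  let ?r = "\<lambda>p i. int (part \<nu> i) - int i + int (p i)"
  let ?T = "{p. p permutes {0..<?n}}"
  have perm: "p i < ?n" if "p \<in> ?T" "i < ?n" for p i
    using permutes_in_image[of p "{0..<?n}" i] that by simp
  have Jt: "Jt (\<lambda>_. H) \<nu> = (\<Sum>p\<in>?T. signof p * (\<Prod>i<?n. H (?r p i)))" for H :: "int \<Rightarrow> xa_series"
    unfolding Jt_def jt_def
    by (subst det_def'[of _ ?n]) (auto simp: perm atLeast0LessThan intro!: sum.cong prod.cong)
  have "schur_of (h_fps 0) \<nu> = Jt (\<lambda>_. h_xa) \<nu>"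
    by (simp add: super_schur flip: super_schur_eq_schur_of)
  moreover have "top_part (int (sum_list \<nu>)) (\<Sum>p\<in>?T. signof p * (\<Prod>i<?n. h_xa (?r p i)))
      (\<Sum>p\<in>?T. signof p * (\<Prod>i<?n. hsym (?r p i)))"
  proof (rule top_part_sum)
    fix p assume "p \<in> ?T"
    then have "(\<Sum>i<?n. ?r p i) = int (sum_list \<nu>)"
      using sum_permuted_degrees by blast
    then have "top_part (int (sum_list \<nu>)) (\<Prod>i<?n. h_xa (?r p i)) (\<Prod>i<?n. hsym (?r p i))"
      using top_part_prod[of "{..<?n}" "?r p" "\<lambda>i. h_xa (?r p i)" "\<lambda>i. hsym (?r p i)"] top_part_h_xa by simp
    from this top_part_uminus[OF this] show "top_part (int (sum_list \<nu>)) (signof p * (\<Prod>i<?n. h_xa (?r p i))) (signof p * (\<Prod>i<?n. hsym (?r p i)))"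
      by (simp add: sign_def)
  qed
  ultimately show ?thesis
    by (simp add: schur_eq_Jt Jt)
qed

lemma mcoeff_Qa_embed_times: "mcoeff (Qa_embed c * F) m = Mfps (Poly_Mapping.lookup c) * mcoeff F m"
  by (simp add: Qa_embed_def)

text \<open>Let N be the largest size of a partition with nonzero coefficient. In degree N in x only
  the partitions of size N are visible, and their determinants agree there with ordinary Schur
  functions. The coefficients are constants in x, so the independence of the Kostka numbers applies
  over \<rat>[[a]].\<close>

lemma schur_of_independent:
  assumes zero: "(\<Sum>\<nu>\<in>parts_le n. Qa_embed (c \<nu>) * schur_of (h_fps 0) \<nu>) = 0" and \<nu>0: "\<nu>0 \<in> parts_le n"
  shows "c \<nu>0 = 0"
proof (rule ccontr)
  assume c0: "c \<nu>0 \<noteq> 0"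
  let ?B = "{\<nu> \<in> parts_le n. c \<nu> \<noteq> 0}"
  define N where "N = Max (sum_list ` ?B)"
  have "N \<in> sum_list ` ?B"
    unfolding N_def using \<nu>0 c0 by (intro Max_in) auto
  then obtain \<nu> where \<nu>: "\<nu> \<in> parts_le n" "c \<nu> \<noteq> 0" "sum_list \<nu> = N" by auto
  have big: "c \<kappa> = 0" if "\<kappa> \<in> parts_le n" "N < sum_list \<kappa>" for \<kappa>
  proof (rule ccontr)
    assume "c \<kappa> \<noteq> 0"
    then have "sum_list \<kappa> \<le> N" unfolding N_def using that(1) by (intro Max_ge) auto
    then show False using that(2) by simp
  qed
  have sub: "{\<nu> \<in> partitions. sum_list \<nu> = N} \<subseteq> parts_le n"
    using \<nu> by (auto simp: parts_le_def)
  have "Mfps (Poly_Mapping.lookup (c \<nu>)) = 0"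
  proof (rule kostka_independent[where n = N and c = "\<lambda>\<nu>. Mfps (Poly_Mapping.lookup (c \<nu>))"])
    fix m :: "nat \<Rightarrow>\<^sub>0 nat" assume m: "mdeg m = N"
    have "(\<Sum>\<nu> | \<nu> \<in> partitions \<and> sum_list \<nu> = N. of_int (kostka \<nu> m) * Mfps (Poly_Mapping.lookup (c \<nu>))) =
        (\<Sum>\<nu>\<in>parts_le n. Mfps (Poly_Mapping.lookup (c \<nu>)) * mcoeff (schur_of (h_fps 0) \<nu>) m)"
    proof (rule sum.mono_neutral_cong_left)
      show "\<forall>\<kappa>\<in>parts_le n - {\<nu> \<in> partitions. sum_list \<nu> = N}.
          Mfps (Poly_Mapping.lookup (c \<kappa>)) * mcoeff (schur_of (h_fps 0) \<kappa>) m = 0"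
      proof
        fix \<kappa> assume \<kappa>: "\<kappa> \<in> parts_le n - {\<nu> \<in> partitions. sum_list \<nu> = N}"
        then have "sum_list \<kappa> \<noteq> N" by (simp add: parts_le_def)
        then consider "N < sum_list \<kappa>" | "sum_list \<kappa> < N" by linarith
        then show "Mfps (Poly_Mapping.lookup (c \<kappa>)) * mcoeff (schur_of (h_fps 0) \<kappa>) m = 0"
        proof cases
          case 1
          then have "c \<kappa> = 0" using big \<kappa> by blast
          then have "Mfps (Poly_Mapping.lookup (c \<kappa>)) = 0" by (intro mfps_eqI) simp
          then show ?thesis by simp
        next
          case 2
          then show ?thesis using top_part_schur_of[of \<kappa>] m by (simp add: top_part_def)
        qed
      qed
      fix \<kappa> assume "\<kappa> \<in> {\<nu> \<in> partitions. sum_list \<nu> = N}"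
      then show "of_int (kostka \<kappa> m) * Mfps (Poly_Mapping.lookup (c \<kappa>)) =
          Mfps (Poly_Mapping.lookup (c \<kappa>)) * mcoeff (schur_of (h_fps 0) \<kappa>) m"
        using top_part_schur_of[of \<kappa>] m by (simp add: top_part_def mcoeff_schur mult.commute)
    qed (use sub in auto)
    also have "\<dots> = mcoeff (\<Sum>\<nu>\<in>parts_le n. Qa_embed (c \<nu>) * schur_of (h_fps 0) \<nu>) m"
      by (simp add: mcoeff_Qa_embed_times)
    finally show "(\<Sum>\<nu> | \<nu> \<in> partitions \<and> sum_list \<nu> = N.
        of_int (kostka \<nu> m) * Mfps (Poly_Mapping.lookup (c \<nu>))) = 0"
      using zero by simp
  qed (use \<nu> in \<open>auto simp: parts_le_def\<close>)
  then have "Qa_embed (c \<nu>) = 0" by (simp add: Qa_embed_def mconst_hom.hom_zero)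
  then show False using \<nu>(2) by (simp add: Qa_embed_eq_0_iff)
qed

section \<open>The transition matrices, chosen once for all G\<close>

definition lower_coeff :: "nat list \<Rightarrow> nat list \<Rightarrow> Qa" where
  "lower_coeff = (SOME lower_coeff. (\<forall>\<nu>. \<forall>G. fps_nth G 0 = 1 \<longrightarrow>
      double_schur_of G \<nu> = schur_of G \<nu> + (\<Sum>\<kappa>\<in>parts_le (int (sum_list \<nu>) - 1). Qa_embed (lower_coeff \<nu> \<kappa>) * schur_of G \<kappa>)))"

lemma double_schur_of_lower:
  assumes "fps_nth G 0 = 1"
  shows "double_schur_of G \<nu> = schur_of G \<nu> + (\<Sum>\<kappa>\<in>parts_le (int (sum_list \<nu>) - 1). Qa_embed (lower_coeff \<nu> \<kappa>) * schur_of G \<kappa>)"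
proof -
  have "\<exists>lower_coeff. \<forall>\<nu>. \<forall>G. fps_nth G 0 = 1 \<longrightarrow>
      double_schur_of G \<nu> = schur_of G \<nu> + (\<Sum>\<kappa>\<in>parts_le (int (sum_list \<nu>) - 1). Qa_embed (lower_coeff \<nu> \<kappa>) * schur_of G \<kappa>)"
    by (rule choice) (intro allI double_schur_of_expand)
  from someI_ex[OF this, folded lower_coeff_def] show ?thesis using assms by blast
qed

definition double_to_schur :: "nat list \<Rightarrow> nat list \<Rightarrow> Qa" where
  "double_to_schur \<nu> \<kappa> = (if \<kappa> = \<nu> then 1 else if \<kappa> \<in> parts_le (int (sum_list \<nu>) - 1) then lower_coeff \<nu> \<kappa> else 0)"

lemma double_schur_of_eq_sum:
  assumes "fps_nth G 0 = 1" "\<nu> \<in> parts_le n"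
  shows "double_schur_of G \<nu> = (\<Sum>\<kappa>\<in>parts_le n. Qa_embed (double_to_schur \<nu> \<kappa>) * schur_of G \<kappa>)"
proof -
  let ?L = "parts_le (int (sum_list \<nu>) - 1)"
  have \<nu>L: "\<nu> \<notin> ?L" by (simp add: parts_le_def)
  have "double_schur_of G \<nu> = (\<Sum>\<kappa>\<in>insert \<nu> ?L. Qa_embed (double_to_schur \<nu> \<kappa>) * schur_of G \<kappa>)"
    unfolding double_schur_of_lower[OF assms(1)] using \<nu>L
    by (subst sum.insert) (auto simp: double_to_schur_def intro!: sum.cong)
  also have "\<dots> = (\<Sum>\<kappa>\<in>parts_le n. Qa_embed (double_to_schur \<nu> \<kappa>) * schur_of G \<kappa>)"
  proof (rule sum.mono_neutral_left)
    have "?L \<subseteq> parts_le n" using assms(2) by (intro parts_le_mono) (simp add: parts_le_def)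
    then show "insert \<nu> ?L \<subseteq> parts_le n" using assms(2) by simp
  qed (auto simp: double_to_schur_def)
  finally show ?thesis .
qed

text \<open>After passing to \<open>schur_of\<close>, the coefficient at a \<nu> of maximal size N
  with c \<nu> \<noteq> 0 is c \<nu> alone: larger partitions have coefficient 0, and any other of
  size at most N contributes only strictly smaller partitions besides itself.\<close>

lemma double_schur_of_independent:
  assumes zero: "(\<Sum>\<nu>\<in>parts_le n. Qa_embed (c \<nu>) * double_schur_of (h_fps 0) \<nu>) = 0" and \<nu>0: "\<nu>0 \<in> parts_le n"
  shows "c \<nu>0 = 0"
proof (rule ccontr)
  assume c0: "c \<nu>0 \<noteq> 0"
  let ?B = "{\<nu> \<in> parts_le n. c \<nu> \<noteq> 0}"
  define N where "N = Max (sum_list ` ?B)"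
  have "N \<in> sum_list ` ?B"
    unfolding N_def using \<nu>0 c0 by (intro Max_in) auto
  then obtain \<nu> where \<nu>: "\<nu> \<in> parts_le n" "c \<nu> \<noteq> 0" "sum_list \<nu> = N" by auto
  have big: "c \<kappa> = 0" if "\<kappa> \<in> parts_le n" "N < sum_list \<kappa>" for \<kappa>
  proof (rule ccontr)
    assume "c \<kappa> \<noteq> 0"
    then have "sum_list \<kappa> \<le> N" unfolding N_def using that(1) by (intro Max_ge) auto
    then show False using that(2) by simp
  qed
  have "0 = (\<Sum>\<mu>\<in>parts_le n. \<Sum>\<kappa>\<in>parts_le n. Qa_embed (c \<mu> * double_to_schur \<mu> \<kappa>) * schur_of (h_fps 0) \<kappa>)"
    unfolding zero[symmetric]
    by (rule sum.cong[OF refl]) (simp add: double_schur_of_eq_sum[of _ _ n] sum_distrib_left Qa_embed.hom_mult mult.assoc)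
  also have "\<dots> = (\<Sum>\<kappa>\<in>parts_le n. Qa_embed (\<Sum>\<mu>\<in>parts_le n. c \<mu> * double_to_schur \<mu> \<kappa>) * schur_of (h_fps 0) \<kappa>)"
    by (subst sum.swap) (simp add: Qa_embed.hom_sum sum_distrib_right)
  finally have "(\<Sum>\<mu>\<in>parts_le n. c \<mu> * double_to_schur \<mu> \<nu>) = 0"
    using schur_of_independent[where n = n and c = "\<lambda>\<kappa>. \<Sum>\<mu>\<in>parts_le n. c \<mu> * double_to_schur \<mu> \<kappa>" and ?\<nu>0.0 = \<nu>] \<nu>(1) by simp
  moreover have "(\<Sum>\<mu>\<in>parts_le n. c \<mu> * double_to_schur \<mu> \<nu>) = (\<Sum>\<mu>\<in>parts_le n. if \<mu> = \<nu> then c \<nu> else 0)"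
  proof (rule sum.cong[OF refl])
    fix \<mu> assume \<mu>: "\<mu> \<in> parts_le n"
    show "c \<mu> * double_to_schur \<mu> \<nu> = (if \<mu> = \<nu> then c \<nu> else 0)"
    proof (cases "N < sum_list \<mu>")
      case True
      then show ?thesis using big[OF \<mu>] \<nu>(3) by auto
    next
      case False
      then show ?thesis using \<nu>(3) by (auto simp: double_to_schur_def parts_le_def)
    qed
  qed
  ultimately show False using \<nu>(1,2) by simp
qed

text \<open>The inverse transition matrix. It is required to vanish outside its range because its
  columns will serve as coordinate functions, which have to be supported on partitions.\<close>

definition schur_to_double :: "nat list \<Rightarrow> nat list \<Rightarrow> Qa" where
  "schur_to_double = (SOME D. (\<forall>\<nu>\<in>partitions. \<forall>G. fps_nth G 0 = 1 \<longrightarrow>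
      schur_of G \<nu> = (\<Sum>\<mu>\<in>parts_le (int (sum_list \<nu>)). Qa_embed (D \<nu> \<mu>) * double_schur_of G \<mu>)) \<and>
      (\<forall>\<nu> \<mu>. D \<nu> \<mu> \<noteq> 0 \<longrightarrow> \<nu> \<in> partitions \<and> \<mu> \<in> parts_le (int (sum_list \<nu>))))"

lemma schur_to_double:
  shows schur_of_eq_sum_exact: "\<And>\<nu> G. \<nu> \<in> partitions \<Longrightarrow> fps_nth G 0 = 1 \<Longrightarrow>
      schur_of G \<nu> = (\<Sum>\<mu>\<in>parts_le (int (sum_list \<nu>)). Qa_embed (schur_to_double \<nu> \<mu>) * double_schur_of G \<mu>)"
    and schur_to_double_support: "\<And>\<nu> \<mu>. schur_to_double \<nu> \<mu> \<noteq> 0 \<Longrightarrow> \<nu> \<in> partitions \<and> \<mu> \<in> parts_le (int (sum_list \<nu>))"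
proof -
  have "\<forall>\<nu>\<in>partitions. \<exists>d. \<forall>G. fps_nth G 0 = 1 \<longrightarrow>
      schur_of G \<nu> = (\<Sum>\<mu>\<in>parts_le (int (sum_list \<nu>)). Qa_embed (d \<mu>) * double_schur_of G \<mu>)"
    by (intro ballI schur_of_expand)
  from bchoice[OF this] obtain D where D: "\<forall>\<nu>\<in>partitions. \<forall>G. fps_nth G 0 = 1 \<longrightarrow>
      schur_of G \<nu> = (\<Sum>\<mu>\<in>parts_le (int (sum_list \<nu>)). Qa_embed (D \<nu> \<mu>) * double_schur_of G \<mu>)" ..
  define D' where "D' \<nu> \<mu> = (if \<nu> \<in> partitions \<and> \<mu> \<in> parts_le (int (sum_list \<nu>)) then D \<nu> \<mu> else 0)" for \<nu> \<mu>
  have "\<exists>D. (\<forall>\<nu>\<in>partitions. \<forall>G. fps_nth G 0 = 1 \<longrightarrow>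
      schur_of G \<nu> = (\<Sum>\<mu>\<in>parts_le (int (sum_list \<nu>)). Qa_embed (D \<nu> \<mu>) * double_schur_of G \<mu>)) \<and>
      (\<forall>\<nu> \<mu>. D \<nu> \<mu> \<noteq> 0 \<longrightarrow> \<nu> \<in> partitions \<and> \<mu> \<in> parts_le (int (sum_list \<nu>)))"
  proof (rule exI[of _ D'], intro conjI ballI allI impI)
    fix \<nu> and G :: "xa_series fps" assume "\<nu> \<in> partitions" "fps_nth G 0 = 1"
    then show "schur_of G \<nu> = (\<Sum>\<mu>\<in>parts_le (int (sum_list \<nu>)). Qa_embed (D' \<nu> \<mu>) * double_schur_of G \<mu>)"
      using D by (simp add: D'_def)
  qed (simp_all add: D'_def split: if_splits)
  from someI_ex[OF this, folded schur_to_double_def]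
  show "\<And>\<nu> G. \<nu> \<in> partitions \<Longrightarrow> fps_nth G 0 = 1 \<Longrightarrow>
      schur_of G \<nu> = (\<Sum>\<mu>\<in>parts_le (int (sum_list \<nu>)). Qa_embed (schur_to_double \<nu> \<mu>) * double_schur_of G \<mu>)"
    and "\<And>\<nu> \<mu>. schur_to_double \<nu> \<mu> \<noteq> 0 \<Longrightarrow> \<nu> \<in> partitions \<and> \<mu> \<in> parts_le (int (sum_list \<nu>))"
    by blast+
qed

lemma schur_of_eq_sum:
  assumes "\<nu> \<in> parts_le n" "fps_nth G 0 = 1"
  shows "schur_of G \<nu> = (\<Sum>\<mu>\<in>parts_le n. Qa_embed (schur_to_double \<nu> \<mu>) * double_schur_of G \<mu>)"
proof -
  have \<nu>: "\<nu> \<in> partitions" "int (sum_list \<nu>) \<le> n" using assms(1) by (simp_all add: parts_le_def)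
  show ?thesis
    unfolding schur_of_eq_sum_exact[OF \<nu>(1) assms(2)]
  proof (rule sum.mono_neutral_left)
    show "\<forall>\<mu>\<in>parts_le n - parts_le (int (sum_list \<nu>)). Qa_embed (schur_to_double \<nu> \<mu>) * double_schur_of G \<mu> = 0"
    proof
      fix \<mu> assume "\<mu> \<in> parts_le n - parts_le (int (sum_list \<nu>))"
      then have "schur_to_double \<nu> \<mu> = 0" using schur_to_double_support[of \<nu> \<mu>] by blast
      then show "Qa_embed (schur_to_double \<nu> \<mu>) * double_schur_of G \<mu> = 0" by simp
    qed
  qed (use parts_le_mono[OF \<nu>(2)] in auto)
qed

text \<open>Expanding in \<open>schur_of\<close> and back expresses \<open>double_schur_of\<close>
  through itself, and independence at G = \<open>h_fps 0\<close> identifies the coefficients. The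
  matrices do not depend on G, so a single G with independent determinants is enough.\<close>

lemma double_to_schur_inverse:
  assumes "\<nu> \<in> partitions" "\<mu> \<in> partitions"
  shows "(\<Sum>\<kappa>\<in>parts_le (int (sum_list \<nu>)). double_to_schur \<nu> \<kappa> * schur_to_double \<kappa> \<mu>) = (if \<nu> = \<mu> then 1 else 0)"
proof -
  let ?P = "parts_le (int (sum_list \<nu>))"
  have \<nu>P: "\<nu> \<in> ?P" using assms(1) by (simp add: parts_le_def)
  show ?thesis
  proof (cases "\<mu> \<in> ?P")
    case True
    let ?c = "\<lambda>\<mu>. (\<Sum>\<kappa>\<in>?P. double_to_schur \<nu> \<kappa> * schur_to_double \<kappa> \<mu>) - (if \<nu> = \<mu> then 1 else 0)"
    have "double_schur_of (h_fps 0) \<nu> = (\<Sum>\<kappa>\<in>?P. \<Sum>\<mu>\<in>?P. Qa_embed (double_to_schur \<nu> \<kappa> * schur_to_double \<kappa> \<mu>) * double_schur_of (h_fps 0) \<mu>)"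
      unfolding double_schur_of_eq_sum[OF h_fps_nth_0 \<nu>P]
      by (rule sum.cong[OF refl]) (simp add: schur_of_eq_sum[of _ "int (sum_list \<nu>)"] sum_distrib_left Qa_embed.hom_mult mult.assoc)
    also have "\<dots> = (\<Sum>\<mu>\<in>?P. Qa_embed (\<Sum>\<kappa>\<in>?P. double_to_schur \<nu> \<kappa> * schur_to_double \<kappa> \<mu>) * double_schur_of (h_fps 0) \<mu>)"
      by (subst sum.swap) (simp add: Qa_embed.hom_sum sum_distrib_right)
    finally have 1: "double_schur_of (h_fps 0) \<nu> = \<dots>" .
    have "double_schur_of (h_fps 0) \<nu> = (\<Sum>\<mu>\<in>?P. if \<mu> = \<nu> then double_schur_of (h_fps 0) \<mu> else 0)"
      using \<nu>P by simp
    also have "\<dots> = (\<Sum>\<mu>\<in>?P. Qa_embed (if \<nu> = \<mu> then 1 else 0) * double_schur_of (h_fps 0) \<mu>)"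
      by (intro sum.cong) auto
    finally have 2: "double_schur_of (h_fps 0) \<nu> = \<dots>" .
    have "(\<Sum>\<mu>\<in>?P. Qa_embed (?c \<mu>) * double_schur_of (h_fps 0) \<mu>) = double_schur_of (h_fps 0) \<nu> - double_schur_of (h_fps 0) \<nu>"
      by (subst 1, subst 2) (simp only: Qa_embed.hom_minus left_diff_distrib sum_subtractf)
    then have "?c \<mu> = 0"
      using True by (intro double_schur_of_independent[where n = "int (sum_list \<nu>)" and c = ?c]) simp_all
    then show ?thesis by simp
  next
    case False
    have "schur_to_double \<kappa> \<mu> = 0" if "\<kappa> \<in> ?P" for \<kappa>
    proof (rule ccontr)
      assume "schur_to_double \<kappa> \<mu> \<noteq> 0"
      then have "\<mu> \<in> parts_le (int (sum_list \<kappa>))" using schur_to_double_support by blast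
      then show False
        using False that parts_le_mono[of "int (sum_list \<kappa>)" "int (sum_list \<nu>)"] by (auto simp: parts_le_def)
    qed
    then have "(\<Sum>\<kappa>\<in>?P. double_to_schur \<nu> \<kappa> * schur_to_double \<kappa> \<mu>) = 0" by simp
    then show ?thesis using False \<nu>P by auto
  qed
qed


section \<open>Coordinates and dual Schur functions\<close>

lemma has_formal_sumI:
  assumes "\<And>m. finite (A m)" "\<And>m. A m \<subseteq> I" "\<And>m i. i \<in> I \<Longrightarrow> i \<notin> A m \<Longrightarrow> mcoeff (F i) m = 0"
    "\<And>m. mcoeff T m = (\<Sum>i\<in>A m. mcoeff (F i) m)"
  shows "has_formal_sum F I T"
  unfolding has_formal_sum_def
proof (intro allI conjI)
  fix m
  have sub: "{i \<in> I. mcoeff (F i) m \<noteq> 0} \<subseteq> A m"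
    using assms(3) by blast
  then show "finite {i \<in> I. mcoeff (F i) m \<noteq> 0}"
    using assms(1) finite_subset by blast
  show "mcoeff T m = (\<Sum>i\<in>{i \<in> I. mcoeff (F i) m \<noteq> 0}. mcoeff (F i) m)"
    unfolding assms(4) using assms(1,2) sub by (intro sum.mono_neutral_right) auto
qed

lemma has_formal_sumD:
  assumes "has_formal_sum F I T" "finite A" "A \<subseteq> I" "\<And>i. i \<in> I \<Longrightarrow> i \<notin> A \<Longrightarrow> mcoeff (F i) m = 0"
  shows "mcoeff T m = (\<Sum>i\<in>A. mcoeff (F i) m)"
proof -
  have "mcoeff T m = (\<Sum>i\<in>{i \<in> I. mcoeff (F i) m \<noteq> 0}. mcoeff (F i) m)"
    using assms(1) unfolding has_formal_sum_def by blast
  also have "\<dots> = (\<Sum>i\<in>A. mcoeff (F i) m)"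
    using assms(2-4) by (intro sum.mono_neutral_left) auto
  finally show ?thesis .
qed

lemma zero_outside: "{\<nu>. c \<nu> \<noteq> 0} \<subseteq> A \<Longrightarrow> \<nu> \<notin> A \<Longrightarrow> c \<nu> = 0"
  by blast

text \<open>A Kostka number vanishes unless |\<nu>| is the degree of m, so the formal sum is finite
  at each monomial. No support condition on c is built in; only values on partitions are
  read.\<close>

definition schur_series :: "(nat list \<Rightarrow> Qa) \<Rightarrow> (nat, Qa) mfps" where
  "schur_series c = Mfps (\<lambda>m. \<Sum>\<nu> | \<nu> \<in> partitions \<and> sum_list \<nu> = mdeg m. of_int (kostka \<nu> m) * c \<nu>)"

lemma mcoeff_scaled_schur: "mcoeff (mconst c * schur \<nu>) m = of_int (kostka \<nu> m) * (c :: Qa)"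
  by (simp add: mcoeff_schur mult.commute[of c])

lemma has_formal_sum_schur_series:
  "has_formal_sum (\<lambda>\<nu>. mconst (c \<nu>) * schur \<nu>) partitions (schur_series c)"
  by (rule has_formal_sumI[where A = "\<lambda>m. {\<nu> \<in> partitions. sum_list \<nu> = mdeg m}"])
    (use kostka_degree in \<open>auto simp: finite_partitions_eq mcoeff_scaled_schur schur_series_def simp del: mcoeff_mconst_times\<close>)

lemma schur_series_unique:
  assumes "has_formal_sum (\<lambda>\<nu>. mconst (c \<nu>) * schur \<nu>) partitions g"
  shows "g = schur_series c"
proof (rule mfps_eqI)
  fix m
  have "mcoeff g m = (\<Sum>\<nu>\<in>{\<nu> \<in> partitions. sum_list \<nu> = mdeg m}. mcoeff (mconst (c \<nu>) * schur \<nu>) m)"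
    by (rule has_formal_sumD[OF assms finite_partitions_eq])
      (use kostka_degree in \<open>auto simp: mcoeff_scaled_schur simp del: mcoeff_mconst_times\<close>)
  then show "mcoeff g m = mcoeff (schur_series c) m"
    by (simp add: schur_series_def mcoeff_scaled_schur del: mcoeff_mconst_times)
qed

lemma schur_series_inject:
  assumes "schur_series c = schur_series d" "\<nu> \<in> partitions"
  shows "c \<nu> = d \<nu>"
proof -
  have "c \<nu> - d \<nu> = 0"
  proof (rule kostka_independent[where c = "\<lambda>\<nu>. c \<nu> - d \<nu>" and n = "sum_list \<nu>"])
    fix m :: "nat \<Rightarrow>\<^sub>0 nat" assume "mdeg m = sum_list \<nu>"
    then show "(\<Sum>\<kappa> | \<kappa> \<in> partitions \<and> sum_list \<kappa> = sum_list \<nu>. of_int (kostka \<kappa> m) * (c \<kappa> - d \<kappa>)) = 0"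
      using arg_cong[OF assms(1), of "\<lambda>F. mcoeff F m"]
      by (simp add: schur_series_def right_diff_distrib sum_subtractf)
  qed (use assms(2) in simp_all)
  then show ?thesis by simp
qed

lemma y_coords_schur_series:
  assumes "{\<nu>. c \<nu> \<noteq> 0} \<subseteq> partitions"
  shows "y_coords (schur_series c) = c"
  unfolding y_coords_def
proof (rule the_equality)
  show "{\<nu>. c \<nu> \<noteq> 0} \<subseteq> partitions \<and>
      has_formal_sum (\<lambda>\<nu>. mconst (c \<nu>) * schur \<nu>) partitions (schur_series c)"
    using assms has_formal_sum_schur_series by blast
  fix d assume d: "{\<nu>. d \<nu> \<noteq> 0} \<subseteq> partitions \<and>
      has_formal_sum (\<lambda>\<nu>. mconst (d \<nu>) * schur \<nu>) partitions (schur_series c)"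
  then have eq: "schur_series c = schur_series d"
    using schur_series_unique by blast
  show "d = c"
  proof
    fix \<nu>
    show "d \<nu> = c \<nu>"
      using schur_series_inject[OF eq, of \<nu>] zero_outside[of c partitions \<nu>] zero_outside[of d partitions \<nu>] assms d
      by (cases "\<nu> \<in> partitions") auto
  qed
qed

lemma Lambda_hat_cases:
  assumes "g \<in> Lambda_hat"
  obtains c where "{\<nu>. c \<nu> \<noteq> 0} \<subseteq> partitions" "g = schur_series c"
proof -
  obtain c where c: "g = schur_series c"
    using assms schur_series_unique unfolding Lambda_hat_def by blast
  have "schur_series c = schur_series (\<lambda>\<nu>. if \<nu> \<in> partitions then c \<nu> else 0)"
    by (rule mfps_eqI) (auto simp: schur_series_def intro!: sum.cong)
  moreover have "{\<nu>. (if \<nu> \<in> partitions then c \<nu> else 0) \<noteq> 0} \<subseteq> partitions"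
    by (auto split: if_splits)
  ultimately show ?thesis
    using c that[of "\<lambda>\<nu>. if \<nu> \<in> partitions then c \<nu> else 0"] by simp
qed

lemma x_coords_eq:
  assumes supp: "{\<nu>. c \<nu> \<noteq> 0} \<subseteq> parts_le n"
    and f: "f = (\<Sum>\<nu>\<in>parts_le n. Qa_embed (c \<nu>) * super (schur \<nu>))"
  shows "x_coords f = c"
  unfolding x_coords_def
proof (rule the_equality)
  have expand: "(\<Sum>\<nu>\<in>{\<nu>. d \<nu> \<noteq> 0}. Qa_embed (d \<nu>) * super (schur \<nu>)) =
      (\<Sum>\<nu>\<in>parts_le k. Qa_embed (d \<nu>) * super (schur \<nu>))" if "{\<nu>. d \<nu> \<noteq> 0} \<subseteq> parts_le k" for d k
    using that by (intro sum.mono_neutral_left) auto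
  show "{\<nu>. c \<nu> \<noteq> 0} \<subseteq> partitions \<and> finite {\<nu>. c \<nu> \<noteq> 0} \<and>
      f = (\<Sum>\<nu>\<in>{\<nu>. c \<nu> \<noteq> 0}. Qa_embed (c \<nu>) * super (schur \<nu>))"
  proof (intro conjI)
    show "{\<nu>. c \<nu> \<noteq> 0} \<subseteq> partitions"
      using supp by (auto simp: parts_le_def)
    show "finite {\<nu>. c \<nu> \<noteq> 0}"
      using supp finite_parts_le by (rule finite_subset)
    show "f = (\<Sum>\<nu>\<in>{\<nu>. c \<nu> \<noteq> 0}. Qa_embed (c \<nu>) * super (schur \<nu>))"
      unfolding f by (rule expand[OF supp, symmetric])
  qed
  fix d assume d: "{\<nu>. d \<nu> \<noteq> 0} \<subseteq> partitions \<and> finite {\<nu>. d \<nu> \<noteq> 0} \<and>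
      f = (\<Sum>\<nu>\<in>{\<nu>. d \<nu> \<noteq> 0}. Qa_embed (d \<nu>) * super (schur \<nu>))"
  \<comment> \<open>A size bound covering both supports. The sum of the sizes stands in for their
    maximum, so an empty support needs no separate treatment.\<close>
  define N where "N = max n (\<Sum>\<nu>\<in>{\<nu>. d \<nu> \<noteq> 0}. int (sum_list \<nu>))"
  have dN: "{\<nu>. d \<nu> \<noteq> 0} \<subseteq> parts_le N"
  proof
    fix \<nu> assume \<nu>: "\<nu> \<in> {\<nu>. d \<nu> \<noteq> 0}"
    then have "int (sum_list \<nu>) \<le> (\<Sum>\<nu>\<in>{\<nu>. d \<nu> \<noteq> 0}. int (sum_list \<nu>))"
      using d by (intro member_le_sum) auto
    then show "\<nu> \<in> parts_le N"
      using \<nu> d by (auto simp: parts_le_def N_def)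
  qed
  have cN: "{\<nu>. c \<nu> \<noteq> 0} \<subseteq> parts_le N"
    using supp parts_le_mono[of n N] by (simp add: N_def)
  have "(\<Sum>\<nu>\<in>parts_le N. Qa_embed (d \<nu> - c \<nu>) * schur_of (h_fps 0) \<nu>) =
      (\<Sum>\<nu>\<in>parts_le N. Qa_embed (d \<nu>) * super (schur \<nu>)) - (\<Sum>\<nu>\<in>parts_le N. Qa_embed (c \<nu>) * super (schur \<nu>))"
    by (simp only: Qa_embed.hom_minus left_diff_distrib sum_subtractf super_schur_eq_schur_of)
  also have "\<dots> = 0"
    using d f expand[OF dN] expand[OF cN] expand[OF supp] by simp
  finally have zero: "(\<Sum>\<nu>\<in>parts_le N. Qa_embed (d \<nu> - c \<nu>) * schur_of (h_fps 0) \<nu>) = 0" .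
  show "d = c"
  proof
    fix \<nu>
    show "d \<nu> = c \<nu>"
      using schur_of_independent[OF zero, of \<nu>] zero_outside[OF cN, of \<nu>] zero_outside[OF dN, of \<nu>]
      by (cases "\<nu> \<in> parts_le N") auto
  qed
qed

lemma double_to_schur_support: "\<nu> \<in> partitions \<Longrightarrow> {\<kappa>. double_to_schur \<nu> \<kappa> \<noteq> 0} \<subseteq> parts_le (int (sum_list \<nu>))"
  by (auto simp: double_to_schur_def parts_le_def split: if_splits)

lemma x_coords_schur_double: "\<nu> \<in> partitions \<Longrightarrow> x_coords (schur_double \<nu>) = double_to_schur \<nu>"
proof -
  assume \<nu>: "\<nu> \<in> partitions"
  have "\<nu> \<in> parts_le (int (sum_list \<nu>))" using \<nu> by (simp add: parts_le_def)
  then show ?thesis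
    using double_to_schur_support[OF \<nu>]
    by (intro x_coords_eq) (simp_all add: schur_double_eq_double_schur_of super_schur_eq_schur_of double_schur_of_eq_sum[OF h_fps_nth_0])
qed

lemma pairing_schur_double:
  assumes "\<nu> \<in> partitions" "{\<kappa>. c \<kappa> \<noteq> 0} \<subseteq> partitions"
  shows "pairing (schur_double \<nu>) (schur_series c) = (\<Sum>\<kappa>\<in>parts_le (int (sum_list \<nu>)). double_to_schur \<nu> \<kappa> * c \<kappa>)"
  unfolding pairing_def x_coords_schur_double[OF assms(1)] y_coords_schur_series[OF assms(2)]
  using double_to_schur_support[OF assms(1)] by (intro sum.mono_neutral_left) auto

text \<open>Duality asks for a coordinate vector that the matrix \<open>double_to_schur\<close>
  sends to a unit vector, so it is a column of the inverse matrix. Uniqueness follows by induction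
  on the size: with diagonal entry 1, the equation for \<nu> determines c \<nu> from the values on
  smaller partitions.\<close>

lemma dual_schur_eq:
  assumes \<mu>: "\<mu> \<in> partitions"
  shows "dual_schur \<mu> = schur_series (\<lambda>\<nu>. schur_to_double \<nu> \<mu>)"
  unfolding dual_schur_def
proof (rule the_equality)
  have supp: "{\<nu>. schur_to_double \<nu> \<mu> \<noteq> 0} \<subseteq> partitions"
    using schur_to_double_support by blast
  show "schur_series (\<lambda>\<nu>. schur_to_double \<nu> \<mu>) \<in> Lambda_hat \<and>
      (\<forall>\<nu>\<in>partitions. pairing (schur_double \<nu>) (schur_series (\<lambda>\<nu>. schur_to_double \<nu> \<mu>)) = (if \<nu> = \<mu> then 1 else 0))"
  proof (intro conjI ballI)
    show "schur_series (\<lambda>\<nu>. schur_to_double \<nu> \<mu>) \<in> Lambda_hat"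
      unfolding Lambda_hat_def using has_formal_sum_schur_series[of "\<lambda>\<nu>. schur_to_double \<nu> \<mu>"] by (intro CollectI exI)
    fix \<nu> assume \<nu>: "\<nu> \<in> partitions"
    show "pairing (schur_double \<nu>) (schur_series (\<lambda>\<nu>. schur_to_double \<nu> \<mu>)) = (if \<nu> = \<mu> then 1 else 0)"
      unfolding pairing_schur_double[OF \<nu> supp] by (rule double_to_schur_inverse[OF \<nu> \<mu>])
  qed
  fix g assume g: "g \<in> Lambda_hat \<and> (\<forall>\<nu>\<in>partitions. pairing (schur_double \<nu>) g = (if \<nu> = \<mu> then 1 else 0))"
  then obtain c where c: "{\<nu>. c \<nu> \<noteq> 0} \<subseteq> partitions" "g = schur_series c"
    using Lambda_hat_cases by blast
  have eq: "(\<Sum>\<kappa>\<in>parts_le (int (sum_list \<nu>)). double_to_schur \<nu> \<kappa> * c \<kappa>) =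
      (\<Sum>\<kappa>\<in>parts_le (int (sum_list \<nu>)). double_to_schur \<nu> \<kappa> * schur_to_double \<kappa> \<mu>)" if \<nu>: "\<nu> \<in> partitions" for \<nu>
    using g \<nu> pairing_schur_double[OF \<nu> c(1)] double_to_schur_inverse[OF \<nu> \<mu>] by (simp add: c(2))
  have "c \<nu> = schur_to_double \<nu> \<mu>" if "\<nu> \<in> partitions" for \<nu>
    using that
  proof (induction "sum_list \<nu>" arbitrary: \<nu> rule: less_induct)
    case less
    let ?P = "parts_le (int (sum_list \<nu>))"
    have \<nu>P: "\<nu> \<in> ?P" using less.prems by (simp add: parts_le_def)
    have rest: "double_to_schur \<nu> \<kappa> * c \<kappa> = double_to_schur \<nu> \<kappa> * schur_to_double \<kappa> \<mu>" if \<kappa>: "\<kappa> \<in> ?P - {\<nu>}" for \<kappa>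
    proof (cases "\<kappa> \<in> parts_le (int (sum_list \<nu>) - 1)")
      case True
      then have "sum_list \<kappa> < sum_list \<nu>" "\<kappa> \<in> partitions" by (simp_all add: parts_le_def)
      then show ?thesis using less.hyps by simp
    next
      case False
      then show ?thesis using \<kappa> by (simp add: double_to_schur_def)
    qed
    have "(\<Sum>\<kappa>\<in>?P - {\<nu>}. double_to_schur \<nu> \<kappa> * c \<kappa>) = (\<Sum>\<kappa>\<in>?P - {\<nu>}. double_to_schur \<nu> \<kappa> * schur_to_double \<kappa> \<mu>)"
      by (rule sum.cong[OF refl rest])
    then have "double_to_schur \<nu> \<nu> * c \<nu> = double_to_schur \<nu> \<nu> * schur_to_double \<nu> \<mu>"
      using eq[OF less.prems] sum.remove[OF finite_parts_le \<nu>P, of "\<lambda>\<kappa>. double_to_schur \<nu> \<kappa> * c \<kappa>"]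
        sum.remove[OF finite_parts_le \<nu>P, of "\<lambda>\<kappa>. double_to_schur \<nu> \<kappa> * schur_to_double \<kappa> \<mu>"] by simp
    then show ?case by (simp add: double_to_schur_def)
  qed
  then have "c \<nu> = schur_to_double \<nu> \<mu>" for \<nu>
    using zero_outside[OF c(1), of \<nu>] zero_outside[OF supp, of \<nu>] by (cases "\<nu> \<in> partitions") simp_all
  then have "c = (\<lambda>\<nu>. schur_to_double \<nu> \<mu>)" ..
  then show "g = schur_series (\<lambda>\<nu>. schur_to_double \<nu> \<mu>)"
    by (simp add: c(2))
qed

lemma mcoeff_dual_schur:
  "\<mu> \<in> partitions \<Longrightarrow> mcoeff (dual_schur \<mu>) m =
    (\<Sum>\<nu> | \<nu> \<in> partitions \<and> sum_list \<nu> = mdeg m. of_int (kostka \<nu> m) * schur_to_double \<nu> \<mu>)"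
  by (simp add: dual_schur_eq schur_series_def)

lemma mcoeff_dual_schur_small:
  assumes "\<mu> \<in> partitions" "mdeg m < sum_list \<mu>"
  shows "mcoeff (dual_schur \<mu>) m = 0"
proof -
  have "schur_to_double \<nu> \<mu> = 0" if "sum_list \<nu> = mdeg m" for \<nu>
    using schur_to_double_support[of \<nu> \<mu>] that assms(2) by (auto simp: parts_le_def)
  then show ?thesis by (simp add: mcoeff_dual_schur[OF assms(1)])
qed

text \<open>In the ordinary Cauchy identity each \<open>schur_of G\<close> is expanded in the
  \<open>double_schur_of G\<close>; the sums that collect at \<mu> are the coefficients of a dual
  Schur function. They are the same for every G. The bound n is left free so that all monomials
  dividing a given one can share its index set.\<close>

theorem hprod_expand:
  assumes G: "fps_nth G 0 = 1" and m: "int (mdeg m) \<le> n"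
  shows "hprod (cf G) m = (\<Sum>\<mu>\<in>parts_le n. Qa_embed (mcoeff (dual_schur \<mu>) m) * double_schur_of G \<mu>)"
proof -
  let ?A = "{\<nu> \<in> partitions. sum_list \<nu> = mdeg m}"
  have "hprod (cf G) m = (\<Sum>\<nu>\<in>?A. of_int (kostka \<nu> m) * schur_of G \<nu>)"
    unfolding schur_of_def using G by (intro cauchy_identity) (simp_all add: cf_def)
  also have "\<dots> = (\<Sum>\<nu>\<in>?A. \<Sum>\<mu>\<in>parts_le n. Qa_embed (of_int (kostka \<nu> m) * schur_to_double \<nu> \<mu>) * double_schur_of G \<mu>)"
  proof (rule sum.cong[OF refl])
    fix \<nu> assume "\<nu> \<in> ?A"
    then have "\<nu> \<in> parts_le n" using m by (simp add: parts_le_def)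
    then show "of_int (kostka \<nu> m) * schur_of G \<nu> =
        (\<Sum>\<mu>\<in>parts_le n. Qa_embed (of_int (kostka \<nu> m) * schur_to_double \<nu> \<mu>) * double_schur_of G \<mu>)"
      by (simp add: schur_of_eq_sum[OF _ G, of \<nu> n] sum_distrib_left Qa_embed.hom_mult Qa_embed.hom_of_int mult.assoc)
  qed
  also have "\<dots> = (\<Sum>\<mu>\<in>parts_le n. Qa_embed (\<Sum>\<nu>\<in>?A. of_int (kostka \<nu> m) * schur_to_double \<nu> \<mu>) * double_schur_of G \<mu>)"
    by (subst sum.swap) (simp only: Qa_embed.hom_sum sum_distrib_right)
  also have "\<dots> = (\<Sum>\<mu>\<in>parts_le n. Qa_embed (mcoeff (dual_schur \<mu>) m) * double_schur_of G \<mu>)"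
    by (rule sum.cong) (simp_all add: mcoeff_dual_schur parts_le_def)
  finally show ?thesis .
qed


section \<open>Adding the variable \<open>a\<^sub>1\<close> and removing \<open>a\<^sub>0\<close>\<close>

lemma cf_add_X:
  assumes "A = B + fps_const u * (fps_X * C)"
  shows "cf A r = cf B r + u * cf C (r - 1)"
proof (cases "r \<le> 0")
  case True
  then show ?thesis unfolding assms by (cases "r = 0") (auto simp: cf_def)
next
  case False
  then show ?thesis unfolding assms by (simp add: cf_def nat_diff_distrib)
qed

lemma lin_fps_change: "lin_fps c = lin_fps d + fps_const (d - c) * fps_X"
  by (simp add: lin_fps_def left_diff_distrib flip: fps_const_sub)

definition middle_shapes :: "nat list \<Rightarrow> nat list \<Rightarrow> nat list set" where
  "middle_shapes \<nu> \<mu> = {\<rho> \<in> partitions. diagram \<mu> \<subseteq> diagram \<rho> \<and> diagram \<rho> \<subseteq> diagram \<nu> \<and>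
     vertical_strip (skew \<nu> \<rho>) \<and> horizontal_strip (skew \<rho> \<mu>)}"

definition total_wt :: "nat list \<Rightarrow> nat list \<Rightarrow> Qa" where
  "total_wt \<nu> \<mu> = (\<Sum>\<rho>\<in>middle_shapes \<nu> \<mu>. wt (skew \<nu> \<rho>, skew \<rho> \<mu>))"

definition tau_fps :: "xa_series fps" where
  "tau_fps = lin_fps (a_xa 0) * geo_fps (a_xa 1)"

lemma below_parts_le:
  "\<mu> \<in> partitions \<Longrightarrow> diagram \<mu> \<subseteq> diagram \<nu> \<Longrightarrow> \<nu> \<in> parts_le n \<Longrightarrow> \<mu> \<in> parts_le n"
  using card_skew[OF _ diagram_subset_length, of \<mu> \<nu>] by (auto simp: parts_le_def)

text \<open>Write e_l for \<open>e_fps l\<close>. Between the two steps the row of content l carries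
  G e_(l+1) / (1 - a_1 t). The vertical step rests on e_l (1 - a_0 t) = e_(l+1) + (a_(l+1) - a_0) t
  e_l, the horizontal one on e_(l+1) / (1 - a_1 t) = e_l + (a_1 - a_(l+1)) t e_l / (1 - a_1 t). The
  last term of the second identity is again an intermediate row, so that recursion iterates, while
  the first does not.\<close>

lemma double_schur_of_tau:
  assumes G: "fps_nth G 0 = 1" and \<nu>: "\<nu> \<in> parts_le n"
  shows "double_schur_of (G * tau_fps) \<nu> = (\<Sum>\<mu>\<in>parts_le n. Qa_embed (total_wt \<nu> \<mu>) * double_schur_of G \<mu>)"
proof -
  have \<nu>p: "\<nu> \<in> partitions" using \<nu> by (simp add: parts_le_def)
  let ?g = "geo_fps (a_xa 1)"
  let ?u = "\<lambda>l. a_xa (l + 1) - a_xa 0" and ?v = "\<lambda>l. a_xa 1 - a_xa (l + 1)"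
  let ?F = "\<lambda>l. cf (G * ?g * e_fps (l + 1))"
  let ?R = "\<lambda>\<rho>. diagram \<rho> \<subseteq> diagram \<nu> \<and> vertical_strip (skew \<nu> \<rho>)"
  let ?Q = "\<lambda>\<rho> \<mu>. diagram \<mu> \<subseteq> diagram \<rho> \<and> horizontal_strip (skew \<rho> \<mu>)"
  have setR: "{\<rho>. \<rho> \<in> partitions \<and> ?R \<rho>} = {\<rho>. \<rho> \<in> parts_le n \<and> ?R \<rho>}"
    using below_parts_le[OF _ _ \<nu>] by (auto simp: parts_le_def)
  have "double_schur_of (G * tau_fps) \<nu> = (\<Sum>\<rho> | \<rho> \<in> partitions \<and> ?R \<rho>.
      (\<Prod>(i, j)\<in>skew \<nu> \<rho>. ?u (int j - int i)) * Jt ?F \<rho>)"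
    unfolding double_schur_of_def
  proof (rule Jt_vertical[where F = "\<lambda>l. cf (G * tau_fps * e_fps l)" and F' = ?F and u = ?u, OF \<nu>p])
    show "unital ?F"
      by (rule unital_cf) (simp add: G)
    fix l r
    have "G * tau_fps * e_fps l = G * ?g * e_fps l * lin_fps (a_xa 0)"
      by (simp add: tau_fps_def mult_ac)
    \<comment> \<open>The index is written \<open>l - 1 + 1\<close> so that the second summand is
      the intermediate row of content l - 1.\<close>
    also have "\<dots> = G * ?g * e_fps (l + 1) + fps_const (?u l) * (fps_X * (G * ?g * e_fps (l - 1 + 1)))"
      unfolding lin_fps_change[of "a_xa 0" "a_xa (l + 1)"]
      by (simp add: e_fps_step distrib_left mult_ac)
    finally have "G * tau_fps * e_fps l = G * ?g * e_fps (l + 1) +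
        fps_const (?u l) * (fps_X * (G * ?g * e_fps (l - 1 + 1)))" .
    from cf_add_X[OF this] show "cf (G * tau_fps * e_fps l) r = ?F l r + ?u l * ?F (l - 1) (r - 1)" .
  qed
  also have "\<dots> = (\<Sum>\<rho>\<in>{\<rho>. \<rho> \<in> parts_le n \<and> ?R \<rho>}. \<Sum>\<mu>\<in>{\<mu>. \<mu> \<in> parts_le n \<and> ?Q \<rho> \<mu>}.
        Qa_embed (wt (skew \<nu> \<rho>, skew \<rho> \<mu>)) * double_schur_of G \<mu>)"
    unfolding setR
  proof (rule sum.cong[OF refl])
    fix \<rho> assume "\<rho> \<in> {\<rho>. \<rho> \<in> parts_le n \<and> ?R \<rho>}"
    then have \<rho>: "\<rho> \<in> parts_le n" "\<rho> \<in> partitions" by (auto simp: parts_le_def)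
    have "Jt ?F \<rho> = (\<Sum>\<mu> | \<mu> \<in> partitions \<and> ?Q \<rho> \<mu>.
        (\<Prod>(i, j)\<in>skew \<rho> \<mu>. ?v (int j - int i)) * Jt (\<lambda>l. cf (G * e_fps l)) \<mu>)"
    proof (rule Jt_horizontal[where F = ?F and F' = "\<lambda>l. cf (G * e_fps l)" and u = ?v, OF \<rho>(2)])
      show "?F l r = 0" if "r < 0" for l r
        using that by (simp add: cf_def)
      show "unital (\<lambda>l. cf (G * e_fps l))"
        by (rule unital_cf) (simp add: G)
      fix l r
      have "G * ?g * e_fps (l + 1) = G * e_fps l * (?g * lin_fps (a_xa (l + 1)))"
        by (simp add: e_fps_step mult_ac)
      also have "\<dots> = G * e_fps l * (?g * lin_fps (a_xa 1)) + fps_const (?v l) * (fps_X * (G * ?g * e_fps (l - 1 + 1)))"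
        unfolding lin_fps_change[of "a_xa (l + 1)" "a_xa 1"]
        by (simp add: distrib_left mult_ac)
      also have "G * e_fps l * (?g * lin_fps (a_xa 1)) = G * e_fps l"
        by simp
      finally have "G * ?g * e_fps (l + 1) =
          G * e_fps l + fps_const (?v l) * (fps_X * (G * ?g * e_fps (l - 1 + 1)))" .
      from cf_add_X[OF this] show "?F l r = cf (G * e_fps l) r + ?v l * ?F (l - 1) (r - 1)" .
    qed
    moreover have "{\<mu>. \<mu> \<in> partitions \<and> ?Q \<rho> \<mu>} = {\<mu>. \<mu> \<in> parts_le n \<and> ?Q \<rho> \<mu>}"
      using below_parts_le[OF _ _ \<rho>(1)] by (auto simp: parts_le_def)
    ultimately show "(\<Prod>(i, j)\<in>skew \<nu> \<rho>. ?u (int j - int i)) * Jt ?F \<rho> =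
        (\<Sum>\<mu>\<in>{\<mu>. \<mu> \<in> parts_le n \<and> ?Q \<rho> \<mu>}. Qa_embed (wt (skew \<nu> \<rho>, skew \<rho> \<mu>)) * double_schur_of G \<mu>)"
      by (simp add: wt_def double_schur_of_def Qa_embed.hom_mult Qa_embed.hom_prod Qa_embed.hom_minus case_prod_beta
          sum_distrib_left mult.assoc)
  qed
  also have "\<dots> = (\<Sum>\<mu>\<in>parts_le n. \<Sum>\<rho>\<in>{\<rho>. \<rho> \<in> {\<rho>. \<rho> \<in> parts_le n \<and> ?R \<rho>} \<and> ?Q \<rho> \<mu>}.
        Qa_embed (wt (skew \<nu> \<rho>, skew \<rho> \<mu>)) * double_schur_of G \<mu>)"
    by (rule sum.swap_restrict) simp_all
  also have "\<dots> = (\<Sum>\<mu>\<in>parts_le n. Qa_embed (total_wt \<nu> \<mu>) * double_schur_of G \<mu>)"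
  proof (rule sum.cong[OF refl])
    fix \<mu>
    have "{\<rho>. \<rho> \<in> {\<rho>. \<rho> \<in> parts_le n \<and> ?R \<rho>} \<and> ?Q \<rho> \<mu>} = middle_shapes \<nu> \<mu>"
      using below_parts_le[OF _ _ \<nu>] by (auto simp: middle_shapes_def parts_le_def)
    then show "(\<Sum>\<rho>\<in>{\<rho>. \<rho> \<in> {\<rho>. \<rho> \<in> parts_le n \<and> ?R \<rho>} \<and> ?Q \<rho> \<mu>}.
        Qa_embed (wt (skew \<nu> \<rho>, skew \<rho> \<mu>)) * double_schur_of G \<mu>) = Qa_embed (total_wt \<nu> \<mu>) * double_schur_of G \<mu>"
      by (simp only: total_wt_def Qa_embed.hom_sum sum_distrib_right)
  qed
  finally show ?thesis .
qed

text \<open>The product of (F G)(y_j) over j is the product of all F(y_j) times the product of all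
  G(y_j). On coefficients, choosing a term in each of the Cauchy products amounts to choosing a
  splitting of m.\<close>

lemma hprod_mult:
  fixes F G :: "'a::comm_ring_1 fps" and m :: "'v \<Rightarrow>\<^sub>0 nat"
  assumes "fps_nth F 0 = 1" "fps_nth G 0 = 1"
  shows "hprod (cf (F * G)) m = (\<Sum>(u, w)\<in>splits m. hprod (cf F) u * hprod (cf G) w)"
proof -
  let ?K = "Poly_Mapping.keys m"
  let ?m = "Poly_Mapping.lookup m"
  define I where "I p = restrict (Poly_Mapping.lookup (fst p)) ?K" for p :: "('v \<Rightarrow>\<^sub>0 nat) \<times> ('v \<Rightarrow>\<^sub>0 nat)"
  define U where "U f = Abs_poly_mapping (\<lambda>k. if k \<in> ?K then f k else 0)" for f :: "'v \<Rightarrow> nat"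
  have U: "Poly_Mapping.lookup (U f) k = (if k \<in> ?K then f k else 0)" for f k
  proof -
    have "finite {k. (if k \<in> ?K then f k else 0) \<noteq> 0}"
      by (rule finite_subset[OF _ finite_keys[of m]]) auto
    then show ?thesis by (simp add: U_def)
  qed
  have "hprod (cf (F * G)) m = (\<Prod>k\<in>?K. \<Sum>i\<in>{0..?m k}. fps_nth F i * fps_nth G (?m k - i))"
    by (simp add: hprod_def cf_def fps_mult_nth)
  also have "\<dots> = (\<Sum>f\<in>PiE ?K (\<lambda>k. {0..?m k}). \<Prod>k\<in>?K. fps_nth F (f k) * fps_nth G (?m k - f k))"
    by (rule prod_sum_PiE) auto
  also have "\<dots> = (\<Sum>(u, w)\<in>splits m. hprod (cf F) u * hprod (cf G) w)"
  proof (rule sum.reindex_bij_witness[of _ I "\<lambda>f. (U f, m - U f)"])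
    fix f assume f: "f \<in> PiE ?K (\<lambda>k. {0..?m k})"
    have le: "Poly_Mapping.lookup (U f) k \<le> ?m k" for k
      using f by (auto simp: U)
    show "I (U f, m - U f) = f"
    proof
      fix k
      show "I (U f, m - U f) k = f k"
        using f by (auto simp: I_def U PiE_def extensional_def)
    qed
    show "(U f, m - U f) \<in> splits m"
      using le by (auto simp: splits_def lookup_add lookup_minus intro!: poly_mapping_eqI)
    have "hprod (cf F) (U f) = (\<Prod>k\<in>?K. cf F (int (Poly_Mapping.lookup (U f) k)))"
      using assms by (intro hprod_eq_prod) (auto simp: cf_def in_keys_iff U split: if_splits)
    moreover have "hprod (cf G) (m - U f) = (\<Prod>k\<in>?K. cf G (int (Poly_Mapping.lookup (m - U f) k)))"
      using assms by (intro hprod_eq_prod) (auto simp: cf_def in_keys_iff lookup_minus)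
    ultimately show "(case (U f, m - U f) of (u, w) \<Rightarrow> hprod (cf F) u * hprod (cf G) w) =
        (\<Prod>k\<in>?K. fps_nth F (f k) * fps_nth G (?m k - f k))"
      by (simp add: prod.distrib cf_def U lookup_minus)
  next
    fix p assume p: "p \<in> splits m"
    obtain u w where uw: "p = (u, w)" by (cases p)
    then have m: "u + w = m" using p by (simp add: splits_def)
    have keys: "Poly_Mapping.keys u \<subseteq> ?K"
      by (simp add: keys_add_nat flip: m)
    have "U (I p) = u"
    proof (rule poly_mapping_eqI)
      fix k
      show "Poly_Mapping.lookup (U (I p)) k = Poly_Mapping.lookup u k"
        using keys by (auto simp: U I_def uw in_keys_iff)
    qed
    moreover have "m - u = w" using m by auto
    ultimately show "(U (I p), m - U (I p)) = p" by (simp add: uw)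
    have "Poly_Mapping.lookup u k \<le> ?m k" for k
      by (simp add: lookup_add flip: m)
    then show "I p \<in> PiE ?K (\<lambda>k. {0..?m k})"
      by (simp add: I_def uw)
  qed
  finally show ?thesis .
qed

text \<open>The same series as \<open>tau_fps\<close>, but over \<rat>[a], so that the kernel built
  from it lies in the ring of the dual Schur functions.\<close>

definition tau_Qa :: "Qa fps" where
  "tau_Qa = lin_fps (avar 0) * geo_fps (avar 1)"

lemma tau_fps_nth: "fps_nth tau_fps n = Qa_embed (fps_nth tau_Qa n)"
proof -
  have "fps_nth (lin_fps (a_xa 0)) n = Qa_embed (fps_nth (lin_fps (avar 0)) n)" for n
    by (simp add: lin_fps_def fps_X_nth Qa_embed.hom_minus Qa_embed.hom_uminus)
  moreover have "fps_nth (geo_fps (a_xa 1)) n = Qa_embed (fps_nth (geo_fps (avar 1)) n)" for n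
    by (simp add: geo_fps_def Qa_embed.hom_power)
  ultimately show ?thesis
    by (simp add: tau_fps_def tau_Qa_def fps_mult_nth Qa_embed.hom_sum Qa_embed.hom_mult)
qed

definition kernel :: "(nat, Qa) mfps" where
  "kernel = Mfps (hprod (cf tau_Qa))"

lemma hprod_tau: "hprod (cf tau_fps) m = Qa_embed (mcoeff kernel m)"
  by (simp add: kernel_def hprod_def cf_def tau_fps_nth Qa_embed.hom_prod)

text \<open>Both expansions run over partitions of size at most deg m, so independence settles those
  \<mu>. For a larger \<mu> both sides vanish: no divisor of m reaches the degree in which
  \<open>dual_schur \<mu>\<close> begins, and \<mu> fits into no \<kappa>.\<close>

theorem kernel_times_dual_schur:
  assumes \<mu>: "\<mu> \<in> partitions"
  shows "mcoeff (kernel * dual_schur \<mu>) m =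
    (\<Sum>\<kappa>\<in>parts_le (int (mdeg m)). mcoeff (dual_schur \<kappa>) m * total_wt \<kappa> \<mu>)"
proof (cases "\<mu> \<in> parts_le (int (mdeg m))")
  case True
  let ?P = "parts_le (int (mdeg m))"
  let ?C = "\<lambda>\<kappa> w. mcoeff (dual_schur \<kappa>) w"
  let ?h = "h_fps 0"
  have tau0: "fps_nth tau_fps 0 = 1" by (simp add: tau_fps_def)
  have "hprod (cf (?h * tau_fps)) m = (\<Sum>\<kappa>\<in>?P. Qa_embed (?C \<kappa> m) * double_schur_of (?h * tau_fps) \<kappa>)"
    by (rule hprod_expand) (simp_all add: tau0)
  also have "\<dots> = (\<Sum>\<kappa>\<in>?P. \<Sum>\<mu>\<in>?P. Qa_embed (?C \<kappa> m * total_wt \<kappa> \<mu>) * double_schur_of ?h \<mu>)"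
    by (rule sum.cong) (simp_all add: double_schur_of_tau[of ?h _ "int (mdeg m)"] sum_distrib_left Qa_embed.hom_mult mult.assoc)
  also have "\<dots> = (\<Sum>\<mu>\<in>?P. Qa_embed (\<Sum>\<kappa>\<in>?P. ?C \<kappa> m * total_wt \<kappa> \<mu>) * double_schur_of ?h \<mu>)"
    by (subst sum.swap) (simp only: Qa_embed.hom_sum sum_distrib_right)
  finally have 1: "hprod (cf (?h * tau_fps)) m = \<dots>" .
  have "hprod (cf (?h * tau_fps)) m = (\<Sum>(u, w)\<in>splits m. hprod (cf tau_fps) u * hprod (cf ?h) w)"
    by (subst mult.commute, rule hprod_mult) (simp_all add: tau0)
  also have "\<dots> = (\<Sum>p\<in>splits m. \<Sum>\<mu>\<in>?P. Qa_embed (mcoeff kernel (fst p) * ?C \<mu> (snd p)) * double_schur_of ?h \<mu>)"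
  proof (rule sum.cong[OF refl])
    fix p assume p: "p \<in> splits m"
    obtain u w where uw: "p = (u, w)" by (cases p)
    have "mdeg w \<le> mdeg m" using p by (auto simp: uw splits_def mdeg_add)
    then have "hprod (cf ?h) w = (\<Sum>\<mu>\<in>?P. Qa_embed (?C \<mu> w) * double_schur_of ?h \<mu>)"
      by (intro hprod_expand) simp_all
    then show "(case p of (u, w) \<Rightarrow> hprod (cf tau_fps) u * hprod (cf ?h) w) =
        (\<Sum>\<mu>\<in>?P. Qa_embed (mcoeff kernel (fst p) * ?C \<mu> (snd p)) * double_schur_of ?h \<mu>)"
      by (simp add: uw hprod_tau sum_distrib_left Qa_embed.hom_mult mult.assoc)
  qed
  also have "\<dots> = (\<Sum>\<mu>\<in>?P. Qa_embed (mcoeff (kernel * dual_schur \<mu>) m) * double_schur_of ?h \<mu>)"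
    by (subst sum.swap) (simp only: mcoeff_times case_prod_beta Qa_embed.hom_sum sum_distrib_right)
  finally have 2: "hprod (cf (?h * tau_fps)) m = \<dots>" .
  let ?c = "\<lambda>\<mu>. mcoeff (kernel * dual_schur \<mu>) m - (\<Sum>\<kappa>\<in>?P. ?C \<kappa> m * total_wt \<kappa> \<mu>)"
  have "(\<Sum>\<mu>\<in>?P. Qa_embed (?c \<mu>) * double_schur_of ?h \<mu>) = 0"
    using 1 2 by (simp only: Qa_embed.hom_minus left_diff_distrib sum_subtractf) simp
  from double_schur_of_independent[OF this True] show ?thesis by simp
next
  case False
  then have big: "mdeg m < sum_list \<mu>" using \<mu> by (simp add: parts_le_def)
  have "mcoeff (kernel * dual_schur \<mu>) m = 0"
    unfolding mcoeff_times
  proof (rule sum.neutral, clarify)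
    fix u w assume "(u, w) \<in> splits m"
    then have "mdeg w < sum_list \<mu>" using big by (auto simp: splits_def mdeg_add)
    then show "mcoeff kernel u * mcoeff (dual_schur \<mu>) w = 0"
      by (simp add: mcoeff_dual_schur_small[OF \<mu>])
  qed
  moreover have "total_wt \<kappa> \<mu> = 0" if "\<kappa> \<in> parts_le (int (mdeg m))" for \<kappa>
  proof -
    have "\<not> diagram \<mu> \<subseteq> diagram \<kappa>"
      using below_parts_le[OF \<mu> _ that] False by blast
    then have "middle_shapes \<kappa> \<mu> = {}" by (auto simp: middle_shapes_def)
    then show ?thesis by (simp add: total_wt_def)
  qed
  ultimately show ?thesis by simp
qed


section \<open>Toggling the northeastmost box\<close>

lemma part_Cons: "part (x # \<rho>) i = (case i of 0 \<Rightarrow> x | Suc k \<Rightarrow> part \<rho> k)"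
  by (cases i) (simp_all add: part_def)

text \<open>Lets a partition be given by its row lengths, as is done when a single row of a middle
  shape is altered.\<close>

lemma exists_partition:
  assumes "\<And>i. f (Suc i) \<le> f i" "\<And>i. n \<le> i \<Longrightarrow> f i = 0"
  shows "\<exists>\<rho>\<in>partitions. \<forall>i. part \<rho> i = f i"
  using assms
proof (induction n arbitrary: f)
  case 0
  then show ?case by (intro bexI[of _ "[]"]) (auto simp: part_def)
next
  case (Suc n)
  show ?case
  proof (cases "f 0 = 0")
    case True
    have "f i \<le> f 0" for i
      by (induction i) (auto intro: order.trans[OF Suc.prems(1)])
    with True have "f i = 0" for i
      by simp
    then show ?thesis by (intro bexI[of _ "[]"]) (auto simp: part_def)
  next
    case False
    have "\<exists>\<rho>\<in>partitions. \<forall>i. part \<rho> i = f (Suc i)"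
      using Suc.prems by (intro Suc.IH) simp_all
    then obtain \<rho> where \<rho>: "\<rho> \<in> partitions" "\<And>i. part \<rho> i = f (Suc i)"
      by blast
    have "part (f 0 # \<rho>) i = f i" for i
      by (cases i) (simp_all add: part_Cons \<rho>(2))
    moreover have "f 0 # \<rho> \<in> partitions"
    proof -
      have "x \<le> f 0" if "x \<in> set \<rho>" for x
      proof -
        obtain k where "k < length \<rho>" "x = \<rho> ! k" using \<open>x \<in> set \<rho>\<close> by (auto simp: in_set_conv_nth)
        then have "x = part \<rho> k" by (simp add: part_def)
        also have "\<dots> \<le> part \<rho> 0" by (rule part_antimono[OF \<rho>(1)]) simp
        also have "\<dots> \<le> f 0" using \<rho>(2) Suc.prems(1) by simp
        finally show ?thesis .
      qed
      then show ?thesis using \<rho>(1) False by (auto simp: partitions_def)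
    qed
    ultimately show ?thesis by blast
  qed
qed

lemma middle_shapes_iff:
  assumes "\<nu> \<in> partitions" "\<mu> \<in> partitions"
  shows "\<rho> \<in> middle_shapes \<nu> \<mu> \<longleftrightarrow> \<rho> \<in> partitions \<and>
    (\<forall>k. part \<mu> k \<le> part \<rho> k \<and> part \<rho> k \<le> part \<nu> k \<and> part \<nu> k \<le> Suc (part \<rho> k) \<and>
      part \<rho> (Suc k) \<le> part \<mu> k)"
  using horizontal_strip_skew_iff[OF _ assms(2), of \<rho>]
  by (auto simp: middle_shapes_def diagram_subset_iff vertical_strip_skew_iff)

text \<open>Lengthening row i of the middle shape by one box moves this box from the outer strip to
  the inner one. Rows are counted from 0 in \<open>part\<close> and from 1 in boxes, hence the
  \<open>Suc i\<close>.\<close>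

lemma skew_insert:
  assumes "part \<rho> i = k" "\<And>j. j \<noteq> i \<Longrightarrow> part \<sigma> j = part \<rho> j" "part \<sigma> i = Suc k"
  shows "Suc k \<le> part \<nu> i \<Longrightarrow> skew \<nu> \<rho> = insert (Suc i, Suc k) (skew \<nu> \<sigma>)"
    and "part \<mu> i \<le> k \<Longrightarrow> skew \<sigma> \<mu> = insert (Suc i, Suc k) (skew \<rho> \<mu>)"
    and "(Suc i, Suc k) \<notin> skew \<nu> \<sigma>" "(Suc i, Suc k) \<notin> skew \<rho> \<mu>"
proof -
  have cases: "a = Suc i \<or> part \<sigma> (a - 1) = part \<rho> (a - 1)" if "1 \<le> a" for a
    using that assms(2)[of "a - 1"] by (cases "a - 1 = i") auto
  show "skew \<nu> \<rho> = insert (Suc i, Suc k) (skew \<nu> \<sigma>)" if "Suc k \<le> part \<nu> i"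
  proof (rule Set.set_eqI)
    fix p :: "nat \<times> nat"
    obtain a b where p: "p = (a, b)" by (cases p)
    show "p \<in> skew \<nu> \<rho> \<longleftrightarrow> p \<in> insert (Suc i, Suc k) (skew \<nu> \<sigma>)"
      using cases[of a] assms that by (auto simp: p skew_iff)
  qed
  show "skew \<sigma> \<mu> = insert (Suc i, Suc k) (skew \<rho> \<mu>)" if "part \<mu> i \<le> k"
  proof (rule Set.set_eqI)
    fix p :: "nat \<times> nat"
    obtain a b where p: "p = (a, b)" by (cases p)
    show "p \<in> skew \<sigma> \<mu> \<longleftrightarrow> p \<in> insert (Suc i, Suc k) (skew \<rho> \<mu>)"
      using cases[of a] assms that by (auto simp: p skew_iff)
  qed
  show "(Suc i, Suc k) \<notin> skew \<nu> \<sigma>" "(Suc i, Suc k) \<notin> skew \<rho> \<mu>"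
    using assms by (auto simp: skew_iff)
qed

lemma northeastmost_skew:
  assumes "\<And>k. k < i \<Longrightarrow> part \<mu> k = part \<nu> k" "part \<mu> i < part \<nu> i"
  shows "northeastmost (skew \<nu> \<mu>) = (Suc i, part \<nu> i)"
proof -
  have mem: "(Suc i, part \<nu> i) \<in> skew \<nu> \<mu>" using assms(2) by (simp add: skew_iff)
  have "Min (fst ` skew \<nu> \<mu>) = Suc i"
  proof (rule Min_eqI)
    show "finite (fst ` skew \<nu> \<mu>)" using finite_skew by simp
    show "Suc i \<in> fst ` skew \<nu> \<mu>" using mem by (force simp: image_iff)
    fix y assume "y \<in> fst ` skew \<nu> \<mu>"
    then obtain j where j: "(y, j) \<in> skew \<nu> \<mu>" by auto
    show "Suc i \<le> y"
    proof (rule ccontr)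
      assume "\<not> Suc i \<le> y"
      moreover have "1 \<le> y" using j by (simp add: skew_iff)
      ultimately have "y - 1 < i" by simp
      from assms(1)[OF this] show False using j by (auto simp: skew_iff)
    qed
  qed
  moreover have "{j. (Suc i, j) \<in> skew \<nu> \<mu>} = {part \<mu> i<..part \<nu> i}"
    by (auto simp: skew_iff)
  moreover have "Max {part \<mu> i<..part \<nu> i} = part \<nu> i"
    using assms(2) by (intro Max_eqI) auto
  ultimately show ?thesis by (simp add: northeastmost_def Let_def)
qed

lemma wt_insert_left:
  "finite A \<Longrightarrow> (Suc i, Suc k) \<notin> A \<Longrightarrow>
    wt (insert (Suc i, Suc k) A, B) = (avar (int k - int i + 1) - avar 0) * wt (A, B)"
proof -
  have c: "int (Suc k) - int (Suc i) + 1 = int k - int i + 1" by simp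
  assume A: "finite A" "(Suc i, Suc k) \<notin> A"
  show ?thesis
    unfolding wt_def fst_conv snd_conv prod.insert[OF A] case_prod_conv c by (rule mult.assoc)
qed

lemma wt_insert_right:
  "finite B \<Longrightarrow> (Suc i, Suc k) \<notin> B \<Longrightarrow>
    wt (A, insert (Suc i, Suc k) B) = (avar 1 - avar (int k - int i + 1)) * wt (A, B)"
proof -
  have c: "int (Suc k) - int (Suc i) + 1 = int k - int i + 1" by simp
  assume B: "finite B" "(Suc i, Suc k) \<notin> B"
  show ?thesis
    unfolding wt_def fst_conv snd_conv prod.insert[OF B] case_prod_conv c by (rule mult.left_commute)
qed

text \<open>
  The northeastmost box may sit in either strip, independently of the other boxes, and the two
  possible factors \<open>a\<^sub>c\<^sub>+\<^sub>1 - a\<^sub>0\<close> and \<open>a\<^sub>1 - a\<^sub>c\<^sub>+\<^sub>1\<close> add up to \<open>a\<^sub>1 - a\<^sub>0\<close>.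
\<close>

theorem total_wt_eq_D_minus:
  assumes \<nu>: "\<nu> \<in> partitions" and \<mu>: "\<mu> \<in> partitions" and ne: "\<nu> \<noteq> \<mu>"
  shows "total_wt \<nu> \<mu> = (avar 1 - avar 0) * (\<Sum>E\<in>D_minus \<nu> \<mu>. wt E)"
proof (cases "diagram \<mu> \<subseteq> diagram \<nu>")
  case False
  then have "middle_shapes \<nu> \<mu> = {}" by (auto simp: middle_shapes_def)
  moreover have "Lambda_decompositions \<nu> \<mu> = {}"
    using False by (auto simp: Lambda_decompositions_def)
  ultimately show ?thesis by (simp add: total_wt_def D_minus_def)
next
  case True
  then have le: "part \<mu> k \<le> part \<nu> k" for k by (simp add: diagram_subset_iff)
  have "\<exists>k. part \<mu> k \<noteq> part \<nu> k"
    using partition_eqI[OF \<nu> \<mu>] ne by metis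
  \<comment> \<open>The top row in which \<nu> and \<mu> differ; the northeastmost box is its last
    one.\<close>
  define i where "i = (LEAST k. part \<mu> k \<noteq> part \<nu> k)"
  have i_neq: "part \<mu> i \<noteq> part \<nu> i"
    unfolding i_def by (rule LeastI_ex) fact
  have i_eq: "part \<mu> k = part \<nu> k" if "k < i" for k
    using not_less_Least[OF that[unfolded i_def]] by blast
  have i_lt: "part \<mu> i < part \<nu> i" using i_neq le[of i] by simp
  then obtain k where k: "part \<nu> i = Suc k" by (cases "part \<nu> i") auto
  have k_ge: "part \<mu> i \<le> k" using i_lt k by simp
  let ?b = "(Suc i, Suc k)"
  have NE: "northeastmost (skew \<nu> \<mu>) = ?b"
    using northeastmost_skew[of i \<mu> \<nu>] i_eq i_lt k by simp
  have nonempty: "skew \<nu> \<mu> \<noteq> {}"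
  proof -
    have "?b \<in> skew \<nu> \<mu>" using k k_ge by (simp add: skew_iff)
    then show ?thesis by blast
  qed
  let ?R = "middle_shapes \<nu> \<mu>"
  let ?pair = "\<lambda>\<rho>. (skew \<nu> \<rho>, skew \<rho> \<mu>)"
  let ?\<phi> = "\<lambda>\<rho>. (skew \<nu> \<rho> - {?b}, skew \<rho> \<mu> - {?b})"
  \<comment> \<open>In \<open>RA\<close> the northeastmost box belongs to the vertical strip, in
    \<open>RB\<close> to the horizontal strip.\<close>
  define RA where "RA = {\<rho> \<in> ?R. part \<rho> i = k}"
  define RB where "RB = {\<rho> \<in> ?R. part \<rho> i = Suc k}"
  note R = middle_shapes_iff[OF \<nu> \<mu>]
  have finR: "finite ?R"
    using finite_below[OF \<nu>, of "\<lambda>_. True"] by (rule finite_subset[rotated]) (auto simp: middle_shapes_def)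
  have R_split: "?R = RA \<union> RB" "RA \<inter> RB = {}"
  proof -
    have "part \<rho> i = k \<or> part \<rho> i = Suc k" if "\<rho> \<in> ?R" for \<rho>
    proof -
      have "part \<rho> i \<le> part \<nu> i" "part \<nu> i \<le> Suc (part \<rho> i)"
        using that unfolding R by blast+
      then show ?thesis using k by auto
    qed
    then show "?R = RA \<union> RB" by (auto simp: RA_def RB_def)
    show "RA \<inter> RB = {}" by (auto simp: RA_def RB_def)
  qed
  \<comment> \<open>Row i may have either length whatever the other rows are. Above row i the shapes
    \<mu> and \<nu> agree, so row i of \<nu> is no longer than the row of \<mu> above it; and row i
    + 1 of the middle shape is at most \<mu>_i \<le> k.\<close>
  have toggle: "\<exists>\<sigma>\<in>?R. part \<sigma> i = v \<and> (\<forall>j. j \<noteq> i \<longrightarrow> part \<sigma> j = part \<rho> j)"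
    if \<rho>: "\<rho> \<in> ?R" and v: "v = k \<or> v = Suc k" for \<rho> v
  proof -
    let ?f = "\<lambda>j. if j = i then v else part \<rho> j"
    have \<rho>R: "\<rho> \<in> partitions" "part \<mu> j \<le> part \<rho> j" "part \<rho> j \<le> part \<nu> j" "part \<nu> j \<le> Suc (part \<rho> j)"
      "part \<rho> (Suc j) \<le> part \<mu> j" for j
      using \<rho> unfolding R by blast+
    have \<nu>_next: "v \<le> part \<mu> j" if "Suc j = i" for j
    proof -
      have "v \<le> part \<nu> i" using v k by auto
      also have "\<dots> \<le> part \<nu> j" using part_antimono[OF \<nu>, of j i] that by simp
      also have "\<dots> = part \<mu> j" using i_eq[of j] that by simp
      finally show ?thesis .
    qed
    have \<rho>_next: "part \<rho> (Suc i) \<le> v"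
      using \<rho>R(5)[of i] k_ge v by auto
    have "?f (Suc j) \<le> ?f j" for j
      using \<nu>_next[of j] \<rho>R(2)[of j] \<rho>_next part_antimono[OF \<rho>R(1), of j "Suc j"] by auto
    moreover have "?f j = 0" if "length \<nu> + length \<rho> \<le> j" for j
    proof -
      have "j \<noteq> i" using that k part_pos_iff[OF \<nu>, of i] by auto
      then show ?thesis using that by (simp add: part_def)
    qed
    ultimately have "\<exists>\<sigma>\<in>partitions. \<forall>j. part \<sigma> j = ?f j"
      by (rule exists_partition)
    then obtain \<sigma> where \<sigma>: "\<sigma> \<in> partitions" "\<And>j. part \<sigma> j = ?f j"
      by blast
    have "part \<mu> j \<le> part \<sigma> j \<and> part \<sigma> j \<le> part \<nu> j \<and> part \<nu> j \<le> Suc (part \<sigma> j) \<and>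
        part \<sigma> (Suc j) \<le> part \<mu> j" for j
      using \<rho>R(2-5)[of j] \<nu>_next[of j] k k_ge v by (auto simp: \<sigma>(2))
    then have "\<sigma> \<in> ?R" unfolding R using \<sigma>(1) by blast
    then show ?thesis using \<sigma>(2) by (intro bexI[of _ \<sigma>]) auto
  qed
  define up where "up \<rho> = (SOME \<sigma>. \<sigma> \<in> ?R \<and> part \<sigma> i = Suc k \<and> (\<forall>j. j \<noteq> i \<longrightarrow> part \<sigma> j = part \<rho> j))" for \<rho>
  have up: "up \<rho> \<in> ?R" "part (up \<rho>) i = Suc k" "\<And>j. j \<noteq> i \<Longrightarrow> part (up \<rho>) j = part \<rho> j" if "\<rho> \<in> ?R" for \<rho>
  proof -
    have "\<exists>\<sigma>. \<sigma> \<in> ?R \<and> part \<sigma> i = Suc k \<and> (\<forall>j. j \<noteq> i \<longrightarrow> part \<sigma> j = part \<rho> j)"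
      using toggle[OF that, of "Suc k"] by blast
    from someI_ex[OF this, folded up_def]
    show "up \<rho> \<in> ?R" "part (up \<rho>) i = Suc k" "\<And>j. j \<noteq> i \<Longrightarrow> part (up \<rho>) j = part \<rho> j" by blast+
  qed
  have RA: "\<rho> \<in> ?R" "\<rho> \<in> partitions" "part \<rho> i = k" if "\<rho> \<in> RA" for \<rho>
    using that unfolding RA_def R by blast+
  have inj_up: "inj_on up RA"
  proof (rule inj_onI)
    fix \<rho> \<rho>' assume \<rho>: "\<rho> \<in> RA" and \<rho>': "\<rho>' \<in> RA" and eq: "up \<rho> = up \<rho>'"
    show "\<rho> = \<rho>'"
    proof (rule partition_eqI)
      fix j
      show "part \<rho> j = part \<rho>' j"
      proof (cases "j = i")
        case False
        then show ?thesis
          using up(3)[OF RA(1)[OF \<rho>], of j] up(3)[OF RA(1)[OF \<rho>'], of j] eq by simp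
      qed (simp add: RA(3) \<rho> \<rho>')
    qed (simp_all add: RA(2) \<rho> \<rho>')
  qed
  have RB_up: "RB = up ` RA"
  proof (intro equalityI subsetI)
    fix \<sigma> assume \<sigma>: "\<sigma> \<in> RB"
    then have \<sigma>R: "\<sigma> \<in> ?R" "part \<sigma> i = Suc k" by (auto simp: RB_def)
    obtain \<rho> where \<rho>: "\<rho> \<in> ?R" "part \<rho> i = k" "\<And>j. j \<noteq> i \<Longrightarrow> part \<rho> j = part \<sigma> j"
      using toggle[OF \<sigma>R(1), of k] by blast
    have "up \<rho> = \<sigma>"
    proof (rule partition_eqI)
      show "up \<rho> \<in> partitions" "\<sigma> \<in> partitions"
        using up(1)[OF \<rho>(1)] \<sigma>R(1) unfolding R by blast+
      show "part (up \<rho>) j = part \<sigma> j" for j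
        using up(2,3)[OF \<rho>(1)] \<rho>(3) \<sigma>R(2) by (cases "j = i") simp_all
    qed
    then show "\<sigma> \<in> up ` RA" using \<rho> by (auto simp: RA_def)
  next
    fix \<sigma> assume "\<sigma> \<in> up ` RA"
    then show "\<sigma> \<in> RB" using up RA(1) by (auto simp: RB_def)
  qed
  have sk: "skew \<nu> \<rho> = insert ?b (skew \<nu> (up \<rho>))" "skew (up \<rho>) \<mu> = insert ?b (skew \<rho> \<mu>)"
    "?b \<notin> skew \<nu> (up \<rho>)" "?b \<notin> skew \<rho> \<mu>" if "\<rho> \<in> RA" for \<rho>
    using skew_insert[OF RA(3)[OF that] up(3)[OF RA(1)[OF that]] up(2)[OF RA(1)[OF that]]] k k_ge
    by simp_all
  have \<phi>: "?\<phi> \<rho> = (skew \<nu> (up \<rho>), skew \<rho> \<mu>)" "?\<phi> (up \<rho>) = ?\<phi> \<rho>" if "\<rho> \<in> RA" for \<rho>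
    using sk[OF that] by simp_all
  have two: "wt (?pair \<rho>) + wt (?pair (up \<rho>)) = (avar 1 - avar 0) * wt (?\<phi> \<rho>)" if \<rho>: "\<rho> \<in> RA" for \<rho>
  proof -
    let ?w = "wt (skew \<nu> (up \<rho>), skew \<rho> \<mu>)"
    have w1: "wt (?pair \<rho>) = (avar (int k - int i + 1) - avar 0) * ?w"
      unfolding sk(1)[OF \<rho>] by (rule wt_insert_left[OF finite_skew sk(3)[OF \<rho>]])
    have w2: "wt (?pair (up \<rho>)) = (avar 1 - avar (int k - int i + 1)) * ?w"
      unfolding sk(2)[OF \<rho>] by (rule wt_insert_right[OF finite_skew sk(4)[OF \<rho>]])
    show ?thesis
      unfolding w1 w2 \<phi>(1)[OF \<rho>] by (simp only: distrib_right[symmetric]) simp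
  qed
  have inj_\<phi>: "inj_on ?\<phi> RA"
  proof (rule inj_onI)
    fix \<rho> \<rho>' assume \<rho>: "\<rho> \<in> RA" and \<rho>': "\<rho>' \<in> RA" and eq: "?\<phi> \<rho> = ?\<phi> \<rho>'"
    then have eq': "skew \<rho> \<mu> = skew \<rho>' \<mu>" using \<phi>(1)[OF \<rho>] \<phi>(1)[OF \<rho>'] by simp
    have "diagram \<mu> \<subseteq> diagram \<rho>" "diagram \<mu> \<subseteq> diagram \<rho>'"
      using RA(1)[OF \<rho>] RA(1)[OF \<rho>'] by (auto simp: middle_shapes_def)
    then have "diagram \<rho> = diagram \<rho>'"
      using eq' unfolding skew_def by blast
    then show "\<rho> = \<rho>'" using diagram_inject RA(2) \<rho> \<rho>' by blast
  qed
  have LD: "Lambda_decompositions \<nu> \<mu> = ?pair ` ?R"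
    unfolding Lambda_decompositions_def middle_shapes_def by auto
  have D_R: "D_minus \<nu> \<mu> = ?\<phi> ` ?R"
  proof (intro equalityI subsetI)
    fix E assume "E \<in> D_minus \<nu> \<mu>"
    then obtain A B where E: "E = (A - {?b}, B - {?b})" and "(A, B) \<in> Lambda_decompositions \<nu> \<mu>"
      unfolding D_minus_def NE by auto
    then obtain \<rho> where "\<rho> \<in> ?R" "(A, B) = ?pair \<rho>"
      unfolding LD by auto
    then show "E \<in> ?\<phi> ` ?R"
      using E by (intro image_eqI[of _ _ \<rho>]) simp_all
  next
    fix E assume "E \<in> ?\<phi> ` ?R"
    then obtain \<rho> where \<rho>: "\<rho> \<in> ?R" and E: "E = ?\<phi> \<rho>"
      by auto
    have "?pair \<rho> \<in> Lambda_decompositions \<nu> \<mu>"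
      unfolding LD using \<rho> by (rule imageI)
    then show "E \<in> D_minus \<nu> \<mu>"
      unfolding D_minus_def NE E using nonempty by auto
  qed
  \<comment> \<open>A shape and its toggled partner yield the same pair once the box is removed, so
    the distinct pairs are already obtained from \<open>RA\<close>.\<close>
  have "?\<phi> ` up ` RA = ?\<phi> ` RA"
    unfolding image_image by (rule image_cong[OF refl \<phi>(2)])
  then have D: "D_minus \<nu> \<mu> = ?\<phi> ` RA"
    unfolding D_R R_split(1) RB_up image_Un by (simp only: Un_absorb)
  have fin: "finite RA" "finite RB" using finR R_split(1) by simp_all
  have sumR: "total_wt \<nu> \<mu> = (\<Sum>\<rho>\<in>RA. wt (?pair \<rho>)) + (\<Sum>\<rho>\<in>RB. wt (?pair \<rho>))"
    unfolding total_wt_def R_split(1) by (rule sum.union_disjoint[OF fin R_split(2)])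
  have sumB: "(\<Sum>\<rho>\<in>RB. wt (?pair \<rho>)) = (\<Sum>\<rho>\<in>RA. wt (?pair (up \<rho>)))"
    unfolding RB_up by (subst sum.reindex[OF inj_up]) (simp only: o_def)
  have sumA: "(\<Sum>\<rho>\<in>RA. wt (?pair \<rho>) + wt (?pair (up \<rho>))) = (\<Sum>\<rho>\<in>RA. (avar 1 - avar 0) * wt (?\<phi> \<rho>))"
    by (rule sum.cong[OF refl two])
  have sumD: "(\<Sum>E\<in>D_minus \<nu> \<mu>. wt E) = (\<Sum>\<rho>\<in>RA. wt (?\<phi> \<rho>))"
    unfolding D by (subst sum.reindex[OF inj_\<phi>]) (simp only: o_def)
  show ?thesis
    unfolding sumR sumB sumD sum.distrib[symmetric] sumA sum_distrib_left ..
qed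

lemma D_minus_self: "D_minus \<mu> \<mu> = {}"
  by (simp add: D_minus_def skew_def)

lemma total_wt_self:
  assumes "\<mu> \<in> partitions"
  shows "total_wt \<mu> \<mu> = 1"
proof -
  have "middle_shapes \<mu> \<mu> = {\<mu>}"
    using assms diagram_inject[OF _ assms]
    by (auto simp: middle_shapes_def skew_def vertical_strip_def horizontal_strip_def)
  then show ?thesis by (simp add: total_wt_def skew_def wt_def)
qed

section \<open>The dual Schur function of one box\<close>

lemma wt_eq_0_left: "finite A \<Longrightarrow> (i, j) \<in> A \<Longrightarrow> int j - int i + 1 = 0 \<Longrightarrow> wt (A, B) = 0"
  by (auto simp: wt_def intro!: prod_zero bexI[of _ "(i, j)"])

lemma wt_eq_0_right: "finite B \<Longrightarrow> (i, i) \<in> B \<Longrightarrow> wt (A, B) = 0"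
  by (auto simp: wt_def intro!: prod_zero bexI[of _ "(i, i)"])

lemma part_Nil [simp]: "part [] i = 0"
  by (simp add: part_def)

text \<open>A nonempty middle shape puts the box (1, 1), of weight a_1 - a_1, into the horizontal
  strip. The empty middle shape forces \<nu> to be a single column, and a second box (2, 1) in it
  has weight a_0 - a_0.\<close>

lemma total_wt_Nil:
  assumes \<nu>: "\<nu> \<in> partitions"
  shows "total_wt \<nu> [] = (if \<nu> = [] then 1 else if \<nu> = [1] then avar 1 - avar 0 else 0)"
proof (cases "\<nu> = []")
  case False
  have pos: "0 < part \<nu> 0" using part_pos_iff[OF \<nu>, of 0] False by simp
  have other: "wt (skew \<nu> \<rho>, skew \<rho> []) = 0" if "\<rho> \<in> middle_shapes \<nu> [] - {[]}" for \<rho>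
  proof -
    have \<rho>: "\<rho> \<in> partitions" "\<rho> \<noteq> []" using that by (auto simp: middle_shapes_def)
    then have "0 < part \<rho> 0" using part_pos_iff[OF \<rho>(1), of 0] by simp
    then have "(1, 1) \<in> skew \<rho> []" by (simp add: skew_iff)
    then show ?thesis by (rule wt_eq_0_right[OF finite_skew])
  qed
  have mem: "[] \<in> middle_shapes \<nu> [] \<longleftrightarrow> part \<nu> 0 \<le> 1"
    using part_antimono[OF \<nu>, of 0]
    by (auto simp: middle_shapes_iff[OF \<nu>] intro: order.trans)
  have fin: "finite (middle_shapes \<nu> [])"
    using finite_below[OF \<nu>, of "\<lambda>_. True"] by (rule finite_subset[rotated]) (auto simp: middle_shapes_def)
  have total: "total_wt \<nu> [] = (if part \<nu> 0 \<le> 1 then wt (skew \<nu> [], skew [] []) else 0)"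
  proof (cases "part \<nu> 0 \<le> 1")
    case True
    then have m: "[] \<in> middle_shapes \<nu> []" using mem by simp
    have "(\<Sum>\<rho>\<in>middle_shapes \<nu> [] - {[]}. wt (skew \<nu> \<rho>, skew \<rho> [])) = 0"
      by (intro sum.neutral ballI other)
    then show ?thesis
      using True sum.remove[OF fin m, of "\<lambda>\<rho>. wt (skew \<nu> \<rho>, skew \<rho> [])"] by (simp add: total_wt_def)
  next
    case no: False
    then have "middle_shapes \<nu> [] - {[]} = middle_shapes \<nu> []" using mem by blast
    then show ?thesis using no other by (simp add: total_wt_def)
  qed
  show ?thesis
  proof (cases "\<nu> = [1]")
    case True
    have "skew [1] [] = {(1, 1)}" by (auto simp: skew_iff part_def split: if_splits)
    moreover have "skew [] [] = {}" by (simp add: skew_def)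
    ultimately show ?thesis
      using total True by (simp add: part_def wt_def)
  next
    case neq: False
    have "total_wt \<nu> [] = 0"
    proof (cases "part \<nu> 0 \<le> 1")
      case True
      have "0 < part \<nu> 1"
      proof (rule ccontr)
        assume "\<not> 0 < part \<nu> 1"
        then have "length \<nu> \<le> 1" using part_pos_iff[OF \<nu>, of 1] by simp
        then obtain x where "\<nu> = [x]" using False by (cases \<nu>) auto
        then show False using True pos neq by (simp add: part_def)
      qed
      then have "(2, 1) \<in> skew \<nu> []" by (simp add: skew_iff)
      then show ?thesis using total wt_eq_0_left[OF finite_skew, of 2 1 \<nu> "[]"] by simp
    qed (simp add: total)
    then show ?thesis using False neq by simp
  qed
qed (simp add: total_wt_self)

lemma e_fps_degree: "0 \<le> l \<Longrightarrow> l < int n \<Longrightarrow> fps_nth (e_fps l) n = 0"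
proof (induction l arbitrary: n rule: int_ge_induct)
  case (step l)
  have "e_fps (l + 1) = e_fps l - fps_const (a_xa (l + 1)) * (fps_X * e_fps l)"
    by (simp add: e_fps_step lin_fps_def right_diff_distrib mult_ac)
  then show ?case
    using step.IH[of n] step.IH[of "n - 1"] step.prems step.hyps by simp
qed simp

text \<open>For G = 1 the first row consists of coefficients of e_l with l = \<nu>_1 - 1, in degrees
  l + 1 and higher. Since l \<ge> 0, this is a polynomial of degree at most l, so the row is
  zero.\<close>

lemma double_schur_of_one: "\<nu> \<in> partitions \<Longrightarrow> double_schur_of 1 \<nu> = (if \<nu> = [] then 1 else 0)"
proof (cases "\<nu> = []")
  case False
  assume \<nu>: "\<nu> \<in> partitions"
  let ?n = "length \<nu>"
  let ?A = "mat ?n ?n (\<lambda>(i, j). cf (1 * e_fps (int (part \<nu> i) - int i - 1)) (int (part \<nu> i) - int i + int j))"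
  have pos: "0 < part \<nu> 0" using part_pos_iff[OF \<nu>, of 0] False by simp
  have row: "?A $$ (0, j) = 0" if "j < ?n" for j
    using that pos False e_fps_degree[of "int (part \<nu> 0) - 1" "part \<nu> 0 + j"]
    by (simp add: cf_def nat_add_distrib)
  have "det ?A = (\<Sum>j<?n. ?A $$ (0, j) * cofactor ?A 0 j)"
    using False by (intro laplace_expansion_row) auto
  also have "\<dots> = 0"
    using row by (intro sum.neutral) (simp del: index_mat)
  finally show ?thesis using False by (simp add: double_schur_of_def Jt_def jt_def)
qed (simp add: double_schur_of_def Jt_def jt_def)

text \<open>At G = 1 all determinants but that of the empty partition vanish, so the expansion of
  \<open>hprod\<close> reduces to the coefficient of \<open>dual_schur []\<close>.\<close>

lemma dual_schur_Nil: "dual_schur [] = 1"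
proof (rule mfps_eqI)
  fix m :: "nat \<Rightarrow>\<^sub>0 nat"
  let ?P = "parts_le (int (mdeg m))"
  have Nil: "[] \<in> ?P" by (simp add: parts_le_def)
  have "hprod (cf 1 :: int \<Rightarrow> xa_series) m = (if m = 0 then 1 else 0)"
  proof (cases "m = 0")
    case False
    then obtain k where "k \<in> Poly_Mapping.keys m" by fastforce
    then show ?thesis
      using False unfolding hprod_def by (intro trans[OF prod_zero]) (auto simp: cf_def in_keys_iff)
  qed (simp add: hprod_def)
  moreover have "hprod (cf 1) m = (\<Sum>\<mu>\<in>?P. Qa_embed (mcoeff (dual_schur \<mu>) m) * double_schur_of 1 \<mu>)"
    by (rule hprod_expand) simp_all
  moreover have "\<dots> = (\<Sum>\<mu>\<in>?P. if \<mu> = [] then Qa_embed (mcoeff (dual_schur \<mu>) m) else 0)"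
    by (intro sum.cong) (auto simp: double_schur_of_one parts_le_def)
  moreover have "\<dots> = Qa_embed (mcoeff (dual_schur []) m)"
    using Nil by simp
  ultimately have "Qa_embed (mcoeff (dual_schur []) m - (if m = 0 then 1 else 0)) = 0"
    by (simp add: Qa_embed.hom_minus)
  then have "mcoeff (dual_schur []) m - (if m = 0 then 1 else 0) = 0"
    by (simp only: Qa_embed_eq_0_iff)
  then show "mcoeff (dual_schur []) m = mcoeff 1 m" by simp
qed

lemma kernel_eq: "kernel = 1 + mconst (avar 1 - avar 0) * dual_schur [1]"
proof (rule mfps_eqI)
  fix m :: "nat \<Rightarrow>\<^sub>0 nat"
  let ?P = "parts_le (int (mdeg m))"
  let ?C = "\<lambda>\<kappa>. mcoeff (dual_schur \<kappa>) m"
  have one: "[1] \<in> partitions" by (simp add: partitions_def)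
  have Nil: "[] \<in> ?P" by (simp add: parts_le_def)
  have "mcoeff kernel m = (\<Sum>\<kappa>\<in>?P. ?C \<kappa> * total_wt \<kappa> [])"
    using kernel_times_dual_schur[of "[]" m] by (simp add: dual_schur_Nil)
  also have "\<dots> = (\<Sum>\<kappa>\<in>?P. (if \<kappa> = [] then ?C \<kappa> else 0) + (if \<kappa> = [1] then ?C \<kappa> * (avar 1 - avar 0) else 0))"
    by (intro sum.cong) (auto simp: total_wt_Nil parts_le_def)
  also have "\<dots> = ?C [] + (if [1] \<in> ?P then ?C [1] * (avar 1 - avar 0) else 0)"
    using Nil by (simp add: sum.distrib)
  \<comment> \<open>For m = 0 the partition \<open>[1]\<close> is outside the index set, but then
    its dual Schur function has no coefficient at m either.\<close>
  also have "(if [1] \<in> ?P then ?C [1] * (avar 1 - avar 0) else 0) = ?C [1] * (avar 1 - avar 0)"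
    using mcoeff_dual_schur_small[OF one, of m] one by (auto simp: parts_le_def)
  finally show "mcoeff kernel m = mcoeff (1 + mconst (avar 1 - avar 0) * dual_schur [1]) m"
    by (simp only: dual_schur_Nil mcoeff_simps mcoeff_mconst_times mult.commute[of "?C [1]"])
qed

lemma avar_diff_nonzero: "avar 1 - avar 0 \<noteq> 0"
proof
  let ?e = "\<lambda>i :: int. Poly_Mapping.single i (1 :: nat)"
  have e: "?e 0 \<noteq> ?e 1"
  proof
    assume "?e 0 = ?e 1"
    from arg_cong[OF this, of "\<lambda>p. Poly_Mapping.lookup p 0"] show False
      by (simp add: lookup_single)
  qed
  assume "avar 1 - avar 0 = 0"
  from arg_cong[OF this, of "\<lambda>p. Poly_Mapping.lookup p (?e 1)"] show False
    using e by (simp add: avar_def lookup_minus lookup_single when_def)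
qed

text \<open>The summand 1 of the kernel accounts for \<nu> = \<mu>, where the total weight is 1 and
  there is no box to remove. All other terms carry the factor a_1 - a_0, which is cancelled at each
  monomial because \<rat>[a] has no zero divisors.\<close>

lemma mcoeff_one_box_times:
  assumes \<mu>: "\<mu> \<in> partitions"
  shows "mcoeff (dual_schur [1] * dual_schur \<mu>) m =
    (\<Sum>\<nu>\<in>parts_le (int (mdeg m)). (\<Sum>E\<in>D_minus \<nu> \<mu>. wt E) * mcoeff (dual_schur \<nu>) m)"
proof -
  let ?P = "parts_le (int (mdeg m))"
  define C where "C \<nu> = mcoeff (dual_schur \<nu>) m" for \<nu>
  define d where "d = avar 1 - avar 0"
  define W where "W \<nu> = (\<Sum>E\<in>D_minus \<nu> \<mu>. wt E)" for \<nu>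
  have split: "C \<nu> * total_wt \<nu> \<mu> = d * (W \<nu> * C \<nu>) + (if \<nu> = \<mu> then C \<mu> else 0)"
    if "\<nu> \<in> ?P" for \<nu>
  proof (cases "\<nu> = \<mu>")
    case True
    have "W \<mu> = 0" by (simp add: W_def D_minus_self)
    then show ?thesis using True by (simp add: total_wt_self[OF \<mu>])
  next
    case False
    have "\<nu> \<in> partitions" using that by (simp add: parts_le_def)
    from total_wt_eq_D_minus[OF this \<mu> False] have "total_wt \<nu> \<mu> = d * W \<nu>"
      by (simp only: d_def W_def)
    then show ?thesis using False by (simp only: mult_ac if_False add_0_right)
  qed
  have C\<mu>: "(if \<mu> \<in> ?P then C \<mu> else 0) = C \<mu>"
    using mcoeff_dual_schur_small[OF \<mu>, of m] \<mu> by (auto simp: parts_le_def C_def)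
  have "kernel * dual_schur \<mu> = mconst d * (dual_schur [1] * dual_schur \<mu>) + dual_schur \<mu>"
    unfolding kernel_eq d_def by (simp only: distrib_right mult.assoc mult_1_left add.commute)
  then have eq1: "mcoeff (kernel * dual_schur \<mu>) m = d * mcoeff (dual_schur [1] * dual_schur \<mu>) m + C \<mu>"
    by (simp only: mcoeff_simps mcoeff_mconst_times C_def)
  have eq2: "mcoeff (kernel * dual_schur \<mu>) m = (\<Sum>\<nu>\<in>?P. C \<nu> * total_wt \<nu> \<mu>)"
    unfolding C_def by (rule kernel_times_dual_schur[OF \<mu>])
  have eq3: "(\<Sum>\<nu>\<in>?P. C \<nu> * total_wt \<nu> \<mu>) =
      (\<Sum>\<nu>\<in>?P. d * (W \<nu> * C \<nu>) + (if \<nu> = \<mu> then C \<mu> else 0))"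
    by (rule sum.cong[OF refl split])
  have "(\<Sum>\<nu>\<in>?P. if \<nu> = \<mu> then C \<mu> else 0) = C \<mu>"
    using C\<mu> by (simp only: sum.delta finite_parts_le)
  then have eq4: "(\<Sum>\<nu>\<in>?P. d * (W \<nu> * C \<nu>) + (if \<nu> = \<mu> then C \<mu> else 0)) =
      d * (\<Sum>\<nu>\<in>?P. W \<nu> * C \<nu>) + C \<mu>"
    by (simp only: sum.distrib sum_distrib_left)
  have "d * mcoeff (dual_schur [1] * dual_schur \<mu>) m = d * (\<Sum>\<nu>\<in>?P. W \<nu> * C \<nu>)"
    by (rule add_right_imp_eq[of _ "C \<mu>"]) (simp only: eq1[symmetric] eq2 eq3 eq4)
  moreover have "d \<noteq> 0"
    unfolding d_def by (rule avar_diff_nonzero)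
  ultimately have "mcoeff (dual_schur [1] * dual_schur \<mu>) m = (\<Sum>\<nu>\<in>?P. W \<nu> * C \<nu>)"
    by (simp only: mult_cancel_left simp_thms)
  then show ?thesis by (simp only: W_def C_def)
qed

theorem theorem6p14:
  fixes \<mu> :: "nat list"
  assumes "\<mu> \<in> partitions"
  shows "has_formal_sum
    (\<lambda>\<nu>. \<Sum>E \<in> D_minus \<nu> \<mu>. mconst (wt E) * dual_schur \<nu>)
    partitions
    (dual_schur [1] * dual_schur \<mu>)"
proof -
  have coeff: "mcoeff (\<Sum>E\<in>D_minus \<nu> \<mu>. mconst (wt E) * dual_schur \<nu>) m =
      (\<Sum>E\<in>D_minus \<nu> \<mu>. wt E) * mcoeff (dual_schur \<nu>) m" for \<nu> m
    by (simp only: mcoeff_sum mcoeff_mconst_times sum_distrib_right)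
  \<comment> \<open>The dual Schur function of \<nu> begins in degree |\<nu>|, so only finitely many
    \<nu> contribute at a given monomial.\<close>
  have zero: "mcoeff (\<Sum>E\<in>D_minus \<nu> \<mu>. mconst (wt E) * dual_schur \<nu>) m = 0"
    if \<nu>: "\<nu> \<in> partitions" "\<nu> \<notin> parts_le (int (mdeg m))" for \<nu> m
  proof -
    have "mdeg m < sum_list \<nu>"
      using \<nu> by (simp add: parts_le_def)
    then have "mcoeff (dual_schur \<nu>) m = 0"
      by (rule mcoeff_dual_schur_small[OF \<nu>(1)])
    then show ?thesis
      by (simp only: coeff mult_zero_right)
  qed
  have sub: "parts_le (int (mdeg m)) \<subseteq> partitions" for m :: "nat \<Rightarrow>\<^sub>0 nat"
    unfolding parts_le_def by (rule Collect_subset)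
  have total: "mcoeff (dual_schur [1] * dual_schur \<mu>) m =
      (\<Sum>\<nu>\<in>parts_le (int (mdeg m)). mcoeff (\<Sum>E\<in>D_minus \<nu> \<mu>. mconst (wt E) * dual_schur \<nu>) m)" for m
    by (simp only: coeff mcoeff_one_box_times[OF assms])
  show ?thesis
    by (rule has_formal_sumI[OF finite_parts_le sub zero total])
qed

end
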